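(* Let $\Xi=\{\xi_k\}_{k\in\mathbb{Z}}$ be a stationary centered complex Gaussian process with $\gamma(0)=1$ and spectral measure $F$, let $X_\Xi(z)=\sum_{k\ge 0}\xi_k z^k$, and let $\rho_1$ be the $1$-intensity of the zeros of $X_\Xi$ in the unit disk. Fix $\phi$ and let $F_\phi(ds)=F(d(s+\phi))$ on $(-\pi,\pi]$ modulo $2\pi$. Suppose that $F_\phi(ds)=f_\phi(s)\,ds$ with $f_\phi\ge 0$ and that $f_\phi(s)$ is smooth at $s=0$ (i.e. $C^\infty$ in a neighbourhood of $0$). Let $\hat f_\phi$ and $\check f_\phi$ be the symmetrization and anti-symmetrization of $f_\phi$. Then, as $r\to 1^-$, the following hold. (i) When $f_\phi(0)>0$, $$\rho_1(re^{i\phi})=\frac{1}{\pi(1-r^2)^2}-\frac{1}{4\pi f_\phi(0)^2}\Big\{f_\phi'(0)^2+\mathcal{I}(T\hat f_\phi)^2\Big\}+O(1-r^2).$$ (ii) When $f_\phi(0)=0$, $$\rho_1(re^{i\phi})=\frac{1}{\pi(1-r^2)}\,\frac{f_\phi''(0)}{2\,\mathcal{I}(T\hat f_\phi)}+O(1).$$ (iii) When $f_\phi(0)=f_\phi''(0)=0$, $$\rho_1(re^{i\phi})=\frac{1}{\pi}\,\frac{\mathcal{I}(T^2\hat f_\phi)^2-\mathcal{I}\big(T^2(\hat f_\phi\cos s)\big)^2-\mathcal{I}\big(T^2(\check f_\phi\sin s)\big)^2}{4\,\mathcal{I}(T\hat f_\phi)^2}+O(1-r^2).$$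
   Context: $\Xi=\{\xi_k\}_{k\in\mathbb{Z}}$ is a stationary, centered, (circularly symmetric) complex Gaussian process with covariance $\gamma(k-l)=\mathbb{E}[\xi_k\overline{\xi_l}]$ and $\gamma(0)=1$, so each $\xi_k$ is standard complex normal. Its spectral measure is the probability measure $F$ on $(-\pi,\pi]$ (identified with the unit circle) with $\gamma(k)=\int_{-\pi}^{\pi}e^{-ikt}F(dt)$ for all $k\in\mathbb{Z}$. The power series $X_\Xi(z)=\sum_{k=0}^\infty \xi_k z^k$ has radius of convergence $1$ almost surely. Its zeros form the point process $\mathcal{Z}=\sum_{z\in\mathbb{D}:X_\Xi(z)=0}\delta_z$ on $\mathbb{D}=\{|z|<1\}$, and $\rho_1$ is its $1$-intensity, i.e. the (continuous) density with respect to Lebesgue measure $m$ on $\mathbb{D}$ such that $\mathbb{E}[\mathcal{Z}(D)]=\int_D\rho_1\,dm$ for Borel $D\subset\mathbb{D}$. For a function $h$ on $(-\pi,\pi]$ (modulo $2\pi$), $\hat h(s)=\frac{h(s)+h(-s)}{2}$ and $\check h(s)=\frac{h(s)-h(-s)}{2}$. For a symmetric function $h$ smooth at $s=0$, $Th(s)=\frac{h(s)-h(0)}{1-\cos s}$ for $s\ne 0$ and $Th(0)=h''(0)$; $Th$ is again symmetric and smooth at $0$, and $T^2h=T(Th)$. The integral operator is $\mathcal{I}(h)=\frac{1}{2\pi}\int_{-\pi}^{\pi}h(s)\,ds$. Expressions such as $\hat f_\phi\cos s$ denote the function $s\mapsto \hat f_\phi(s)\cos s$. *)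

theory Defs
  imports "HOL-Probability.Probability" "HOL-Library.Landau_Symbols"
begin

text \<open>Centred circularly symmetric complex normal law with variance \<open>v\<close>, so that
  \<open>E |Z|^2 = v\<close>. The degenerate law is allowed for \<open>v = 0\<close>.\<close>

definition complex_normal :: "'a measure \<Rightarrow> real \<Rightarrow> ('a \<Rightarrow> complex) \<Rightarrow> bool" where
  "complex_normal M v Z \<longleftrightarrow>
     (if v = 0 then Z \<in> borel_measurable M \<and> (AE \<omega> in M. Z \<omega> = 0)
      else v > 0 \<and> distributed M lborel Z (\<lambda>z. ennreal (exp (- (norm z)\<^sup>2 / v) / (pi * v))))"

text \<open>Joint Gaussianity is expressed through complex linear combinations, which covers all real
  linear combinations of real and imaginary parts. Requiring each combination to be centred and
  circularly symmetric makes the whole process centred and circularly symmetric.\<close>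

definition complex_gaussian_process :: "'a measure \<Rightarrow> ('i \<Rightarrow> 'a \<Rightarrow> complex) \<Rightarrow> bool" where
  "complex_gaussian_process M \<xi> \<longleftrightarrow>
     (\<forall>k. \<xi> k \<in> borel_measurable M) \<and>
     (\<forall>A c. finite A \<longrightarrow> (\<exists>v\<ge>0. complex_normal M v (\<lambda>\<omega>. \<Sum>k\<in>A. c k * \<xi> k \<omega>)))"

definition stationary_process :: "'a measure \<Rightarrow> (int \<Rightarrow> 'a \<Rightarrow> complex) \<Rightarrow> bool" where
  "stationary_process M \<xi> \<longleftrightarrow>
     (\<forall>n. distr M (PiM UNIV (\<lambda>_. borel)) (\<lambda>\<omega> k. \<xi> (k + n) \<omega>)
        = distr M (PiM UNIV (\<lambda>_. borel)) (\<lambda>\<omega> k. \<xi> k \<omega>))"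

definition has_covariance :: "'a measure \<Rightarrow> (int \<Rightarrow> 'a \<Rightarrow> complex) \<Rightarrow> (int \<Rightarrow> complex) \<Rightarrow> bool" where
  "has_covariance M \<xi> \<gamma> \<longleftrightarrow>
     (\<forall>k l. integrable M (\<lambda>\<omega>. \<xi> k \<omega> * cnj (\<xi> l \<omega>)) \<and>
            (LINT \<omega>|M. \<xi> k \<omega> * cnj (\<xi> l \<omega>)) = \<gamma> (k - l))"

definition spectral_measure :: "(int \<Rightarrow> complex) \<Rightarrow> real measure \<Rightarrow> bool" where
  "spectral_measure \<gamma> F \<longleftrightarrow>
     prob_space F \<and> sets F = sets (restrict_space borel {-pi<..pi}) \<and>
     (\<forall>k. \<gamma> k = (LINT t|F. exp (- \<i> * of_int k * of_real t)))"

text \<open>The representative of a real number modulo \<open>2 pi\<close> in \<open>(-pi, pi]\<close>.\<close>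

definition wrap :: "real \<Rightarrow> real" where
  "wrap x = x - 2 * pi * of_int \<lceil>(x - pi) / (2 * pi)\<rceil>"

text \<open>\<open>F_phi(ds) = F(d(s + phi))\<close>: the mass that \<open>F\<close> has at \<open>t\<close> is moved to \<open>t - phi\<close>.\<close>

definition rotated_measure :: "real measure \<Rightarrow> real \<Rightarrow> real measure" where
  "rotated_measure F \<phi> = distr F (restrict_space borel {-pi<..pi}) (\<lambda>t. wrap (t - \<phi>))"

definition power_series :: "(int \<Rightarrow> 'a \<Rightarrow> complex) \<Rightarrow> 'a \<Rightarrow> complex \<Rightarrow> complex" where
  "power_series \<xi> \<omega> z = (\<Sum>k. \<xi> (int k) \<omega> * z ^ k)"

text \<open>The mass that the sum of unit point masses over the zero set in the unit disk gives to
  \<open>D\<close>; it may be infinite, and each zero is counted once.\<close>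

definition zero_process :: "(int \<Rightarrow> 'a \<Rightarrow> complex) \<Rightarrow> 'a \<Rightarrow> complex set \<Rightarrow> ennreal" where
  "zero_process \<xi> \<omega> D =
     emeasure (count_space UNIV) {z \<in> D. norm z < 1 \<and> power_series \<xi> \<omega> z = 0}"

definition one_intensity ::
    "'a measure \<Rightarrow> (int \<Rightarrow> 'a \<Rightarrow> complex) \<Rightarrow> (complex \<Rightarrow> real) \<Rightarrow> bool" where
  "one_intensity M \<xi> \<rho> \<longleftrightarrow>
     continuous_on (ball 0 1) \<rho> \<and> (\<forall>z\<in>ball 0 1. \<rho> z \<ge> 0) \<and>
     (\<forall>D\<in>sets borel. D \<subseteq> ball 0 1 \<longrightarrow>
        (\<integral>\<^sup>+\<omega>. zero_process \<xi> \<omega> D \<partial>M) = (\<integral>\<^sup>+z\<in>D. ennreal (\<rho> z) \<partial>lborel))"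

definition smooth_at :: "(real \<Rightarrow> real) \<Rightarrow> real \<Rightarrow> bool" where
  "smooth_at h a \<longleftrightarrow>
     (\<exists>e>0. \<forall>n. \<forall>x\<in>ball a e. (deriv ^^ n) h field_differentiable (at x))"

definition sym_part :: "(real \<Rightarrow> real) \<Rightarrow> real \<Rightarrow> real" where
  "sym_part h s = (h s + h (- s)) / 2"

definition antisym_part :: "(real \<Rightarrow> real) \<Rightarrow> real \<Rightarrow> real" where
  "antisym_part h s = (h s - h (- s)) / 2"

text \<open>Meaningful only for \<open>s\<close> in \<open>[-pi, pi]\<close>, where \<open>0\<close> is the only zero of \<open>1 - cos s\<close>.\<close>

definition T_op :: "(real \<Rightarrow> real) \<Rightarrow> real \<Rightarrow> real" where
  "T_op h s = (if s = 0 then (deriv ^^ 2) h 0 else (h s - h 0) / (1 - cos s))"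

definition I_op :: "(real \<Rightarrow> real) \<Rightarrow> real" where
  "I_op h = 1 / (2 * pi) * (LBINT s:{-pi..pi}. h s)"

end

theory Submission
  imports Defs "HOL-Complex_Analysis.Complex_Analysis"
begin

text \<open>Write \<open>X\<close> for the random power series and \<open>K z = E |X z|^2\<close> for its covariance kernel on the
  diagonal; in spectral terms \<open>K z\<close> is the integral of \<open>1 / |1 - z e^(-it)|^2\<close> against \<open>F\<close>. The
  theorem has a probabilistic half, which expresses the intensity through \<open>K\<close>, and an analytic
  half, which finds the behaviour of that expression at a boundary point.

  \<^bold>\<open>The intensity.\<close> The Edelman-Kostlan formula says that the intensity is
  \<open>(K K_11 - |K_1|^2) / (pi K^2)\<close>, a quarter of the Laplacian of \<open>ln K\<close> divided by \<open>pi\<close>, where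
  \<open>K_1 = E (X' cnj X)\<close> and \<open>K_11 = E |X'|^2\<close>. Jensen's formula turns zeros into integrals: if
  \<open>J s\<close> is the mean of \<open>ln |X|\<close> over the circle of radius \<open>s\<close> about \<open>a\<close>, then
  \<open>J s2 - J s1\<close> lies between \<open>ln (s2 / s1)\<close> times the number of zeros in the inner disc and
  \<open>ln (s2 / s1)\<close> times the number in the outer disc (\<open>jensen_simple_zeros\<close>). Each \<open>X z\<close> is a complex
  normal variable of variance \<open>K z\<close>, so \<open>E ln |X z|\<close> is \<open>ln (K z) / 2\<close> plus a constant that cancels
  in the difference (\<open>power_series_law\<close>, \<open>log_moment\<close>). Hence the expected number of zeros in small discs
  is squeezed by circle means of \<open>ln K\<close> (\<open>expected_zeros_bounds\<close>), and a second-order Taylor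
  expansion of \<open>ln K\<close> determines the continuous density (\<open>one_intensity_eq\<close>). Working with these two
  inequalities rather than with an exact formula makes the measurability of the number of zeros
  irrelevant: the integral of a nonnegative function is monotone whether or not the function is
  measurable. The zero process counts every zero once, while Jensen's formula counts multiplicities; they
  agree because almost surely no zero is multiple (\<open>AE_simple_zeros\<close>). Near a double zero \<open>X\<close> is
  quadratically small, and a grid of mesh \<open>1/N\<close>, with about \<open>N^2\<close> points, meets such a value with probability
  of order \<open>N^2 * (1/N^2)^2\<close>.

  \<^bold>\<open>The boundary.\<close> At \<open>z = r e^(i phi)\<close> all three kernels are integrals of the even or odd part of
  the density \<open>f\<close> against powers of \<open>1 / (1 - 2 r cos s + r^2)\<close> (\<open>K_radial\<close>). Subtract from the even
  part its jet \<open>f 0 + f'' 0 (1 - cos s)\<close> and from the odd part its jet \<open>f' 0 sin s\<close>. The jets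
  contribute elementary integrals that can be evaluated exactly. The remainders vanish to fourth
  order, after multiplying the odd one by \<open>sin s\<close>, and for such functions the integrals
  converge to their values at \<open>r = 1\<close> with error of order \<open>1 - r\<close> (\<open>flat_over_pdenom_sq\<close>); those values are
  the operators \<open>I\<close>, \<open>T\<close> of the statement. When \<open>f 0 = 0\<close> this gives the expansion at once.
  When \<open>f 0 > 0\<close> the three kernels blow up and the leading terms cancel; there one uses that
  \<open>(1 - |z|^2) K z\<close> is a Poisson integral, hence harmonic, which rewrites the numerator as
  \<open>1 / (1 - r^2)^2\<close> minus a squared gradient that stays bounded (\<open>A2_recursion\<close>, \<open>density_interior\<close>).
\<close>

section \<open>Mean values on a circle\<close>

text \<open>The angular parameter of a circle. Circle integrals are kept unnormalised, so means carry a factor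
  \<open>2 pi\<close>.\<close>

definition arc :: "real measure" where "arc = restrict_space lborel {-pi..pi}"

lemma space_arc [simp]: "space arc = {-pi..pi}"
  by (simp add: arc_def space_restrict_space)

lemma emeasure_arc: "emeasure arc (space arc) = ennreal (2 * pi)"
  by (simp add: arc_def emeasure_restrict_space space_restrict_space)

lemma measure_arc [simp]: "measure arc {-pi..pi} = 2 * pi"
  using emeasure_arc by (simp add: measure_def)

lemma finite_measure_arc: "finite_measure arc"
  by (rule finite_measureI) (simp only: emeasure_arc infinity_ennreal_def ennreal_neq_top not_False_eq_True)

interpretation arc: finite_measure arc by (rule finite_measure_arc)

lemma measurable_arc [measurable (raw)]:
  "f \<in> borel_measurable borel \<Longrightarrow> f \<in> borel_measurable arc"
  unfolding arc_def by (rule measurable_restrict_space1) simp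

lemma integral_arc:
  fixes f :: "real \<Rightarrow> 'b::{banach,second_countable_topology}"
  shows "(LINT s|arc. f s) = (LBINT s:{-pi..pi}. f s)"
  unfolding arc_def by (subst integral_restrict_space) (auto simp: set_lebesgue_integral_def)

lemma integrable_arc_iff:
  fixes f :: "real \<Rightarrow> 'b::{banach,second_countable_topology}"
  shows "integrable arc f \<longleftrightarrow> set_integrable lborel {-pi..pi} f"
  unfolding arc_def by (subst integrable_restrict_space) (auto simp: set_integrable_def)

lemma integrable_arc_continuous:
  fixes f :: "real \<Rightarrow> 'b::euclidean_space"
  assumes "continuous_on {-pi..pi} f" shows "integrable arc f"
  unfolding integrable_arc_iff using assms by (intro borel_integrable_atLeastAtMost') auto

text \<open>Cauchy's formula for the circle uses the parameter interval \<open>[0, 2 pi]\<close>. Applying it to the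
  reflected function \<open>w \<mapsto> g (2 a - w)\<close> shifts the parameter by \<open>pi\<close>, which is what the
  symmetric interval requires.\<close>

lemma holomorphic_mean_value:
  fixes g :: "complex \<Rightarrow> complex"
  assumes g: "g holomorphic_on ball a R" and s: "0 \<le> s" "s < R"
  shows "(LINT t|arc. g (a + of_real s * cis t)) = 2 * pi * g a"
proof (cases "s = 0")
  case True
  show ?thesis using True by (simp add: scaleR_conv_of_real)
next
  case False
  then have s0: "s > 0" using s by simp
  \<comment> \<open>At parameter \<open>t + pi\<close> the circle about \<open>a\<close> is at \<open>2 a\<close> minus its position at \<open>t\<close>.\<close>
  define h where "h w = g (2 * a - w)" for w
  have hol: "h holomorphic_on ball a R"
    unfolding h_def
  proof (rule holomorphic_on_compose[of "\<lambda>w. 2*a-w" _ g, unfolded o_def])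
    show "(\<lambda>w. 2 * a - w) holomorphic_on ball a R" by (intro holomorphic_intros)
    have "(\<lambda>w. 2 * a - w) ` ball a R \<subseteq> ball a R"
      by (auto simp: dist_norm norm_minus_commute)
    then show "g holomorphic_on (\<lambda>w. 2 * a - w) ` ball a R"
      by (rule holomorphic_on_subset[OF g])
  qed
  have "h holomorphic_on cball a s"
    by (rule holomorphic_on_subset[OF hol]) (use s in auto)
  from Cauchy_integral_circlepath_simple[OF this, of a] s0
  have "((\<lambda>u. h u / (u - a)) has_contour_integral 2 * of_real pi * \<i> * h a) (circlepath a s)"
    by simp
  then have "((\<lambda>t. h (a + s * cis t) / (s * cis t) * s * \<i> * cis t) has_integral 2 * of_real pi * \<i> * h a) {0..2*pi}"
    by (simp add: circlepath_def has_contour_integral_part_circlepath_iff)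
  then have "((\<lambda>t. \<i> * h (a + s * cis t)) has_integral 2 * of_real pi * \<i> * h a) {0..2*pi}"
    using s0 by (simp add: field_simps)
  from has_integral_mult_right[OF this, of "-\<i>"]
  have "((\<lambda>t. h (a + s * cis t)) has_integral 2 * of_real pi * h a) {0..2*pi}"
    by (simp add: algebra_simps)
  then have "((\<lambda>t. h (a + s * cis t)) has_integral 2 * of_real pi * h a) (cbox 0 (2*pi))" by simp
  from has_integral_affinity[OF this, of 1 pi]
  have "((\<lambda>t. h (a + s * cis (t + pi))) has_integral 2 * of_real pi * h a) {-pi..pi}"
    by (simp add: algebra_simps)
  moreover have "h (a + s * cis (t + pi)) = g (a + s * cis t)" for t
    by (simp add: h_def cis_mult[symmetric] algebra_simps)
  ultimately have *: "((\<lambda>t. g (a + s * cis t)) has_integral 2 * of_real pi * g a) {-pi..pi}"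
    by (simp add: h_def)
  have "continuous_on {-pi..pi} (\<lambda>t. g (a + of_real s * cis t))"
    by (rule continuous_on_compose2[OF holomorphic_on_imp_continuous_on[OF g]])
       (use s s0 in \<open>auto intro!: continuous_intros simp: norm_mult dist_norm\<close>)
  then have "integrable arc (\<lambda>t. g (a + of_real s * cis t))" by (rule integrable_arc_continuous)
  then have "((\<lambda>t. g (a + of_real s * cis t)) has_integral (LINT t|arc. g (a + of_real s * cis t))) {-pi..pi}"
    unfolding integrable_arc_iff integral_arc
    using set_borel_integral_eq_integral by (metis has_integral_iff)
  with * show ?thesis by (metis has_integral_unique of_real_mult of_real_numeral)
qed

section \<open>Logarithmic means and Jensen counts\<close>

text \<open>A zero-free function on a slightly larger disc has a holomorphic logarithm, and the real part of
  the mean value property for that logarithm is the claim.\<close>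

lemma log_mean_nonvanishing:
  assumes g: "g holomorphic_on ball a R" and nz: "\<And>z. z \<in> cball a s \<Longrightarrow> g z \<noteq> 0"
    and s: "0 \<le> s" "s < R"
  shows "integrable arc (\<lambda>t. ln (norm (g (a + of_real s * cis t))))"
    and "(LINT t|arc. ln (norm (g (a + of_real s * cis t)))) = 2 * pi * ln (norm (g a))"
proof -
  let ?U = "{z \<in> ball a R. g z \<in> -{0}}"
  have "open ?U"
  proof -
    have "open (ball a R \<inter> g -` (-{0}))"
      by (rule continuous_open_preimage[OF holomorphic_on_imp_continuous_on[OF g]]) auto
    moreover have "ball a R \<inter> g -` (-{0}) = ?U" by auto
    ultimately show ?thesis by simp
  qed
  moreover have "cball a s \<subseteq> ?U" using s nz by auto
  ultimately obtain e where e: "e > 0" "(\<Union>x\<in>cball a s. ball x e) \<subseteq> ?U"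
    using compact_subset_open_imp_ball_epsilon_subset[of "cball a s" ?U] compact_cball by blast
  have sub: "ball a (s + e) \<subseteq> ?U"
  proof
    fix z assume z: "z \<in> ball a (s + e)"
    show "z \<in> ?U"
    proof (cases "dist a z \<le> s")
      case True then show ?thesis using e by force
    next
      case False
      define y where "y = a + (s / dist a z) *\<^sub>R (z - a)"
      have az: "a \<noteq> z" using False s by auto
      then have dy: "dist a y = s" using False s by (simp add: y_def dist_norm norm_minus_commute)
      have "y - z = (s / dist a z - 1) *\<^sub>R (z - a)"
        by (simp add: y_def algebra_simps)
      then have "dist y z = \<bar>s / dist a z - 1\<bar> * dist a z"
        by (simp add: dist_norm norm_minus_commute)
      also have "\<dots> = dist a z - s" using False s az by (simp add: abs_if field_simps)
      finally have "dist y z < e" using z by simp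
      then show ?thesis using e dy by force
    qed
  qed
  have "g holomorphic_on ball a (s+e)" using g sub by (blast intro: holomorphic_on_subset)
  moreover have "a \<in> ball a (s+e)" using s e by simp
  ultimately obtain l where l: "l holomorphic_on ball a (s+e)" "\<And>x. x \<in> ball a (s+e) \<Longrightarrow> exp (l x) = g x"
    using holomorphic_logarithm_exists[OF convex_ball open_ball, of g a "s+e" a] sub by blast
  have ln: "ln (norm (g z)) = Re (l z)" if "z \<in> ball a (s+e)" for z
    using l(2)[OF that] by (metis ln_exp norm_exp_eq_Re)
  have in_ball: "a + of_real s * cis t \<in> ball a (s+e)" for t
    using s e by (simp add: dist_norm norm_mult)
  have "continuous_on {-pi..pi} (\<lambda>t. l (a + of_real s * cis t))"
    by (rule continuous_on_compose2[OF holomorphic_on_imp_continuous_on[OF l(1)]])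
       (use in_ball in \<open>auto intro!: continuous_intros\<close>)
  then have int: "integrable arc (\<lambda>t. l (a + of_real s * cis t))" by (rule integrable_arc_continuous)
  have lnt: "ln (norm (g (a + of_real s * cis t))) = Re (l (a + of_real s * cis t))" for t
    using in_ball by (rule ln)
  show "integrable arc (\<lambda>t. ln (norm (g (a + of_real s * cis t))))"
    unfolding lnt using int by (rule integrable_Re)
  have "(LINT t|arc. ln (norm (g (a + of_real s * cis t)))) = Re (LINT t|arc. l (a + of_real s * cis t))"
    unfolding lnt using int by (rule integral_Re)
  also have "\<dots> = 2 * pi * ln (norm (g a))"
    using holomorphic_mean_value[OF l(1), of s] s e ln[of a] by simp
  finally show "(LINT t|arc. ln (norm (g (a + of_real s * cis t)))) = 2 * pi * ln (norm (g a))" .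
qed

lemma finite_cis_eq: "finite {t \<in> {-pi..pi}. cis t = w}"
proof -
  have "{t \<in> {-pi..pi}. cis t = w} \<subseteq> {-pi, Arg w}"
  proof
    fix t assume "t \<in> {t \<in> {-pi..pi}. cis t = w}"
    then have "t \<in> {-pi..pi}" "cis t = w" by auto
    then show "t \<in> {-pi, Arg w}" using cis_Arg_unique[of w t]
      by (cases "t = -pi") (auto simp: sgn_div_norm)
  qed
  then show ?thesis by (rule finite_subset) simp
qed

lemma AE_arc_cis_neq: "AE t in arc. cis t \<noteq> w"
proof -
  have fin: "finite {t \<in> {-pi..pi}. cis t = w}" by (rule finite_cis_eq)
  have "AE t in lborel. t \<notin> {t \<in> {-pi..pi}. cis t = w}"
    by (rule AE_not_in) (use fin in \<open>auto intro: countable_imp_null_set_lborel countable_finite\<close>)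
  then show ?thesis unfolding arc_def by (subst AE_restrict_space_iff) auto
qed

text \<open>On the unit circle \<open>|s \<zeta> - b| = |s - cnj b \<zeta>|\<close>, and the right-hand side has no zero in the closed
  unit disc: reflecting the zero \<open>b\<close> out of the circle reduces the claim to the zero-free case.\<close>

lemma log_mean_linear_interior:
  assumes s: "s > 0" and w: "norm b < s"
  shows "integrable arc (\<lambda>t. ln (norm (of_real s * cis t - b)))"
    and "(LINT t|arc. ln (norm (of_real s * cis t - b))) = 2 * pi * ln s"
proof -
  have eq: "norm (of_real s * cis t - b) = norm (of_real s - cnj b * (0 + of_real 1 * cis t))" for t
  proof -
    have "norm (of_real s * cis t - b) = norm (cis t * (of_real s - b * cnj (cis t)))"
      by (simp add: algebra_simps cis_cnj cis_mult)
    also have "\<dots> = norm (cnj (of_real s - b * cnj (cis t)))"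
      by (simp only: norm_mult norm_cis complex_mod_cnj mult_1)
    finally show ?thesis by simp
  qed
  obtain R where R: "R > 1" "norm b * R < s"
  proof (cases "b = 0")
    case False
    then obtain R where "1 < R" "R < s / norm b" using dense[of 1 "s / norm b"] w by auto
    then show ?thesis using that[of R] False by (simp add: field_simps)
  qed (use that[of 2] s in auto)
  have hol: "(\<lambda>z. of_real s - cnj b * z) holomorphic_on ball 0 R" by (intro holomorphic_intros)
  have nz: "of_real s - cnj b * z \<noteq> 0" if "z \<in> cball 0 1" for z
  proof
    assume "of_real s - cnj b * z = 0"
    then have "norm (of_real s :: complex) = norm (cnj b * z)" by simp
    moreover have "norm b * norm z \<le> norm b * 1" using that by (intro mult_left_mono) auto
    ultimately show False using w s by (simp add: norm_mult)
  qed
  from log_mean_nonvanishing[OF hol nz, of 1] R s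
  show "integrable arc (\<lambda>t. ln (norm (of_real s * cis t - b)))"
    and "(LINT t|arc. ln (norm (of_real s * cis t - b))) = 2 * pi * ln s"
    unfolding eq by simp_all
qed

text \<open>A zero on the circle itself is approached through interior zeros \<open>r b\<close> with \<open>r \<rightarrow> 1\<close>. Since
  \<open>|s \<zeta> - b| \<le> 2 |s \<zeta> - r b|\<close>, all these logarithms are dominated by the limiting one, whose
  integrability comes from Fatou's lemma.\<close>

lemma log_mean_linear_boundary:
  assumes s: "s > 0" and w: "norm b = s"
  shows "integrable arc (\<lambda>t. ln (norm (of_real s * cis t - b)))"
    and "(LINT t|arc. ln (norm (of_real s * cis t - b))) = 2 * pi * ln s"
proof -
  define d where "d r t = norm (of_real s * cis t - of_real r * b)" for r t
  define r where "r n = 1 - 1 / (real n + 2)" for n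
  have r: "0 \<le> r n" "r n < 1" for n by (auto simp: r_def field_simps)
  have rlim: "r \<longlonglongrightarrow> 1"
    unfolding r_def by real_asymp
  have m[measurable]: "d x \<in> borel_measurable borel" for x
    unfolding d_def by (intro borel_measurable_continuous_onI continuous_intros)
  have upper: "d x t \<le> 2 * s" if "0 \<le> x" "x \<le> 1" for x t
  proof -
    have "d x t \<le> norm (of_real s * cis t) + norm (of_real x * b)" unfolding d_def by (rule norm_triangle_ineq4)
    also have "\<dots> \<le> s + 1 * s" using that s w by (simp add: norm_mult mult_left_le_one_le)
    finally show ?thesis by simp
  qed
  have lower: "d 1 t \<le> 2 * d x t" if "0 \<le> x" "x < 1" for x t
  proof -
    have "d 1 t = norm ((of_real s * cis t - of_real x * b) - of_real (1 - x) * b)"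
      by (simp add: d_def algebra_simps)
    also have "\<dots> \<le> d x t + norm (of_real (1-x) * b)" unfolding d_def by (rule norm_triangle_ineq4)
    also have "norm (of_real (1-x) * b) = s - x * s"
      using that w by (simp add: norm_mult algebra_simps del: of_real_diff)
    also have "s - x * s \<le> d x t"
      using norm_triangle_ineq2[of "of_real s * cis t" "of_real x * b"] that s w
      by (simp add: d_def norm_mult)
    finally show ?thesis by simp
  qed
  have pos: "0 < d x t" if "0 \<le> x" "x < 1" for x t
  proof -
    have "x * s < 1 * s" using that s by (intro mult_strict_right_mono) auto
    then have "0 < s - x * s" by simp
    also have "\<dots> \<le> d x t" using norm_triangle_ineq2[of "of_real s * cis t" "of_real x * b"] that s w
      by (simp add: d_def norm_mult)
    finally show ?thesis .
  qed
  have mean: "integrable arc (\<lambda>t. ln (d x t))" "(LINT t|arc. ln (d x t)) = 2 * pi * ln s"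
    if "0 \<le> x" "x < 1" for x
  proof -
    have "norm (of_real x * b) < s" using that s w by (simp add: norm_mult)
    from log_mean_linear_interior[OF s this]
    show "integrable arc (\<lambda>t. ln (d x t))" "(LINT t|arc. ln (d x t)) = 2 * pi * ln s"
      by (simp_all add: d_def)
  qed
  have conv: "AE t in arc. (\<lambda>n. ln (d (r n) t)) \<longlonglongrightarrow> ln (d 1 t)"
    using AE_arc_cis_neq[of "b / of_real s"]
  proof eventually_elim
    case (elim t)
    then have "d 1 t \<noteq> 0" using s by (auto simp: d_def field_simps)
    moreover have "(\<lambda>n. d (r n) t) \<longlonglongrightarrow> d 1 t"
      unfolding d_def by (intro tendsto_intros rlim)
    ultimately show ?case by (intro tendsto_ln)
  qed
  have bound: "AE t in arc. norm (ln (d (r n) t)) \<le> \<bar>ln (d 1 t)\<bar> + \<bar>ln (2 * s)\<bar> + ln 2" for n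
    using AE_arc_cis_neq[of "b / of_real s"]
  proof eventually_elim
    case (elim t)
    then have p1: "d 1 t > 0" using s by (auto simp: d_def field_simps)
    have "ln (d (r n) t) \<le> ln (2 * s)" using pos[OF r[of n]] upper[of "r n" t] r[of n] s by simp
    moreover have "ln (d 1 t) \<le> ln (2 * d (r n) t)" using pos[OF r[of n]] lower[OF r[of n], of t] p1 by simp
    then have "ln (d 1 t) \<le> ln 2 + ln (d (r n) t)" using pos[OF r[of n], of t] by (simp add: ln_mult)
    moreover have "ln (2::real) > 0" by simp
    ultimately show ?case unfolding real_norm_def by arith
  qed
  have int1: "integrable arc (\<lambda>t. ln (2 * s) - ln (d 1 t))"
  proof (rule integrableI_bounded)
    have "(\<integral>\<^sup>+t. ennreal (norm (ln (2 * s) - ln (d 1 t))) \<partial>arc)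
        = (\<integral>\<^sup>+t. liminf (\<lambda>n. ennreal (ln (2 * s) - ln (d (r n) t))) \<partial>arc)"
    proof (rule nn_integral_cong_AE)
      show "AE t in arc. ennreal (norm (ln (2 * s) - ln (d 1 t)))
          = liminf (\<lambda>n. ennreal (ln (2 * s) - ln (d (r n) t)))"
        using conv AE_arc_cis_neq[of "b / of_real s"]
      proof eventually_elim
        case (elim t)
        then have p1: "d 1 t > 0" using s by (auto simp: d_def field_simps)
        have "ln (d 1 t) \<le> ln (2 * s)" using p1 upper[of 1 t] s by simp
        moreover have "(\<lambda>n. ennreal (ln (2 * s) - ln (d (r n) t))) \<longlonglongrightarrow> ennreal (ln (2 * s) - ln (d 1 t))"
          by (intro tendsto_ennrealI tendsto_intros elim)
        then have "liminf (\<lambda>n. ennreal (ln (2 * s) - ln (d (r n) t))) = ennreal (ln (2 * s) - ln (d 1 t))"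
          by (intro lim_imp_Liminf) auto
        ultimately show ?case by simp
      qed
    qed
    also have "\<dots> \<le> liminf (\<lambda>n. \<integral>\<^sup>+t. ennreal (ln (2 * s) - ln (d (r n) t)) \<partial>arc)"
      by (rule nn_integral_liminf) measurable
    also have "(\<lambda>n. \<integral>\<^sup>+t. ennreal (ln (2 * s) - ln (d (r n) t)) \<partial>arc) = (\<lambda>n. ennreal (2 * pi * ln 2))"
    proof
      fix n
      have "(\<integral>\<^sup>+t. ennreal (ln (2 * s) - ln (d (r n) t)) \<partial>arc)
          = ennreal (LINT t|arc. ln (2 * s) - ln (d (r n) t))"
        using mean[OF r[of n]] upper[of "r n"] r[of n] pos[OF r[of n]] s
        by (intro nn_integral_eq_integral) auto
      also have "(LINT t|arc. ln (2 * s) - ln (d (r n) t)) = 2 * pi * ln 2"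
        using mean[OF r[of n]] s by (simp add: ln_mult algebra_simps)
      finally show "(\<integral>\<^sup>+t. ennreal (ln (2 * s) - ln (d (r n) t)) \<partial>arc) = ennreal (2 * pi * ln 2)" .
    qed
    also have "liminf (\<lambda>n::nat. ennreal (2 * pi * ln 2)) < \<infinity>" by (simp add: Liminf_const)
    finally show "(\<integral>\<^sup>+t. ennreal (norm (ln (2 * s) - ln (d 1 t))) \<partial>arc) < \<infinity>" .
  qed measurable
  have "integrable arc (\<lambda>t. ln (2 * s) - (ln (2 * s) - ln (d 1 t)))"
    by (rule Bochner_Integration.integrable_diff[OF _ int1]) simp
  then have int: "integrable arc (\<lambda>t. ln (d 1 t))" by simp
  then show "integrable arc (\<lambda>t. ln (norm (of_real s * cis t - b)))" by (simp add: d_def)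
  have "(\<lambda>n. LINT t|arc. ln (d (r n) t)) \<longlonglongrightarrow> (LINT t|arc. ln (d 1 t))"
    using conv bound int
    by (intro integral_dominated_convergence[where w = "\<lambda>t. \<bar>ln (d 1 t)\<bar> + \<bar>ln (2 * s)\<bar> + ln 2"]) auto
  moreover have "(\<lambda>n. LINT t|arc. ln (d (r n) t)) = (\<lambda>n. 2 * pi * ln s)"
    using mean[OF r] by simp
  ultimately have "(LINT t|arc. ln (d 1 t)) = 2 * pi * ln s"
    using LIMSEQ_unique tendsto_const by metis
  then show "(LINT t|arc. ln (norm (of_real s * cis t - b))) = 2 * pi * ln s" by (simp add: d_def)
qed

text \<open>The mean of \<open>ln |z - w|\<close> freezes at \<open>ln s\<close> once \<open>w\<close> is inside the circle; the maximum covers all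
  positions of \<open>w\<close>, the circle included.\<close>

lemma log_mean_linear:
  assumes s: "s > 0"
  shows "integrable arc (\<lambda>t. ln (norm (a + of_real s * cis t - w)))"
    and "(LINT t|arc. ln (norm (a + of_real s * cis t - w))) = 2 * pi * ln (max s (norm (w - a)))"
proof -
  have "integrable arc (\<lambda>t. ln (norm (a + of_real s * cis t - w))) \<and>
    (LINT t|arc. ln (norm (a + of_real s * cis t - w))) = 2 * pi * ln (max s (norm (w - a)))"
  proof (cases "norm (w - a) \<le> s")
    case True
    have eq: "a + of_real s * cis t - w = of_real s * cis t - (w - a)" for t by simp
    show ?thesis unfolding eq
      using True log_mean_linear_interior[OF s, of "w - a"] log_mean_linear_boundary[OF s, of "w - a"]
      by (cases "norm (w - a) = s") (auto simp: max_def)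
  next
    case False
    then have nz: "z - w \<noteq> 0" if "z \<in> cball a s" for z
      using that by (auto simp: dist_norm norm_minus_commute)
    have "(\<lambda>z. z - w) holomorphic_on ball a (s + 1)" by (intro holomorphic_intros)
    from log_mean_nonvanishing[OF this nz] show ?thesis
      using s False by (auto simp: max_def norm_minus_commute[of w a])
  qed
  then show "integrable arc (\<lambda>t. ln (norm (a + of_real s * cis t - w)))"
    and "(LINT t|arc. ln (norm (a + of_real s * cis t - w))) = 2 * pi * ln (max s (norm (w - a)))" by auto
qed

lemma divide_out_zeros:
  assumes f: "f holomorphic_on S" "open S" and "finite Z" "Z \<subseteq> {z \<in> S. f z = 0}"
  shows "\<exists>g. g holomorphic_on S \<and> (\<forall>z\<in>S. f z = (\<Prod>w\<in>Z. z - w) * g z)"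
  using assms(3,4)
proof (induction Z)
  case empty
  then show ?case using f by (auto intro: exI[of _ f])
next
  case (insert w Z)
  then obtain g where g: "g holomorphic_on S" "\<And>z. z \<in> S \<Longrightarrow> f z = (\<Prod>w\<in>Z. z - w) * g z" by auto
  have "w \<in> S" "f w = 0" using insert.prems by auto
  with g(2)[of w] insert.hyps have gw: "g w = 0" by auto
  define h where "h z = (if z = w then deriv g w else (g z - g w) / (z - w))" for z
  have "h holomorphic_on S" unfolding h_def by (rule pole_lemma_open[OF g(1) f(2)])
  moreover have gh: "g z = (z - w) * h z" for z using gw by (auto simp: h_def)
  have "f z = (\<Prod>w\<in>insert w Z. z - w) * h z" if "z \<in> S" for z
    using g(2)[OF that] gh[of z] insert.hyps by simp
  ultimately show ?case by blast
qed

text \<open>Divide the zeros in the closed disc out of \<open>f\<close>. The quotient is zero-free because the zeros are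
  simple, so its logarithmic mean does not depend on the radius, and each zero \<open>w\<close> contributes
  \<open>ln (max s |w - a|)\<close>. Between the radii \<open>s1\<close> and \<open>s2\<close> this grows by exactly \<open>ln (s2 / s1)\<close> for zeros
  in the inner disc, by nothing for zeros outside the outer disc, and by something in between
  otherwise.\<close>

lemma jensen_simple_zeros:
  assumes f: "f holomorphic_on ball a R" and simple: "\<And>z. z \<in> ball a R \<Longrightarrow> f z = 0 \<Longrightarrow> deriv f z \<noteq> 0"
    and s: "0 < s1" "s1 < s2" "s2 < R"
  defines "J s \<equiv> LINT t|arc. ln (norm (f (a + of_real s * cis t)))"
  shows "finite {z \<in> ball a s2. f z = 0}"
    and "real (card {z \<in> ball a s1. f z = 0}) * (2 * pi * ln (s2 / s1)) \<le> J s2 - J s1"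
    and "J s2 - J s1 \<le> real (card {z \<in> ball a s2. f z = 0}) * (2 * pi * ln (s2 / s1))"
proof -
  define Z where "Z = {z \<in> cball a s2. f z = 0}"
  have Z_sub: "cball a s2 \<subseteq> ball a R" using s by auto
  have finZ: "finite Z"
  proof (cases "f constant_on ball a R")
    case True
    then obtain c where c: "\<And>z. z \<in> ball a R \<Longrightarrow> f z = c" by (auto simp: constant_on_def)
    have a: "a \<in> ball a R" using s by simp
    have "eventually (\<lambda>z. f z = c) (nhds a)"
      using c a by (intro eventually_nhds_in_open[of "ball a R", THEN eventually_mono]) auto
    then have "deriv f a = deriv (\<lambda>_. c) a" by (rule deriv_cong_ev) simp
    with simple[OF a] c[OF a] have "c \<noteq> 0" by auto
    then have "Z = {}" using c Z_sub by (auto simp: Z_def)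
    then show ?thesis by simp
  next
    case False
    then show ?thesis unfolding Z_def
      using holomorphic_compact_finite_zeros[OF f open_ball _ compact_cball Z_sub] by simp
  qed
  then show fin2: "finite {z \<in> ball a s2. f z = 0}" by (rule rev_finite_subset) (auto simp: Z_def)
  have "Z \<subseteq> {z \<in> ball a R. f z = 0}" using Z_sub by (auto simp: Z_def)
  then obtain g where g: "g holomorphic_on ball a R"
    "\<And>z. z \<in> ball a R \<Longrightarrow> f z = (\<Prod>w\<in>Z. z - w) * g z"
    using divide_out_zeros[OF f open_ball finZ] by blast
  have gnz: "g z \<noteq> 0" if z: "z \<in> cball a s2" for z
  proof
    assume g0: "g z = 0"
    have zR: "z \<in> ball a R" using z Z_sub by auto
    then have "f z = 0" using g(2) g0 by simp
    then have zZ: "z \<in> Z" using z by (simp add: Z_def)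
    define k where "k x = (\<Prod>w\<in>Z-{z}. x - w) * g x" for x
    have fk: "f x = (x - z) * k x" if "x \<in> ball a R" for x
      using g(2)[OF that] finZ zZ by (simp add: k_def prod.remove mult.assoc)
    have "k holomorphic_on ball a R" unfolding k_def by (intro holomorphic_intros g)
    then have kd: "(k has_field_derivative deriv k z) (at z)"
      using zR by (intro holomorphic_derivI) auto
    have "((\<lambda>x. (x - z) * k x) has_field_derivative k z) (at z)"
      by (rule derivative_eq_intros kd refl | simp)+
    then have "(f has_field_derivative k z) (at z)"
      by (rule DERIV_cong_ev[THEN iffD1, rotated 3, OF _ refl _ refl])
         (use zR fk in \<open>auto intro!: eventually_nhds_in_open[of "ball a R", THEN eventually_mono]\<close>)
    then have "deriv f z = 0" using g0 by (simp add: DERIV_imp_deriv k_def)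
    with simple[OF zR \<open>f z = 0\<close>] show False by simp
  qed
  have J: "J s = 2 * pi * ((\<Sum>w\<in>Z. ln (max s (norm (w - a)))) + ln (norm (g a)))"
    if "0 < s" "s \<le> s2" for s
  proof -
    have *: "z \<in> cball a s \<Longrightarrow> g z \<noteq> 0" for z using gnz that by auto
    have G: "integrable arc (\<lambda>t. ln (norm (g (a + of_real s * cis t))))"
       "(LINT t|arc. ln (norm (g (a + of_real s * cis t)))) = 2 * pi * ln (norm (g a))"
      using log_mean_nonvanishing[OF g(1) *, of s] that s by auto
    have meas: "(\<lambda>t. ln (norm (f (a + of_real s * cis t)))) \<in> borel_measurable arc"
    proof -
      have "continuous_on {-pi..pi} (\<lambda>t. f (a + of_real s * cis t))"
        by (rule continuous_on_compose2[OF holomorphic_on_imp_continuous_on[OF f]])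
           (use s that in \<open>auto intro!: continuous_intros simp: dist_norm norm_mult\<close>)
      then have "(\<lambda>t. f (a + of_real s * cis t)) \<in> borel_measurable arc"
        using integrable_arc_continuous borel_measurable_integrable by blast
      then show ?thesis by measurable
    qed
    have "AE t in arc. \<forall>w\<in>Z. cis t \<noteq> (w - a) / of_real s"
      using finZ by (auto simp: AE_finite_all AE_arc_cis_neq)
    then have "AE t in arc. ln (norm (f (a + of_real s * cis t)))
       = (\<Sum>w\<in>Z. ln (norm (a + of_real s * cis t - w))) + ln (norm (g (a + of_real s * cis t)))"
    proof eventually_elim
      case (elim t)
      have nz: "norm (a + of_real s * cis t - w) > 0" if "w \<in> Z" for w
      proof -
        have "cis t \<noteq> (w - a) / of_real s" using elim that by blast
        then have "a + of_real s * cis t \<noteq> w" using \<open>0 < s\<close> by (auto simp: field_simps)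
        then show ?thesis by simp
      qed
      have in_cball: "a + of_real s * cis t \<in> cball a s2" using that by (simp add: dist_norm norm_mult)
      then have "f (a + of_real s * cis t) = (\<Prod>w\<in>Z. a + of_real s * cis t - w) * g (a + of_real s * cis t)"
        using g(2) Z_sub by blast
      then show ?case using nz gnz[OF in_cball] finZ
        by (simp add: norm_mult ln_mult prod_norm[symmetric] ln_prod prod_pos)
    qed
    then have "J s = (LINT t|arc. (\<Sum>w\<in>Z. ln (norm (a + of_real s * cis t - w))) + ln (norm (g (a + of_real s * cis t))))"
      unfolding J_def by (intro integral_cong_AE meas) (use G(1) log_mean_linear(1)[OF that(1)] in auto)
    also have "\<dots> = (\<Sum>w\<in>Z. 2 * pi * ln (max s (norm (w - a)))) + 2 * pi * ln (norm (g a))"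
      using G log_mean_linear[OF that(1)] by (subst Bochner_Integration.integral_add) auto
    finally show ?thesis by (simp add: sum_distrib_left algebra_simps)
  qed
  have diff: "J s2 - J s1 = 2 * pi * (\<Sum>w\<in>Z. ln (max s2 (norm (w - a))) - ln (max s1 (norm (w - a))))"
    using J[of s1] J[of s2] s by (simp add: sum_subtractf algebra_simps)
  have L: "ln (s2 / s1) = ln s2 - ln s1" using s by (simp add: ln_div)
  have card_eq: "real (card {z \<in> ball a s. f z = 0}) * L = (\<Sum>w\<in>Z. if norm (w - a) < s then L else 0)"
    if "s \<le> s2" for s L
  proof -
    have "{z \<in> ball a s. f z = 0} = {w \<in> Z. norm (w - a) < s}"
      using that by (auto simp: Z_def dist_norm norm_minus_commute)
    then show ?thesis using finZ by (simp add: sum.inter_filter[symmetric])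
  qed
  have lnmono: "ln x \<le> ln s2" "ln s1 \<le> ln x" if "\<not> x < s1" "\<not> s2 \<le> x" for x
    using that s by auto
  have "real (card {z \<in> ball a s1. f z = 0}) * ln (s2 / s1)
      \<le> (\<Sum>w\<in>Z. ln (max s2 (norm (w - a))) - ln (max s1 (norm (w - a))))"
    unfolding card_eq[OF less_imp_le[OF s(2)]]
    by (intro sum_mono) (use s in \<open>auto simp: L max_def intro: lnmono\<close>)
  then show "real (card {z \<in> ball a s1. f z = 0}) * (2 * pi * ln (s2 / s1)) \<le> J s2 - J s1"
    unfolding diff using mult_left_mono[of _ _ "2 * pi"] by (simp add: ac_simps)
  have "(\<Sum>w\<in>Z. ln (max s2 (norm (w - a))) - ln (max s1 (norm (w - a))))
      \<le> real (card {z \<in> ball a s2. f z = 0}) * ln (s2 / s1)"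
    unfolding card_eq[OF order_refl]
    by (intro sum_mono) (use s in \<open>auto simp: L max_def intro: lnmono\<close>)
  then show "J s2 - J s1 \<le> real (card {z \<in> ball a s2. f z = 0}) * (2 * pi * ln (s2 / s1))"
    unfolding diff using mult_left_mono[of _ _ "2 * pi"] by (simp add: ac_simps)
qed

section \<open>The standard complex normal law\<close>

text \<open>The circularly symmetric complex normal law with \<open>E |Z|^2 = 1\<close>. No moment of it is ever computed
  explicitly: a common factor in all variances cancels in the intensity.\<close>

definition std_normal :: "complex measure" where
  "std_normal = density lborel (\<lambda>z. ennreal (exp (- (norm z)\<^sup>2) / pi))"

lemma sets_std_normal [simp, measurable_cong]: "sets std_normal = sets borel"
  by (simp add: std_normal_def)

lemma space_std_normal [simp]: "space std_normal = UNIV"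
  by (simp add: std_normal_def)

lemma nn_integral_lborel_scale:
  fixes g :: "complex \<Rightarrow> ennreal"
  assumes [measurable]: "g \<in> borel_measurable borel" and c: "c > 0"
  shows "(\<integral>\<^sup>+z. g z \<partial>lborel) = (\<integral>\<^sup>+z. ennreal (c\<^sup>2) * g (of_real c * z) \<partial>lborel)"
proof -
  have "(\<integral>\<^sup>+z. g z \<partial>lborel) = (\<integral>\<^sup>+z. g z \<partial>density (distr lborel borel (\<lambda>x. 0 + c *\<^sub>R x)) (\<lambda>_. \<bar>c\<bar> ^ DIM(complex)))"
    using c by (subst lborel_affine[of c 0]) auto
  also have "\<dots> = (\<integral>\<^sup>+z. ennreal (c\<^sup>2) * g (of_real c * z) \<partial>lborel)"
    by (simp add: nn_integral_density nn_integral_distr scaleR_conv_of_real)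
  finally show ?thesis .
qed

text \<open>Scaling the plane by \<open>sqrt v\<close> multiplies Lebesgue measure by \<open>v\<close>, which cancels the normalisation
  of the density.\<close>

lemma complex_normal_standardize:
  assumes Z: "complex_normal M v Z" and v: "v > 0"
  shows "distr M borel (\<lambda>\<omega>. Z \<omega> / of_real (sqrt v)) = std_normal"
    and "Z \<in> borel_measurable M"
proof -
  let ?f = "\<lambda>z :: complex. ennreal (exp (- (norm z)\<^sup>2 / v) / (pi * v))"
  have D: "distributed M lborel Z ?f" using Z v by (simp add: complex_normal_def)
  then have meas[measurable]: "Z \<in> borel_measurable M" and dens: "distr M lborel Z = density lborel ?f"
    by (auto simp: distributed_def)
  show "Z \<in> borel_measurable M" by (rule meas)
  show "distr M borel (\<lambda>\<omega>. Z \<omega> / of_real (sqrt v)) = std_normal"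
  proof (rule measure_eqI)
    fix A :: "complex set" assume "A \<in> sets (distr M borel (\<lambda>\<omega>. Z \<omega> / of_real (sqrt v)))"
    then have [measurable]: "A \<in> sets borel" by simp
    have "emeasure (distr M borel (\<lambda>\<omega>. Z \<omega> / of_real (sqrt v))) A
        = emeasure (distr (distr M lborel Z) borel (\<lambda>z. z / of_real (sqrt v))) A"
      by (subst distr_distr) (auto simp: o_def)
    also have "\<dots> = (\<integral>\<^sup>+z. indicator A (z / of_real (sqrt v)) \<partial>distr M lborel Z)"
    proof -
      have "emeasure (distr (distr M lborel Z) borel (\<lambda>z. z / of_real (sqrt v))) A
        = (\<integral>\<^sup>+z. indicator A z \<partial>distr (distr M lborel Z) borel (\<lambda>z. z / of_real (sqrt v)))" by simp
      also have "\<dots> = (\<integral>\<^sup>+z. indicator A (z / of_real (sqrt v)) \<partial>distr M lborel Z)"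
        by (subst nn_integral_distr) auto
      finally show ?thesis .
    qed
    also have "\<dots> = (\<integral>\<^sup>+z. ?f z * indicator A (z / of_real (sqrt v)) \<partial>lborel)"
      unfolding dens by (subst nn_integral_density) auto
    also have "\<dots> = (\<integral>\<^sup>+z. ennreal ((sqrt v)\<^sup>2) * (?f (of_real (sqrt v) * z) * indicator A (of_real (sqrt v) * z / of_real (sqrt v))) \<partial>lborel)"
      by (rule nn_integral_lborel_scale) (use v in auto)
    also have "\<dots> = (\<integral>\<^sup>+z. ennreal (exp (- (norm z)\<^sup>2) / pi) * indicator A z \<partial>lborel)"
    proof (rule nn_integral_cong)
      fix z :: complex
      have "v * (exp (- (v * (norm z)\<^sup>2) / v) / (pi * v)) = exp (- (norm z)\<^sup>2) / pi" using v by simp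
      then show "ennreal ((sqrt v)\<^sup>2) * (?f (of_real (sqrt v) * z) * indicator A (of_real (sqrt v) * z / of_real (sqrt v)))
         = ennreal (exp (- (norm z)\<^sup>2) / pi) * indicator A z"
        using v by (simp add: norm_mult power_mult_distrib mult.assoc[symmetric] ennreal_mult'[symmetric])
    qed
    also have "\<dots> = emeasure std_normal A"
      unfolding std_normal_def by (subst emeasure_density) auto
    finally show "emeasure (distr M borel (\<lambda>\<omega>. Z \<omega> / of_real (sqrt v))) A = emeasure std_normal A" .
  qed simp
qed

lemma std_normal_ball: 
  assumes "\<delta> \<ge> 0" shows "emeasure std_normal (ball (0 :: complex) \<delta>) \<le> ennreal (\<delta>\<^sup>2)"
proof -
  have "emeasure std_normal (ball 0 \<delta>) = (\<integral>\<^sup>+z. ennreal (exp (- (norm z)\<^sup>2) / pi) * indicator (ball (0 :: complex) \<delta>) z \<partial>lborel)"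
    unfolding std_normal_def by (subst emeasure_density) auto
  also have "\<dots> \<le> (\<integral>\<^sup>+z. ennreal (1 / pi) * indicator (ball (0 :: complex) \<delta>) z \<partial>lborel)"
    by (intro nn_integral_mono mult_right_mono ennreal_leI divide_right_mono) auto
  also have "\<dots> = ennreal (1 / pi) * emeasure lborel (ball (0::complex) \<delta>)"
    by (subst nn_integral_cmult_indicator) auto
  also have "\<dots> = ennreal (1 / pi) * ennreal (pi * \<delta>\<^sup>2)"
    using assms by (subst emeasure_ball) (auto simp: unit_ball_vol_2 ennreal_mult' ennreal_mult'' mult_ac)
  also have "\<dots> = ennreal (\<delta>\<^sup>2)" by (subst ennreal_mult'[symmetric]) auto
  finally show ?thesis .
qed

text \<open>If all \<open>Y n\<close> share one law, so does their almost sure limit. Bounded continuous test functions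
  pass to the limit by dominated convergence, and truncated multiples of the distance to the complement
  approximate the indicator of any open set.\<close>

lemma law_of_AE_limit:
  fixes Y :: "nat \<Rightarrow> 'a \<Rightarrow> 'b::metric_space"
  assumes M: "prob_space M" and Y[measurable]: "\<And>n. Y n \<in> borel_measurable M" and Z[measurable]: "Z \<in> borel_measurable M"
    and conv: "AE \<omega> in M. (\<lambda>n. Y n \<omega>) \<longlonglongrightarrow> Z \<omega>"
    and law: "\<And>n. distr M borel (Y n) = N"
  shows "distr M borel Z = N"
proof -
  interpret prob_space M by (rule M)
  have sN: "sets N = sets borel" using law[of 0] by (metis sets_distr)
  interpret N: prob_space N using law[of 0] prob_space_distr[OF Y[of 0]] by simp
  interpret D: prob_space "distr M borel Z" by (rule prob_space_distr) simp
  have eq_cont: "(LINT x|distr M borel Z. g x) = (LINT x|N. g x)"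
    if g: "continuous_on UNIV g" and b: "\<And>x. \<bar>g x\<bar> \<le> (1::real)" for g :: "'b \<Rightarrow> real"
  proof -
    have [measurable]: "g \<in> borel_measurable borel" using g by (rule borel_measurable_continuous_onI)
    have "(\<lambda>n. LINT \<omega>|M. g (Y n \<omega>)) \<longlonglongrightarrow> (LINT \<omega>|M. g (Z \<omega>))"
    proof (rule integral_dominated_convergence[where w = "\<lambda>_. 1"])
      show "AE \<omega> in M. (\<lambda>n. g (Y n \<omega>)) \<longlonglongrightarrow> g (Z \<omega>)"
        using conv by eventually_elim (rule continuous_on_tendsto_compose[OF g], auto)
    qed (use b in auto)
    moreover have "(LINT \<omega>|M. g (Y n \<omega>)) = (LINT x|N. g x)" for n
      unfolding law[of n, symmetric] by (subst integral_distr) auto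
    ultimately have "(LINT \<omega>|M. g (Z \<omega>)) = (LINT x|N. g x)"
      by (simp add: LIMSEQ_const_iff)
    then show ?thesis by (subst integral_distr) auto
  qed
  have eq_open: "measure (distr M borel Z) U = measure N U" if U: "open U" for U :: "'b set"
  proof (cases "U = UNIV")
    case True
    then show ?thesis using D.prob_space N.prob_space sets_eq_imp_space_eq[OF sN] by simp
  next
    case False
    then have ne: "- U \<noteq> {}" by auto
    define g where "g k x = min 1 (real k * infdist x (- U))" for k x
    have cont: "continuous_on UNIV (g k)" for k
      unfolding g_def by (intro continuous_intros)
    have b: "\<bar>g k x\<bar> \<le> 1" for k x unfolding g_def by (auto simp: infdist_nonneg min_def)
    have lim: "(\<lambda>k. g k x) \<longlonglongrightarrow> indicator U x" for x
    proof (cases "x \<in> U")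
      case True
      then have pos: "infdist x (- U) > 0" using U ne infdist_pos_not_in_closed[of "- U" x] by auto
      have "eventually (\<lambda>k. real k > 1 / infdist x (- U)) sequentially"
        using filterlim_real_sequentially by (simp add: filterlim_at_top_dense)
      then have "eventually (\<lambda>k. g k x = indicator U x) sequentially"
        by eventually_elim (use pos True in \<open>auto simp: g_def field_simps min_def\<close>)
      then show ?thesis by (rule tendsto_eventually)
    qed (simp add: g_def)
    have [measurable]: "g k \<in> borel_measurable borel" for k using cont by (rule borel_measurable_continuous_onI)
    have mU[measurable]: "U \<in> sets borel" using U by simp
    have dc: "(\<lambda>k. LINT x|L. g k x) \<longlonglongrightarrow> measure L U" if L: "prob_space L" "sets L = sets borel" for L
    proof -
      interpret L: prob_space L by (rule L)
      note [measurable_cong] = L(2)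
      have "(\<lambda>k. LINT x|L. g k x) \<longlonglongrightarrow> (LINT x|L. indicator U x)"
        by (rule integral_dominated_convergence[where w = "\<lambda>_. 1"]) (use lim b in auto)
      then show ?thesis using sets_eq_imp_space_eq[OF L(2)] by simp
    qed
    have "(\<lambda>k. LINT x|N. g k x) \<longlonglongrightarrow> measure (distr M borel Z) U"
      using dc[OF D.prob_space_axioms] eq_cont[OF cont b] by simp
    with dc[OF N.prob_space_axioms sN] show ?thesis using LIMSEQ_unique by blast
  qed
  show ?thesis
  proof (rule measure_eqI_generator_eq[where E = "{S. open S}" and A = "\<lambda>_. UNIV" and \<Omega> = UNIV])
    show "Int_stable {S :: 'b set. open S}" by (auto simp: Int_stable_def)
    show "sets N = sigma_sets UNIV {S. open S}" unfolding sN by (simp add: borel_def)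
    show "sets (distr M borel Z) = sigma_sets UNIV {S. open S}" by (simp add: borel_def)
  qed (auto simp: eq_open D.emeasure_eq_measure N.emeasure_eq_measure)
qed

text \<open>The part of the hypotheses that speaks of the law of the process; everything about zeros is
  derived from it. The density of the spectral measure joins in \<open>spectral_density\<close>.\<close>

locale spectral_gaussian = prob_space M for M :: "'a measure" +
  fixes \<xi> :: "int \<Rightarrow> 'a \<Rightarrow> complex" and \<gamma> :: "int \<Rightarrow> complex" and F :: "real measure"
  assumes gaussian: "complex_gaussian_process M \<xi>"
    and covariance: "has_covariance M \<xi> \<gamma>"
    and normalized: "\<gamma> 0 = 1"
    and spectral: "spectral_measure \<gamma> F"
begin

lemma measurable_xi [measurable]: "\<xi> k \<in> borel_measurable M"
  using gaussian by (simp add: complex_gaussian_process_def)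

sublocale F: prob_space F using spectral by (simp add: spectral_measure_def)

lemma sets_F: "sets F = sets (restrict_space borel {-pi<..pi})"
  using spectral by (simp add: spectral_measure_def)

lemma measurable_F [measurable (raw)]: "g \<in> borel_measurable borel \<Longrightarrow> g \<in> borel_measurable F"
  by (subst measurable_cong_sets[OF sets_F refl]) (rule measurable_restrict_space1)

lemma second_moment_xi: "integrable M (\<lambda>\<omega>. (norm (\<xi> k \<omega>))\<^sup>2)" "(LINT \<omega>|M. (norm (\<xi> k \<omega>))\<^sup>2) = 1"
proof -
  have eq: "\<xi> k \<omega> * cnj (\<xi> k \<omega>) = of_real ((norm (\<xi> k \<omega>))\<^sup>2)" for \<omega>
    by (simp add: complex_norm_square[symmetric])
  have "integrable M (\<lambda>\<omega>. \<xi> k \<omega> * cnj (\<xi> k \<omega>))" "(LINT \<omega>|M. \<xi> k \<omega> * cnj (\<xi> k \<omega>)) = 1"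
    using covariance normalized by (auto simp: has_covariance_def)
  then show "integrable M (\<lambda>\<omega>. (norm (\<xi> k \<omega>))\<^sup>2)" "(LINT \<omega>|M. (norm (\<xi> k \<omega>))\<^sup>2) = 1"
    unfolding eq by (auto simp: complex_of_real_integrable_eq of_real_eq_1_iff simp del: of_real_power)
qed

definition second_moment_std :: real where "second_moment_std = (LINT w|std_normal. (norm w)\<^sup>2)"

text \<open>The variance parameter is proportional to the second moment; this is all that is needed to identify it.\<close>

lemma second_moment_complex_normal:
  assumes Z: "complex_normal M v Z" and v: "v \<ge> 0"
  shows "(LINT \<omega>|M. (norm (Z \<omega>))\<^sup>2) = v * second_moment_std"
proof (cases "v = 0")
  case True
  then have "Z \<in> borel_measurable M" "AE \<omega> in M. Z \<omega> = 0" using Z by (auto simp: complex_normal_def)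
  then have "(LINT \<omega>|M. (norm (Z \<omega>))\<^sup>2) = (LINT \<omega>|M. 0)" by (intro integral_cong_AE) auto
  then show ?thesis using True by simp
next
  case False
  then have v0: "v > 0" using v by simp
  note std = complex_normal_standardize[OF Z v0]
  have [measurable]: "Z \<in> borel_measurable M" by (rule std(2))
  have "second_moment_std = (LINT \<omega>|M. (norm (Z \<omega> / of_real (sqrt v)))\<^sup>2)"
    unfolding second_moment_std_def std(1)[symmetric] by (subst integral_distr) auto
  also have "\<dots> = (LINT \<omega>|M. (norm (Z \<omega>))\<^sup>2 / v)"
    using v0 by (simp add: norm_divide power_divide)
  finally show ?thesis using v0 by (simp add: field_simps)
qed

lemma xi_0_normal: obtains v where "v > 0" "complex_normal M v (\<xi> 0)"
proof -
  obtain v where v: "v \<ge> 0" "complex_normal M v (\<lambda>\<omega>. \<Sum>k\<in>{0}. 1 * \<xi> k \<omega>)"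
    using gaussian[unfolded complex_gaussian_process_def, THEN conjunct2, rule_format, of "{0}" "\<lambda>_. 1"] by auto
  then have n: "complex_normal M v (\<xi> 0)" by simp
  have "v \<noteq> 0" using second_moment_complex_normal[OF n v(1)] second_moment_xi(2)[of 0] by auto
  then have "v > 0" using v(1) by simp
  from that[OF this n] show ?thesis .
qed

text \<open>The hypothesis \<open>E |\<xi> 0|^2 = 1\<close> supplies both finiteness and positivity of the constant without
  integrating a Gaussian.\<close>

lemma second_moment_std_pos: "second_moment_std > 0" and integrable_std_norm2: "integrable std_normal (\<lambda>w. (norm w)\<^sup>2)"
proof -
  obtain v where v: "v > 0" "complex_normal M v (\<xi> 0)" by (rule xi_0_normal)
  have "v * second_moment_std = 1" using second_moment_complex_normal[OF v(2)] v(1) second_moment_xi(2)[of 0] by simp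
  then show "second_moment_std > 0" using v(1) zero_less_mult_pos[of v second_moment_std] by simp
  have "integrable M (\<lambda>\<omega>. (norm (\<xi> 0 \<omega> / of_real (sqrt v)))\<^sup>2)"
    using second_moment_xi(1)[of 0] v(1) by (simp add: norm_divide power_divide)
  then show "integrable std_normal (\<lambda>w. (norm w)\<^sup>2)"
    unfolding complex_normal_standardize(1)[OF v(2,1), symmetric] by (subst integrable_distr_eq) auto
qed

sublocale std: prob_space std_normal
proof -
  obtain v where v: "v > 0" "complex_normal M v (\<xi> 0)" by (rule xi_0_normal)
  show "prob_space std_normal"
    unfolding complex_normal_standardize(1)[OF v(2,1), symmetric] by (rule prob_space_distr) auto
qed

definition partial :: "nat \<Rightarrow> complex \<Rightarrow> 'a \<Rightarrow> complex" where
  "partial n z \<omega> = (\<Sum>k<n. \<xi> (int k) \<omega> * z ^ k)"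

lemma measurable_partial [measurable]: "partial n z \<in> borel_measurable M"
  unfolding partial_def by measurable

text \<open>The partial sum \<open>partial n z\<close> under the spectral isometry that sends \<open>\<xi> k\<close> to \<open>e^(-ikt)\<close>.\<close>

definition geom :: "nat \<Rightarrow> complex \<Rightarrow> real \<Rightarrow> complex" where
  "geom n z t = (\<Sum>k<n. (z * cis (- t)) ^ k)"

definition Kn :: "nat \<Rightarrow> complex \<Rightarrow> real" where
  "Kn n z = (LINT t|F. (norm (geom n z t))\<^sup>2)"

lemma second_moment_partial: "(LINT \<omega>|M. (norm (partial n z \<omega>))\<^sup>2) = Kn n z"
proof -
  have intc: "integrable M (\<lambda>\<omega>. \<xi> k \<omega> * cnj (\<xi> l \<omega>))" and cov: "(LINT \<omega>|M. \<xi> k \<omega> * cnj (\<xi> l \<omega>)) = \<gamma> (k - l)" for k l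
    using covariance by (auto simp: has_covariance_def)
  have eqL: "of_real ((norm (partial n z \<omega>))\<^sup>2) = (\<Sum>k<n. \<Sum>l<n. (z ^ k * cnj z ^ l) * (\<xi> (int k) \<omega> * cnj (\<xi> (int l) \<omega>)))" for \<omega>
    unfolding complex_norm_square partial_def cnj_sum sum_product
    by (intro sum.cong refl) (simp add: mult_ac)
  have eqR: "of_real ((norm (geom n z t))\<^sup>2) = (\<Sum>k<n. \<Sum>l<n. (z ^ k * cnj z ^ l) * exp (- \<i> * of_int (int k - int l) * of_real t))" for t
  proof -
    have "cis (- t) ^ k * cnj (cis (- t)) ^ l = exp (- \<i> * of_int (int k - int l) * of_real t)" for k l
      by (simp add: cis_conv_exp exp_of_nat_mult[symmetric] exp_cnj exp_add[symmetric] algebra_simps)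
    note e = this
    have "(z * cis (- t)) ^ k * cnj ((z * cis (- t)) ^ l) = (z ^ k * cnj z ^ l) * (cis (- t) ^ k * cnj (cis (- t)) ^ l)" for k l
      by (simp only: power_mult_distrib complex_cnj_mult complex_cnj_power mult_ac)
    then show ?thesis
      unfolding complex_norm_square geom_def cnj_sum sum_product e by (intro sum.cong refl) simp
  qed
  have gam: "\<gamma> k = (LINT t|F. exp (- \<i> * of_int k * of_real t))" for k
    using spectral by (simp add: spectral_measure_def)
  have intF: "integrable F (\<lambda>t. exp (- \<i> * of_int k * of_real t))" for k
    by (rule F.integrable_const_bound[where B = 1]) (auto intro!: AE_I2 borel_measurable_continuous_onI continuous_intros measurable_F)
  have "of_real (LINT \<omega>|M. (norm (partial n z \<omega>))\<^sup>2) = (\<Sum>k<n. \<Sum>l<n. (z ^ k * cnj z ^ l) * \<gamma> (int k - int l))"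
    unfolding integral_complex_of_real[symmetric] eqL by (simp add: intc cov)
  also have "\<dots> = of_real (LINT t|F. (norm (geom n z t))\<^sup>2)"
    unfolding integral_complex_of_real[symmetric] eqR using intF by (simp add: gam del: of_int_diff)
  finally show ?thesis unfolding of_real_eq_iff Kn_def .
qed

lemma partial_normal: "complex_normal M (Kn n z / second_moment_std) (partial n z)"
proof -
  obtain v where v: "v \<ge> 0" "complex_normal M v (\<lambda>\<omega>. \<Sum>k\<in>int ` {..<n}. z ^ nat k * \<xi> k \<omega>)"
    using gaussian[unfolded complex_gaussian_process_def, THEN conjunct2, rule_format, of "int ` {..<n}" "\<lambda>k. z ^ nat k"] by auto
  have "(\<lambda>\<omega>. \<Sum>k\<in>int ` {..<n}. z ^ nat k * \<xi> k \<omega>) = partial n z"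
    by (auto simp: partial_def sum.reindex mult.commute)
  with v have n: "complex_normal M v (partial n z)" by simp
  have "v * second_moment_std = Kn n z" using second_moment_complex_normal[OF n v(1)] second_moment_partial by simp
  then have "v = Kn n z / second_moment_std" using second_moment_std_pos by (simp add: field_simps)
  with n show ?thesis by simp
qed

end

text \<open>For integrating the logarithm near \<open>0\<close>: there \<open>-ln |w|\<close> is at most the number of balls of radius
  \<open>e^(-n)\<close> that contain \<open>w\<close>.\<close>

lemma suminf_emeasure_small_balls:
  "(\<Sum>n. emeasure std_normal (ball 0 (exp (- real n)))) < \<infinity>"
proof -
  have "(\<Sum>n. emeasure std_normal (ball 0 (exp (- real n)))) \<le> (\<Sum>n. ennreal ((exp (- 2)) ^ n))"
  proof (rule suminf_le)
    fix n
    have "(exp (- real n))\<^sup>2 = (exp (- 2)) ^ n"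
      by (simp add: exp_of_nat_mult[symmetric] power2_eq_square mult_exp_exp)
    then show "emeasure std_normal (ball 0 (exp (- real n))) \<le> ennreal ((exp (- 2)) ^ n)"
      using std_normal_ball[of "exp (- real n)"] by simp
  qed auto
  also have "\<dots> = ennreal (\<Sum>n. (exp (- 2)) ^ n)"
    by (rule suminf_ennreal2) (auto intro: summable_geometric)
  also have "\<dots> < \<infinity>" by simp
  finally show ?thesis .
qed

context spectral_gaussian
begin

lemma integrable_std_ln: "integrable std_normal (\<lambda>w. ln (norm w))"
proof (rule integrableI_bounded)
  show "(\<lambda>w. ln (norm w)) \<in> borel_measurable std_normal" by measurable
  have [measurable]: "ball 0 (exp (- real n)) \<in> sets (borel :: complex measure)" for n by simp
  have le: "ennreal (norm (ln (norm w))) \<le> ennreal ((norm w)\<^sup>2) + (\<Sum>n. indicator (ball 0 (exp (- real n))) w)" for w :: complex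
  proof (cases "norm w \<ge> 1 \<or> w = 0")
    case True
    then have "norm (ln (norm w)) \<le> (norm w)\<^sup>2"
    proof
      assume w: "norm w \<ge> 1"
      then have "ln (norm w) \<le> norm w - 1" by (intro ln_le_minus_one) auto
      also have "\<dots> \<le> norm w * 1" by simp
      also have "\<dots> \<le> (norm w)\<^sup>2" unfolding power2_eq_square using w by (intro mult_left_mono) auto
      finally show ?thesis using w by simp
    qed simp
    then show ?thesis by (intro order_trans[OF ennreal_leI add_increasing2]) auto
  next
    case False
    then have w: "0 < norm w" "norm w < 1" by auto
    define x where "x = - ln (norm w)"
    have x: "x > 0" using w by (simp add: x_def)
    define N where "N = nat \<lceil>x\<rceil>"
    have ind: "indicator (ball 0 (exp (- real n))) w = (1 :: ennreal)" if "n < N" for n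
    proof -
      have "real n < x" using that unfolding N_def by linarith
      then have "ln (norm w) < - real n" by (simp add: x_def)
      then have "norm w < exp (- real n)" using w by (metis exp_less_mono exp_ln)
      then show ?thesis by simp
    qed
    have "ennreal (norm (ln (norm w))) = ennreal x" using w x by (simp add: x_def)
    also have "\<dots> \<le> ennreal (real N)" using x by (intro ennreal_leI) (simp add: N_def)
    also have "\<dots> = (\<Sum>n<N. indicator (ball 0 (exp (- real n))) w)" using ind by (simp add: ennreal_of_nat_eq_real_of_nat)
    also have "\<dots> \<le> (\<Sum>n. indicator (ball 0 (exp (- real n))) w)" by (rule sum_le_suminf) auto
    finally show ?thesis by (simp add: add_increasing)
  qed
  have "(\<integral>\<^sup>+w. ennreal (norm (ln (norm w))) \<partial>std_normal)
      \<le> (\<integral>\<^sup>+w. ennreal ((norm w)\<^sup>2) + (\<Sum>n. indicator (ball 0 (exp (- real n))) w) \<partial>std_normal)"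
    by (intro nn_integral_mono le)
  also have "\<dots> = (\<integral>\<^sup>+w. ennreal ((norm w)\<^sup>2) \<partial>std_normal) + (\<integral>\<^sup>+w. (\<Sum>n. indicator (ball 0 (exp (- real n))) w) \<partial>std_normal)"
    by (intro nn_integral_add) measurable
  also have "(\<integral>\<^sup>+w. (\<Sum>n. indicator (ball 0 (exp (- real n))) w) \<partial>std_normal)
      = (\<Sum>n. emeasure std_normal (ball 0 (exp (- real n))))"
    by (subst nn_integral_suminf) auto
  also have "(\<integral>\<^sup>+w. ennreal ((norm w)\<^sup>2) \<partial>std_normal) = ennreal second_moment_std"
    unfolding second_moment_std_def by (rule nn_integral_eq_integral[OF integrable_std_norm2]) simp
  also have "ennreal second_moment_std + (\<Sum>n. emeasure std_normal (ball 0 (exp (- real n)))) < \<infinity>"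
    using suminf_emeasure_small_balls by simp
  finally show "(\<integral>\<^sup>+w. ennreal (norm (ln (norm w))) \<partial>std_normal) < \<infinity>" .
qed

lemma std_AE_nonzero: "AE w in std_normal. w \<noteq> 0"
proof -
  have "emeasure std_normal {0} = (\<integral>\<^sup>+z. ennreal (exp (- (norm z)\<^sup>2) / pi) * indicator {0} z \<partial>(lborel :: complex measure))"
    unfolding std_normal_def by (subst emeasure_density) auto
  also have "\<dots> = 0" by (subst nn_integral_0_iff_AE) (use AE_lborel_singleton[of "0 :: complex"] in auto)
  finally have "{0} \<in> null_sets std_normal" by (auto intro: null_setsI)
  then show ?thesis by (rule AE_I') auto
qed

text \<open>The kernel \<open>E |X z|^2\<close> in spectral form.\<close>

definition K :: "complex \<Rightarrow> real" where
  "K z = (LINT t|F. 1 / (norm (1 - z * cis (- t)))\<^sup>2)"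

lemma norm_one_minus_ge: "norm z < 1 \<Longrightarrow> 1 - norm z \<le> norm (1 - z * cis (- t))"
  using norm_triangle_ineq2[of 1 "z * cis (- t)"] by (simp add: norm_mult)

lemma integrable_bounded_F:
  fixes g :: "real \<Rightarrow> 'b::{banach,second_countable_topology}"
  assumes "g \<in> borel_measurable borel" "\<And>t. norm (g t) \<le> B"
  shows "integrable F g"
  using assms by (intro F.integrable_const_bound[where B = B]) (auto intro: measurable_F)

lemma integrable_K: assumes "norm z < 1" shows "integrable F (\<lambda>t. 1 / (norm (1 - z * cis (- t)))\<^sup>2)"
proof (rule integrable_bounded_F)
  show "(\<lambda>t. 1 / (norm (1 - z * cis (- t)))\<^sup>2) \<in> borel_measurable borel"
    by (intro borel_measurable_divide borel_measurable_power borel_measurable_continuous_onI continuous_intros)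
  fix t
  have "(1 - norm z)\<^sup>2 \<le> (norm (1 - z * cis (- t)))\<^sup>2"
    using norm_one_minus_ge[OF assms, of t] assms by (intro power_mono) auto
  then show "norm (1 / (norm (1 - z * cis (- t)))\<^sup>2) \<le> 1 / (1 - norm z)\<^sup>2"
    using assms by (simp add: frac_le)
qed

lemma K_ge: assumes "norm z < 1" shows "1 / 4 \<le> K z"
proof -
  have "1 / 4 = (LINT t|F. 1 / (4 :: real))" using F.prob_space by simp
  also have "\<dots> \<le> K z"
    unfolding K_def
  proof (rule integral_mono[OF _ integrable_K[OF assms]])
    fix t
    have "norm (1 - z * cis (- t)) \<le> norm (1::complex) + norm (z * cis (- t))" by (rule norm_triangle_ineq4)
    then have "norm (1 - z * cis (- t)) \<le> 2" using assms by (simp add: norm_mult)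
    then have "(norm (1 - z * cis (- t)))\<^sup>2 \<le> 2\<^sup>2" by (intro power_mono) auto
    moreover have "0 < norm (1 - z * cis (- t))" using norm_one_minus_ge[OF assms, of t] assms by linarith
    then have "0 < (norm (1 - z * cis (- t)))\<^sup>2" by (rule zero_less_power)
    ultimately show "1 / 4 \<le> 1 / (norm (1 - z * cis (- t)))\<^sup>2" by (intro frac_le) auto
  qed simp
  finally show ?thesis .
qed

lemma Kn_tendsto: assumes z: "norm z < 1" shows "(\<lambda>n. Kn n z) \<longlonglongrightarrow> K z"
  unfolding Kn_def K_def
proof (rule integral_dominated_convergence[where w = "\<lambda>_. (1 / (1 - norm z))\<^sup>2"])
  show "(\<lambda>t. 1 / (norm (1 - z * cis (- t)))\<^sup>2) \<in> borel_measurable F"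
    using integrable_K[OF z] by simp
  show "(\<lambda>t. (norm (geom n z t))\<^sup>2) \<in> borel_measurable F" for n
    unfolding geom_def by (intro measurable_F borel_measurable_continuous_onI continuous_intros)
  have n: "norm (z * cis (- t)) < 1" for t using z by (simp add: norm_mult)
  show "AE t in F. (\<lambda>n. (norm (geom n z t))\<^sup>2) \<longlonglongrightarrow> 1 / (norm (1 - z * cis (- t)))\<^sup>2"
  proof (rule AE_I2)
    fix t
    have "(\<lambda>n. geom n z t) \<longlonglongrightarrow> 1 / (1 - z * cis (- t))"
      using geometric_sums[OF n[of t]] by (simp add: sums_def geom_def)
    then have "(\<lambda>n. (norm (geom n z t))\<^sup>2) \<longlonglongrightarrow> (norm (1 / (1 - z * cis (- t))))\<^sup>2"
      by (intro tendsto_intros)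
    then show "(\<lambda>n. (norm (geom n z t))\<^sup>2) \<longlonglongrightarrow> 1 / (norm (1 - z * cis (- t)))\<^sup>2"
      by (simp add: norm_divide power_divide)
  qed
  show "AE t in F. norm ((norm (geom n z t))\<^sup>2) \<le> (1 / (1 - norm z))\<^sup>2" for n
  proof (rule AE_I2)
    fix t
    have "norm (geom n z t) \<le> (\<Sum>k<n. norm ((z * cis (- t)) ^ k))" unfolding geom_def by (rule norm_sum)
    also have "\<dots> = (\<Sum>k<n. norm z ^ k)" by (simp add: norm_power norm_mult)
    also have "\<dots> \<le> (\<Sum>k. norm z ^ k)" using z by (intro sum_le_suminf summable_geometric) auto
    also have "\<dots> = 1 / (1 - norm z)" using z by (intro suminf_geometric) auto
    finally have "(norm (geom n z t))\<^sup>2 \<le> (1 / (1 - norm z))\<^sup>2" by (intro power_mono) auto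
    then show "norm ((norm (geom n z t))\<^sup>2) \<le> (1 / (1 - norm z))\<^sup>2" by simp
  qed
qed simp

definition converges :: "'a \<Rightarrow> bool" where
  "converges \<omega> \<longleftrightarrow> (\<forall>z. norm z < 1 \<longrightarrow> summable (\<lambda>k. \<xi> (int k) \<omega> * z ^ k))"

text \<open>First moments of the coefficients are bounded, so \<open>\<Sum> |\<xi> k| r^k\<close> has finite mean for each \<open>r < 1\<close>;
  countably many radii suffice.\<close>

lemma AE_converges: "AE \<omega> in M. converges \<omega>"
proof -
  define r where "r n = 1 - 1 / (real n + 2)" for n
  have r: "0 < r n" "r n < 1" for n by (auto simp: r_def field_simps)
  have "AE \<omega> in M. summable (\<lambda>k. norm (\<xi> (int k) \<omega>) * r n ^ k)" for n
  proof -
    have b: "(\<integral>\<^sup>+\<omega>. ennreal (norm (\<xi> k \<omega>)) \<partial>M) \<le> 2" for k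
    proof -
      have "(\<integral>\<^sup>+\<omega>. ennreal (norm (\<xi> k \<omega>)) \<partial>M) \<le> (\<integral>\<^sup>+\<omega>. ennreal (1 + (norm (\<xi> k \<omega>))\<^sup>2) \<partial>M)"
      proof (intro nn_integral_mono ennreal_leI)
        fix \<omega> show "norm (\<xi> k \<omega>) \<le> 1 + (norm (\<xi> k \<omega>))\<^sup>2"
          using sum_squares_ge_zero[of "norm (\<xi> k \<omega>) - 1/2" 0] by (simp add: power2_eq_square algebra_simps)
      qed
      also have "\<dots> = ennreal (LINT \<omega>|M. 1 + (norm (\<xi> k \<omega>))\<^sup>2)"
        using second_moment_xi(1)[of k] by (intro nn_integral_eq_integral) auto
      also have "(LINT \<omega>|M. 1 + (norm (\<xi> k \<omega>))\<^sup>2) = 2" using second_moment_xi[of k] prob_space by simp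
      finally show ?thesis by simp
    qed
    have "(\<integral>\<^sup>+\<omega>. (\<Sum>k. ennreal (norm (\<xi> (int k) \<omega>) * r n ^ k)) \<partial>M)
        = (\<Sum>k. \<integral>\<^sup>+\<omega>. ennreal (norm (\<xi> (int k) \<omega>) * r n ^ k) \<partial>M)"
      by (rule nn_integral_suminf) measurable
    also have "\<dots> = (\<Sum>k. ennreal (r n ^ k) * (\<integral>\<^sup>+\<omega>. ennreal (norm (\<xi> (int k) \<omega>)) \<partial>M))"
      using r[of n] by (subst nn_integral_cmult[symmetric]) (auto simp: ennreal_mult' mult.commute)
    also have "\<dots> \<le> (\<Sum>k. ennreal (r n ^ k) * 2)"
      by (intro suminf_le mult_left_mono b) auto
    also have "\<dots> = (\<Sum>k. ennreal (r n ^ k)) * 2" by simp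
    also have "(\<Sum>k. ennreal (r n ^ k)) = ennreal (\<Sum>k. r n ^ k)"
      using r[of n] by (intro suminf_ennreal2) (auto intro: summable_geometric)
    also have "ennreal (\<Sum>k. r n ^ k) * 2 < \<infinity>" by (simp add: ennreal_mult_less_top)
    finally have fin: "(\<integral>\<^sup>+\<omega>. (\<Sum>k. ennreal (norm (\<xi> (int k) \<omega>) * r n ^ k)) \<partial>M) < \<infinity>" .
    have "AE \<omega> in M. (\<Sum>k. ennreal (norm (\<xi> (int k) \<omega>) * r n ^ k)) \<noteq> \<infinity>"
      by (rule nn_integral_noteq_infinite) (use fin in auto)
    then show ?thesis
    proof eventually_elim
      case (elim \<omega>)
      then show ?case using r[of n] by (intro summable_suminf_not_top) auto
    qed
  qed
  then have "AE \<omega> in M. \<forall>n. summable (\<lambda>k. norm (\<xi> (int k) \<omega>) * r n ^ k)"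
    by (simp add: AE_all_countable)
  then show ?thesis
  proof eventually_elim
    case (elim \<omega>)
    show ?case unfolding converges_def
    proof (intro allI impI)
      fix z :: complex assume z: "norm z < 1"
      have "r \<longlonglongrightarrow> 1" unfolding r_def by real_asymp
      then have "eventually (\<lambda>n. norm z < r n) sequentially" using z by (rule order_tendstoD)
      then obtain n where n: "norm z < r n" by (auto simp: eventually_sequentially)
      show "summable (\<lambda>k. \<xi> (int k) \<omega> * z ^ k)"
      proof (rule summable_comparison_test')
        show "summable (\<lambda>k. norm (\<xi> (int k) \<omega>) * r n ^ k)" using elim by blast
        show "norm (\<xi> (int k) \<omega> * z ^ k) \<le> norm (\<xi> (int k) \<omega>) * r n ^ k" for k
          using n by (auto simp: norm_mult norm_power intro!: mult_left_mono power_mono)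
      qed
    qed
  qed
qed

abbreviation X :: "'a \<Rightarrow> complex \<Rightarrow> complex" where "X \<equiv> power_series \<xi>"

lemma converges_sums: "converges \<omega> \<Longrightarrow> norm z < 1 \<Longrightarrow> (\<lambda>k. \<xi> (int k) \<omega> * z ^ k) sums X \<omega> z"
  unfolding power_series_def converges_def by (auto intro: summable_sums)

lemma X_holomorphic: assumes "converges \<omega>" shows "X \<omega> holomorphic_on ball 0 1"
  by (rule power_series_holomorphic[of 0 1 "\<lambda>k. \<xi> (int k) \<omega>"]) (use converges_sums[OF assms] in auto)

lemma measurable_X [measurable]: "(\<lambda>\<omega>. X \<omega> z) \<in> borel_measurable M"
  unfolding power_series_def by measurable

definition std_dev :: "complex \<Rightarrow> real" where "std_dev z = sqrt (K z / second_moment_std)"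

lemma std_dev_pos: "norm z < 1 \<Longrightarrow> std_dev z > 0"
  using K_ge[of z] second_moment_std_pos by (simp add: std_dev_def)

text \<open>Every partial sum, divided by its standard deviation, has exactly the standard law. These
  quotients converge almost surely, so no convergence of densities has to be discussed.\<close>

lemma power_series_law:
  assumes z: "norm z < 1"
  shows "distr M borel (\<lambda>\<omega>. X \<omega> z / of_real (std_dev z)) = std_normal"
proof -
  have lim: "(\<lambda>n. sqrt (Kn n z / second_moment_std)) \<longlonglongrightarrow> std_dev z"
    unfolding std_dev_def by (intro tendsto_intros Kn_tendsto z) (use second_moment_std_pos in auto)
  have "eventually (\<lambda>n. 0 < Kn n z) sequentially"
    using order_tendstoD(1)[OF Kn_tendsto[OF z], of 0] K_ge[OF z] by simp
  then obtain N where N: "\<And>n. n \<ge> N \<Longrightarrow> 0 < Kn n z" by (auto simp: eventually_sequentially)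
  show ?thesis
  proof (rule law_of_AE_limit[where Y = "\<lambda>n \<omega>. partial (n + N) z \<omega> / of_real (sqrt (Kn (n + N) z / second_moment_std))"])
    show "prob_space M" by (rule prob_space_axioms)
    show "AE \<omega> in M. (\<lambda>n. partial (n + N) z \<omega> / of_real (sqrt (Kn (n + N) z / second_moment_std))) \<longlonglongrightarrow> X \<omega> z / of_real (std_dev z)"
      using AE_converges
    proof eventually_elim
      case (elim \<omega>)
      have "(\<lambda>n. partial n z \<omega>) \<longlonglongrightarrow> X \<omega> z"
        using converges_sums[OF elim z] by (simp add: sums_def partial_def)
      then have "(\<lambda>n. partial n z \<omega> / of_real (sqrt (Kn n z / second_moment_std))) \<longlonglongrightarrow> X \<omega> z / of_real (std_dev z)"
        by (intro tendsto_divide tendsto_of_real lim) (use std_dev_pos[OF z] in auto)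
      then show ?case by (rule LIMSEQ_ignore_initial_segment)
    qed
    show "distr M borel (\<lambda>\<omega>. partial (n + N) z \<omega> / of_real (sqrt (Kn (n + N) z / second_moment_std))) = std_normal" for n
      by (rule complex_normal_standardize[OF partial_normal]) (use N[of "n + N"] second_moment_std_pos in auto)
  qed measurable
qed

text \<open>The factor \<open>4\<close> is the uniform bound for \<open>1 / K\<close> on the disc, as \<open>|1 - z e^(-it)| \<le> 2\<close>.\<close>

lemma small_ball:
  assumes z: "norm z < 1" and d: "\<delta> \<ge> 0"
  shows "emeasure M {\<omega> \<in> space M. norm (X \<omega> z) < \<delta>} \<le> ennreal (4 * second_moment_std * \<delta>\<^sup>2)"
proof -
  have "{\<omega> \<in> space M. norm (X \<omega> z) < \<delta>} = (\<lambda>\<omega>. X \<omega> z / of_real (std_dev z)) -` ball 0 (\<delta> / std_dev z) \<inter> space M"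
    using std_dev_pos[OF z] by (auto simp: norm_divide divide_less_cancel)
  then have "emeasure M {\<omega> \<in> space M. norm (X \<omega> z) < \<delta>} = emeasure std_normal (ball 0 (\<delta> / std_dev z))"
    unfolding power_series_law[OF z, symmetric] by (subst emeasure_distr) auto
  also have "\<dots> \<le> ennreal ((\<delta> / std_dev z)\<^sup>2)" using d std_dev_pos[OF z] by (intro std_normal_ball) auto
  also have "\<dots> \<le> ennreal (4 * second_moment_std * \<delta>\<^sup>2)"
  proof (rule ennreal_leI)
    have "(\<delta> / std_dev z)\<^sup>2 = second_moment_std * \<delta>\<^sup>2 * (1 / K z)"
      using K_ge[OF z] second_moment_std_pos by (simp add: std_dev_def power_divide)
    also have "\<dots> \<le> second_moment_std * \<delta>\<^sup>2 * 4"
    proof (rule mult_left_mono)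
      show "1 / K z \<le> 4" using K_ge[OF z] by (simp add: divide_le_eq)
    qed (use second_moment_std_pos in auto)
    finally show "(\<delta> / std_dev z)\<^sup>2 \<le> 4 * second_moment_std * \<delta>\<^sup>2" by simp
  qed
  finally show ?thesis .
qed

definition mean_ln_std :: real where "mean_ln_std = (LINT w|std_normal. ln (norm w))"
definition mean_abs_ln_std :: real where "mean_abs_ln_std = (LINT w|std_normal. \<bar>ln (norm w)\<bar>)"

text \<open>Since \<open>X z = std_dev z * Y\<close> with \<open>Y\<close> standard, the logarithm separates the dependence on \<open>z\<close> from
  a universal constant.\<close>

lemma log_moment:
  assumes z: "norm z < 1"
  shows "integrable M (\<lambda>\<omega>. ln (norm (X \<omega> z)))"
    and "(LINT \<omega>|M. ln (norm (X \<omega> z))) = ln (K z / second_moment_std) / 2 + mean_ln_std"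
    and "(LINT \<omega>|M. \<bar>ln (norm (X \<omega> z))\<bar>) \<le> \<bar>ln (K z / second_moment_std)\<bar> / 2 + mean_abs_ln_std"
proof -
  let ?Y = "\<lambda>\<omega>. X \<omega> z / of_real (std_dev z)"
  have [measurable]: "(\<lambda>\<omega>. X \<omega> z / of_real (std_dev z)) \<in> borel_measurable M" by measurable
  have i: "integrable M (\<lambda>\<omega>. ln (norm (?Y \<omega>)))"
    using integrable_std_ln unfolding power_series_law[OF z, symmetric]
    by (subst (asm) integrable_distr_eq) auto
  have e: "(LINT \<omega>|M. ln (norm (?Y \<omega>))) = mean_ln_std"
    unfolding mean_ln_std_def power_series_law[OF z, symmetric] by (subst integral_distr) auto
  have ea: "(LINT \<omega>|M. \<bar>ln (norm (?Y \<omega>))\<bar>) = mean_abs_ln_std"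
    unfolding mean_abs_ln_std_def power_series_law[OF z, symmetric] by (subst integral_distr) auto
  have "AE w in distr M borel ?Y. w \<noteq> 0" unfolding power_series_law[OF z] by (rule std_AE_nonzero)
  then have nz: "AE \<omega> in M. ?Y \<omega> \<noteq> 0" by (subst (asm) AE_distr_iff) auto
  have lnsd: "ln (std_dev z) = ln (K z / second_moment_std) / 2"
    unfolding std_dev_def using K_ge[OF z] second_moment_std_pos by (intro ln_sqrt) auto
  have ae: "AE \<omega> in M. ln (norm (X \<omega> z)) = ln (K z / second_moment_std) / 2 + ln (norm (?Y \<omega>))"
    using nz
  proof eventually_elim
    case (elim \<omega>)
    then show ?case using std_dev_pos[OF z] lnsd by (simp add: norm_divide ln_div)
  qed
  show "integrable M (\<lambda>\<omega>. ln (norm (X \<omega> z)))"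
    by (subst integrable_cong_AE[OF _ _ ae]) (use i in auto)
  have "(LINT \<omega>|M. ln (norm (X \<omega> z))) = (LINT \<omega>|M. ln (K z / second_moment_std) / 2 + ln (norm (?Y \<omega>)))"
    by (rule integral_cong_AE[OF _ _ ae]) auto
  also have "\<dots> = ln (K z / second_moment_std) / 2 + mean_ln_std" using i e prob_space by simp
  finally show "(LINT \<omega>|M. ln (norm (X \<omega> z))) = ln (K z / second_moment_std) / 2 + mean_ln_std" .
  have "(LINT \<omega>|M. \<bar>ln (norm (X \<omega> z))\<bar>) \<le> (LINT \<omega>|M. \<bar>ln (K z / second_moment_std)\<bar> / 2 + \<bar>ln (norm (?Y \<omega>))\<bar>)"
  proof (rule integral_mono_AE)
    show "AE \<omega> in M. \<bar>ln (norm (X \<omega> z))\<bar> \<le> \<bar>ln (K z / second_moment_std)\<bar> / 2 + \<bar>ln (norm (?Y \<omega>))\<bar>"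
      using ae
    proof eventually_elim
      case (elim \<omega>)
      have "\<bar>ln (norm (X \<omega> z))\<bar> \<le> \<bar>ln (K z / second_moment_std) / 2\<bar> + \<bar>ln (norm (?Y \<omega>))\<bar>"
        unfolding elim by (rule abs_triangle_ineq)
      then show ?case by (simp only: abs_divide abs_numeral)
    qed
    show "integrable M (\<lambda>\<omega>. \<bar>ln (norm (X \<omega> z))\<bar>)"
      by (rule integrable_abs) (subst integrable_cong_AE[OF _ _ ae], use i in auto)
    show "integrable M (\<lambda>\<omega>. \<bar>ln (K z / second_moment_std)\<bar> / 2 + \<bar>ln (norm (?Y \<omega>))\<bar>)" using i by auto
  qed
  also have "\<dots> = \<bar>ln (K z / second_moment_std)\<bar> / 2 + mean_abs_ln_std" using i ea prob_space by simp
  finally show "(LINT \<omega>|M. \<bar>ln (norm (X \<omega> z))\<bar>) \<le> \<bar>ln (K z / second_moment_std)\<bar> / 2 + mean_abs_ln_std" .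
qed

end

section \<open>Simplicity of the zeros\<close>

lemma double_zero_quadratic_bound:
  assumes f: "f holomorphic_on ball 0 1" and R: "R < 1" and z0: "z0 \<in> cball 0 R"
    and zero: "f z0 = 0" "deriv f z0 = 0"
  shows "\<exists>C. \<forall>z\<in>cball 0 R. norm (f z) \<le> C * (norm (z - z0))\<^sup>2"
proof -
  have sub: "cball (0::complex) R \<subseteq> ball 0 1" using R by auto
  have hol: "(deriv ^^ i) f holomorphic_on ball 0 1" for i
    using f by (intro holomorphic_higher_deriv) auto
  have "compact ((deriv ^^ 2) f ` cball 0 R)"
    using hol[of 2] sub by (intro compact_continuous_image) (auto intro: holomorphic_on_imp_continuous_on holomorphic_on_subset)
  then obtain B where B: "\<And>z. z \<in> cball 0 R \<Longrightarrow> norm ((deriv ^^ 2) f z) \<le> B"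
    using compact_imp_bounded bounded_iff by (metis image_eqI)
  have "norm (f z) \<le> B * (norm (z - z0))\<^sup>2" if z: "z \<in> cball 0 R" for z
  proof -
    have "norm ((deriv ^^ 0) f z - (\<Sum>i\<le>1. (deriv ^^ i) f z0 * (z - z0) ^ i / fact i)) \<le> B * norm (z - z0) ^ Suc 1 / fact 1"
    proof (rule complex_Taylor[of "cball 0 R"])
      fix i x assume x: "x \<in> cball (0::complex) R"
      have "((deriv ^^ i) f has_field_derivative deriv ((deriv ^^ i) f) x) (at x)"
        using x sub by (intro holomorphic_derivI[OF hol[of i]]) auto
      then show "((deriv ^^ i) f has_field_derivative (deriv ^^ Suc i) f x) (at x within cball 0 R)"
        by (simp add: has_field_derivative_at_within)
    next
      show "norm ((deriv ^^ Suc 1) f x) \<le> B" if "x \<in> cball 0 R" for x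
        using B[OF that] by (simp add: numeral_2_eq_2)
    qed (use z z0 in auto)
    then show ?thesis using zero by (simp add: power2_eq_square)
  qed
  then show ?thesis by blast
qed

context spectral_gaussian
begin

text \<open>If \<open>|X z| \<le> C |z - z0|^2\<close> for some \<open>z0\<close>, then at the adjacent point of a grid of mesh \<open>1/N\<close> the value
  of \<open>X\<close> is below \<open>3 C / N^2\<close>. By \<open>small_ball\<close> that has probability of order \<open>N^-4\<close> at each of order
  \<open>N^2\<close> grid points. The exceptional set is thus contained in measurable sets of arbitrarily small
  measure.\<close>

lemma AE_no_double_zero_at_scale:
  assumes R: "0 \<le> R" "R < R'" "R' < 1" and C: "C > 0"
  shows "AE \<omega> in M. \<not> (\<exists>z0\<in>cball 0 R. \<forall>z\<in>cball 0 R'. norm (X \<omega> z) \<le> C * (norm (z - z0))\<^sup>2)"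
proof -
  define grid where "grid N m n = Complex (real_of_int m / real N) (real_of_int n / real N)" for N :: nat and m n
  define I where "I N = {(m, n). m \<in> {- int N..int N} \<and> n \<in> {- int N..int N} \<and> grid N m n \<in> cball 0 R'}" for N :: nat
  define U where "U N = (\<Union>(m, n)\<in>I N. {\<omega> \<in> space M. norm (X \<omega> (grid N m n)) < 3 * C / (real N)\<^sup>2})" for N :: nat
  have fin: "finite (I N)" and card: "card (I N) \<le> (2 * N + 1)\<^sup>2" for N
  proof -
    have sub: "I N \<subseteq> {- int N..int N} \<times> {- int N..int N}" by (auto simp: I_def)
    then show "finite (I N)" by (rule finite_subset) auto
    have "card (I N) \<le> card ({- int N..int N} \<times> {- int N..int N})" by (rule card_mono[OF _ sub]) auto
    also have "\<dots> = (2 * N + 1)\<^sup>2" by (simp add: card_cartesian_product power2_eq_square nat_add_distrib nat_mult_distrib)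
    finally show "card (I N) \<le> (2 * N + 1)\<^sup>2" .
  qed
  have [measurable]: "U N \<in> sets M" for N
    unfolding U_def using fin[of N] by (intro sets.finite_UN) auto
  have bound: "emeasure M (U N) \<le> ennreal (324 * second_moment_std * C\<^sup>2 * (1 / (real N)\<^sup>2))" if N: "N \<ge> 1" for N
  proof -
    have "emeasure M (U N) \<le> (\<Sum>(m, n)\<in>I N. emeasure M {\<omega> \<in> space M. norm (X \<omega> (grid N m n)) < 3 * C / (real N)\<^sup>2})"
      unfolding U_def case_prod_beta by (rule emeasure_subadditive_finite[OF fin]) auto
    also have "\<dots> \<le> (\<Sum>(m, n)\<in>I N. ennreal (4 * second_moment_std * (3 * C / (real N)\<^sup>2)\<^sup>2))"
    proof (rule sum_mono, clarify)
      fix m n assume "(m, n) \<in> I N"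
      then have "norm (grid N m n) < 1" using R by (auto simp: I_def)
      then show "emeasure M {\<omega> \<in> space M. norm (X \<omega> (grid N m n)) < 3 * C / (real N)\<^sup>2} \<le> ennreal (4 * second_moment_std * (3 * C / (real N)\<^sup>2)\<^sup>2)"
        by (rule small_ball) (use C in auto)
    qed
    also have "\<dots> = ennreal (real (card (I N)) * (4 * second_moment_std * (3 * C / (real N)\<^sup>2)\<^sup>2))"
      using second_moment_std_pos by (simp add: ennreal_mult' ennreal_of_nat_eq_real_of_nat)
    also have "\<dots> \<le> ennreal (324 * second_moment_std * C\<^sup>2 * (1 / (real N)\<^sup>2))"
    proof (rule ennreal_leI)
      have "real (card (I N)) \<le> real ((2 * N + 1)\<^sup>2)" using card[of N] by (simp only: of_nat_le_iff)
      also have "real ((2 * N + 1)\<^sup>2) = (2 * real N + 1)\<^sup>2" by simp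
      also have "\<dots> \<le> (3 * real N)\<^sup>2" using N by (intro power_mono) auto
      finally have "real (card (I N)) * (4 * second_moment_std * (3 * C / (real N)\<^sup>2)\<^sup>2) \<le> (3 * real N)\<^sup>2 * (4 * second_moment_std * (3 * C / (real N)\<^sup>2)\<^sup>2)"
        using second_moment_std_pos by (intro mult_right_mono) auto
      also have "\<dots> = 324 * second_moment_std * C\<^sup>2 * (1 / (real N)\<^sup>2)"
        using N by (simp add: power_mult_distrib power_divide power2_eq_square)
      finally show "real (card (I N)) * (4 * second_moment_std * (3 * C / (real N)\<^sup>2)\<^sup>2) \<le> 324 * second_moment_std * C\<^sup>2 * (1 / (real N)\<^sup>2)" .
    qed
    finally show ?thesis .
  qed
  \<comment> \<open>From this mesh on, the grid point next to a point of the smaller disc lies in the larger disc.\<close>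
  obtain N0 :: nat where N0: "N0 \<ge> 1" "2 / real N0 < R' - R"
  proof -
    obtain n :: nat where n: "2 / (R' - R) < real n" using reals_Archimedean2 by blast
    moreover have "0 < 2 / (R' - R)" using R by simp
    ultimately have "0 < real n" by linarith
    with n show ?thesis using that[of n] R by (simp add: field_simps)
  qed
  let ?V = "\<Inter>N\<in>{N0..}. U N"
  have Vm: "?V \<in> sets M" by auto
  have "emeasure M ?V \<le> 0"
  proof (rule LIMSEQ_le_const)
    show "(\<lambda>N. ennreal (324 * second_moment_std * C\<^sup>2 * (1 / (real N)\<^sup>2))) \<longlonglongrightarrow> 0"
      by (rule tendsto_ennrealI[of _ 0, simplified]) real_asymp
    show "\<exists>N'. \<forall>N\<ge>N'. emeasure M ?V \<le> ennreal (324 * second_moment_std * C\<^sup>2 * (1 / (real N)\<^sup>2))"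
    proof (intro exI[of _ N0] allI impI)
      fix N assume N: "N0 \<le> N"
      have "emeasure M ?V \<le> emeasure M (U N)" by (rule emeasure_mono) (use N in auto)
      also have "\<dots> \<le> ennreal (324 * second_moment_std * C\<^sup>2 * (1 / (real N)\<^sup>2))" using N N0 by (intro bound) auto
      finally show "emeasure M ?V \<le> ennreal (324 * second_moment_std * C\<^sup>2 * (1 / (real N)\<^sup>2))" .
    qed
  qed
  then have "?V \<in> null_sets M" using Vm by (auto intro: null_setsI)
  then show ?thesis
  proof (rule AE_I')
    show "{\<omega> \<in> space M. \<not> \<not> (\<exists>z0\<in>cball 0 R. \<forall>z\<in>cball 0 R'. norm (X \<omega> z) \<le> C * (norm (z - z0))\<^sup>2)} \<subseteq> ?V"
    proof (intro subsetI INT_I)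
      fix \<omega> N
      assume "\<omega> \<in> {\<omega> \<in> space M. \<not> \<not> (\<exists>z0\<in>cball 0 R. \<forall>z\<in>cball 0 R'. norm (X \<omega> z) \<le> C * (norm (z - z0))\<^sup>2)}"
      then obtain z0 where w: "\<omega> \<in> space M" and z0: "z0 \<in> cball 0 R"
        and b: "\<forall>z\<in>cball 0 R'. norm (X \<omega> z) \<le> C * (norm (z - z0))\<^sup>2" by blast
      assume "N \<in> {N0..}"
      then have N: "N0 \<le> N" by simp
      have N1: "real N > 0" using N N0 by simp
      define m n where "m = \<lfloor>real N * Re z0\<rfloor>" and "n = \<lfloor>real N * Im z0\<rfloor>"
      define g where "g = grid N m n"
      have apx: "\<bar>real_of_int \<lfloor>real N * x\<rfloor> / real N - x\<bar> \<le> 1 / real N" for x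
      proof -
        have "real_of_int \<lfloor>real N * x\<rfloor> / real N - x = (real_of_int \<lfloor>real N * x\<rfloor> - real N * x) / real N"
          using N1 by (simp add: field_simps)
        moreover have "\<bar>real_of_int \<lfloor>real N * x\<rfloor> - real N * x\<bar> \<le> 1" by linarith
        ultimately show ?thesis using N1 by (simp add: divide_right_mono)
      qed
      have d: "(norm (g - z0))\<^sup>2 \<le> 2 / (real N)\<^sup>2"
      proof -
        have "(norm (g - z0))\<^sup>2 = \<bar>Re (g - z0)\<bar>\<^sup>2 + \<bar>Im (g - z0)\<bar>\<^sup>2" by (simp add: cmod_power2)
        also have "\<dots> \<le> (1 / real N)\<^sup>2 + (1 / real N)\<^sup>2"
          using apx[of "Re z0"] apx[of "Im z0"]
          by (intro add_mono power_mono) (auto simp: g_def grid_def m_def n_def)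
        finally show ?thesis by (simp add: power_divide)
      qed
      have "norm (g - z0) \<le> 2 / real N"
      proof (rule power2_le_imp_le)
        have "2 / (real N)\<^sup>2 \<le> (2 / real N)\<^sup>2" by (simp add: power_divide divide_right_mono)
        then show "(norm (g - z0))\<^sup>2 \<le> (2 / real N)\<^sup>2" using d by linarith
      qed simp
      also have "\<dots> \<le> 2 / real N0" using N N0 by (intro divide_left_mono) auto
      finally have "norm g \<le> R'" using N0(2) z0 norm_triangle_sub[of g z0] by simp
      then have g_in: "g \<in> cball 0 R'" by simp
      have rng: "m \<in> {- int N..int N}" "n \<in> {- int N..int N}"
      proof -
        have fl: "\<lfloor>real N * x\<rfloor> \<in> {- int N..int N}" if "\<bar>x\<bar> \<le> 1" for x
        proof -
          have "\<bar>real N * x\<bar> \<le> real N * 1" unfolding abs_mult using that by (intro mult_mono) auto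
          then show ?thesis by (auto simp: le_floor_iff floor_le_iff abs_le_iff)
        qed
        show "m \<in> {- int N..int N}" "n \<in> {- int N..int N}"
          unfolding m_def n_def using z0 R abs_Re_le_cmod[of z0] abs_Im_le_cmod[of z0] by (intro fl; simp)+
      qed
      have "norm (X \<omega> g) \<le> C * (norm (g - z0))\<^sup>2" using b g_in by blast
      also have "\<dots> \<le> C * (2 / (real N)\<^sup>2)" using d C by (intro mult_left_mono) auto
      also have "\<dots> < 3 * C / (real N)\<^sup>2" using C N1 by (simp add: divide_strict_right_mono)
      finally show "\<omega> \<in> U N"
        unfolding U_def by (intro UN_I[of "(m, n)"]) (use w g_in rng in \<open>auto simp: I_def g_def\<close>)
    qed
  qed
qed

lemma AE_simple_zeros:
  "AE \<omega> in M. converges \<omega> \<and> (\<forall>z\<in>ball 0 1. X \<omega> z = 0 \<longrightarrow> deriv (X \<omega>) z \<noteq> 0)"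
proof -
  define R where "R n = 1 - 1 / (real n + 2)" for n
  \<comment> \<open>The larger radius leaves room for grid points next to a zero in the smaller disc.\<close>
  define R' where "R' n = 1 - 1 / (real n + 3)" for n
  have R: "0 \<le> R n" "R n < R' n" "R' n < 1" for n by (auto simp: R_def R'_def field_simps)
  have "AE \<omega> in M. \<forall>n k. \<not> (\<exists>z0\<in>cball 0 (R n). \<forall>z\<in>cball 0 (R' n). norm (X \<omega> z) \<le> real (Suc k) * (norm (z - z0))\<^sup>2)"
    unfolding AE_all_countable using AE_no_double_zero_at_scale[OF R] by auto
  with AE_converges show ?thesis
  proof eventually_elim
    case (elim \<omega>)
    have "deriv (X \<omega>) z0 \<noteq> 0" if z0: "z0 \<in> ball 0 1" and X0: "X \<omega> z0 = 0" for z0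
    proof
      assume d0: "deriv (X \<omega>) z0 = 0"
      have "R \<longlonglongrightarrow> 1" unfolding R_def by real_asymp
      then have "eventually (\<lambda>n. norm z0 < R n) sequentially" using z0 by (intro order_tendstoD) auto
      then obtain n where n: "norm z0 < R n" by (auto simp: eventually_sequentially)
      then have "z0 \<in> cball 0 (R' n)" using R[of n] by auto
      then obtain C where C: "\<And>z. z \<in> cball 0 (R' n) \<Longrightarrow> norm (X \<omega> z) \<le> C * (norm (z - z0))\<^sup>2"
        using double_zero_quadratic_bound[OF X_holomorphic R(3) _ X0 d0] elim(1) by blast
      obtain k :: nat where k: "C \<le> real k" using real_arch_simple by blast
      have "norm (X \<omega> z) \<le> real (Suc k) * (norm (z - z0))\<^sup>2" if "z \<in> cball 0 (R' n)" for z
      proof -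
        have "C * (norm (z - z0))\<^sup>2 \<le> real (Suc k) * (norm (z - z0))\<^sup>2" using k by (intro mult_right_mono) auto
        with C[OF that] show ?thesis by linarith
      qed
      moreover have "z0 \<in> cball 0 (R n)" using n by auto
      ultimately show False using elim(2) by blast
    qed
    with elim(1) show ?case by blast
  qed
qed

lemma K_le: assumes "norm z < 1" shows "K z \<le> 1 / (1 - norm z)\<^sup>2"
proof -
  have "K z \<le> (LINT t|F. 1 / (1 - norm z)\<^sup>2)"
    unfolding K_def
  proof (rule integral_mono[OF integrable_K[OF assms]])
    fix t
    have "(1 - norm z)\<^sup>2 \<le> (norm (1 - z * cis (- t)))\<^sup>2"
      using norm_one_minus_ge[OF assms, of t] assms by (intro power_mono) auto
    then show "1 / (norm (1 - z * cis (- t)))\<^sup>2 \<le> 1 / (1 - norm z)\<^sup>2"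
      using assms by (intro frac_le) auto
  qed simp
  then show ?thesis using F.prob_space by simp
qed

text \<open>Random logarithmic mean over a circle; the factor \<open>1 / (2 pi)\<close> is left out.\<close>

definition J :: "complex \<Rightarrow> real \<Rightarrow> 'a \<Rightarrow> real" where
  "J a s \<omega> = (LINT t|arc. ln (norm (X \<omega> (a + of_real s * cis t))))"

lemma measurable_K [measurable]: "K \<in> borel_measurable borel"
proof -
  have c: "(\<lambda>p::complex \<times> real. norm (1 - fst p * cis (- snd p))) \<in> borel_measurable borel"
    by (intro borel_measurable_continuous_onI continuous_intros)
  have id: "(\<lambda>p. p) \<in> borel \<Otimes>\<^sub>M F \<rightarrow>\<^sub>M (borel :: (complex \<times> real) measure)"
    by (subst borel_prod[symmetric], rule measurable_Pair[OF measurable_fst measurable_compose[OF measurable_snd measurable_F[of "\<lambda>x. x"]], simplified])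
  have "(\<lambda>(z, t). 1 / (norm (1 - z * cis (- t)))\<^sup>2) \<in> borel_measurable (borel \<Otimes>\<^sub>M F)"
    using measurable_compose[OF id c] by (simp add: case_prod_beta')
  then show ?thesis unfolding K_def[abs_def] by (rule F.borel_measurable_lebesgue_integral)
qed

text \<open>Fubini's theorem applies because \<open>E |ln |X z||\<close> is bounded on the circle, \<open>K\<close> being bounded above and below
  on it.\<close>

lemma mean_log_expectation:
  assumes a: "norm a + s < 1" "s \<ge> 0"
  shows "integrable M (J a s)"
    and "integrable arc (\<lambda>t. ln (K (a + of_real s * cis t)))"
    and "(LINT \<omega>|M. J a s \<omega>) = (LINT t|arc. ln (K (a + of_real s * cis t))) / 2 + 2 * pi * (mean_ln_std - ln second_moment_std / 2)"
proof -
  define z where "z t = a + of_real s * cis t" for t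
  have z: "norm (z t) \<le> norm a + s" for t
    unfolding z_def using norm_triangle_ineq[of a "of_real s * cis t"] a by (simp add: norm_mult)
  have z1: "norm (z t) < 1" for t using z[of t] a by linarith
  have zm[measurable]: "z \<in> borel_measurable arc"
    unfolding z_def by (intro measurable_arc borel_measurable_continuous_onI continuous_intros)
  have Xm[measurable]: "(\<lambda>(t, \<omega>). X \<omega> (z t)) \<in> borel_measurable (arc \<Otimes>\<^sub>M M)"
    unfolding power_series_def by measurable
  have fm: "(\<lambda>(t, \<omega>). ln (norm (X \<omega> (z t)))) \<in> borel_measurable (arc \<Otimes>\<^sub>M M)" by measurable
  interpret P: pair_sigma_finite arc M
    using arc.sigma_finite_measure sigma_finite_measure by (simp add: pair_sigma_finite_def)
  define B where "B = \<bar>ln (1/4)\<bar> + \<bar>ln (1 / (1 - (norm a + s))\<^sup>2)\<bar>"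
  have KB: "\<bar>ln (K (z t))\<bar> \<le> B" for t
  proof -
    have l: "ln (1/4) \<le> ln (K (z t))" using K_ge[OF z1[of t]] by (subst ln_le_cancel_iff) auto
    have "1 / (1 - norm (z t))\<^sup>2 \<le> 1 / (1 - (norm a + s))\<^sup>2"
      using z[of t] a by (intro frac_le power_mono) auto
    then have "K (z t) \<le> 1 / (1 - (norm a + s))\<^sup>2" using K_le[OF z1[of t]] by linarith
    then have u: "ln (K (z t)) \<le> ln (1 / (1 - (norm a + s))\<^sup>2)" using K_ge[OF z1[of t]] by (subst ln_le_cancel_iff) auto
    show ?thesis using l u unfolding B_def by linarith
  qed
  have iK: "integrable arc (\<lambda>t. ln (K (z t)))"
    by (rule arc.integrable_const_bound[where B = B]) (use KB in auto)
  then show "integrable arc (\<lambda>t. ln (K (a + of_real s * cis t)))" by (simp add: z_def)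
  have lnq: "ln (K (z t) / second_moment_std) = ln (K (z t)) - ln second_moment_std" for t
    using K_ge[OF z1[of t]] second_moment_std_pos by (simp add: ln_div)
  have int: "integrable (arc \<Otimes>\<^sub>M M) (\<lambda>(t, \<omega>). ln (norm (X \<omega> (z t))))"
  proof (rule P.Fubini_integrable[OF fm])
    show "AE t in arc. integrable M (\<lambda>\<omega>. case (t, \<omega>) of (t, \<omega>) \<Rightarrow> ln (norm (X \<omega> (z t))))"
      using log_moment(1)[OF z1] by simp
    show "integrable arc (\<lambda>t. LINT \<omega>|M. norm (case (t, \<omega>) of (t, \<omega>) \<Rightarrow> ln (norm (X \<omega> (z t)))))"
    proof (rule arc.integrable_const_bound[where B = "(B + \<bar>ln second_moment_std\<bar>) / 2 + mean_abs_ln_std"])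
      show "(\<lambda>t. LINT \<omega>|M. norm (case (t, \<omega>) of (t, \<omega>) \<Rightarrow> ln (norm (X \<omega> (z t))))) \<in> borel_measurable arc"
        by (rule borel_measurable_lebesgue_integral) measurable
      have "norm (LINT \<omega>|M. norm (case (t, \<omega>) of (t, \<omega>) \<Rightarrow> ln (norm (X \<omega> (z t))))) \<le> (B + \<bar>ln second_moment_std\<bar>) / 2 + mean_abs_ln_std" for t
      proof -
        have "(LINT \<omega>|M. \<bar>ln (norm (X \<omega> (z t)))\<bar>) \<le> \<bar>ln (K (z t) / second_moment_std)\<bar> / 2 + mean_abs_ln_std"
          by (rule log_moment(3)[OF z1])
        also have "\<bar>ln (K (z t) / second_moment_std)\<bar> \<le> B + \<bar>ln second_moment_std\<bar>" unfolding lnq using KB[of t] by linarith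
        finally show ?thesis by (simp add: divide_right_mono)
      qed
      then show "AE t in arc. norm (LINT \<omega>|M. norm (case (t, \<omega>) of (t, \<omega>) \<Rightarrow> ln (norm (X \<omega> (z t))))) \<le> (B + \<bar>ln second_moment_std\<bar>) / 2 + mean_abs_ln_std"
        by simp
    qed
  qed
  have Jz: "J a s \<omega> = (LINT t|arc. ln (norm (X \<omega> (z t))))" for \<omega> by (simp add: J_def z_def)
  show "integrable M (J a s)"
    using P.integrable_snd[OF int] by (simp add: Jz[abs_def])
  have "(LINT \<omega>|M. J a s \<omega>) = (LINT t|arc. LINT \<omega>|M. ln (norm (X \<omega> (z t))))"
    unfolding Jz using P.Fubini_integral[OF int] by simp
  also have "\<dots> = (LINT t|arc. ln (K (z t)) / 2 + (mean_ln_std - ln second_moment_std / 2))"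
    by (intro Bochner_Integration.integral_cong refl) (simp add: log_moment(2)[OF z1] lnq diff_divide_distrib)
  also have "\<dots> = (LINT t|arc. ln (K (z t))) / 2 + 2 * pi * (mean_ln_std - ln second_moment_std / 2)"
    using iK by simp
  finally show "(LINT \<omega>|M. J a s \<omega>) = (LINT t|arc. ln (K (a + of_real s * cis t))) / 2 + 2 * pi * (mean_ln_std - ln second_moment_std / 2)"
    by (simp add: z_def)
qed

text \<open>Twice the expectation of \<open>J\<close>, up to a constant that does not depend on the circle.\<close>

definition G :: "complex \<Rightarrow> real \<Rightarrow> real" where "G a s = (LINT t|arc. ln (K (a + of_real s * cis t)))"

text \<open>The expectation of the two Jensen inequalities. On the side of the zero process only monotonicity of
  the integral is used, which holds for nonmeasurable functions too.\<close>

lemma expected_zeros_bounds: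
  assumes s: "0 < s1" "s1 < s2" "norm a + s2 < 1"
  shows "(\<integral>\<^sup>+\<omega>. zero_process \<xi> \<omega> (ball a s1) \<partial>M) \<le> ennreal ((G a s2 - G a s1) / (4 * pi * ln (s2 / s1)))"
    and "ennreal ((G a s2 - G a s1) / (4 * pi * ln (s2 / s1))) \<le> (\<integral>\<^sup>+\<omega>. zero_process \<xi> \<omega> (ball a s2) \<partial>M)"
    and "0 \<le> (G a s2 - G a s1) / (4 * pi * ln (s2 / s1))"
proof -
  define L where "L = 2 * pi * ln (s2 / s1)"
  have L: "L > 0" using s by (simp add: L_def)
  define D where "D \<omega> = (J a s2 \<omega> - J a s1 \<omega>) / L" for \<omega>
  have m1: "integrable M (J a s1)" and m2: "integrable M (J a s2)" using s by (auto intro!: mean_log_expectation(1))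
  have Dint: "integrable M D" unfolding D_def using m1 m2 by auto
  have "(LINT \<omega>|M. D \<omega>) = ((LINT \<omega>|M. J a s2 \<omega>) - (LINT \<omega>|M. J a s1 \<omega>)) / L"
    unfolding D_def using m1 m2 by simp
  also have "\<dots> = (G a s2 / 2 - G a s1 / 2) / L"
    using s by (simp add: mean_log_expectation(3) G_def)
  also have "\<dots> = (G a s2 - G a s1) / (4 * pi * ln (s2 / s1))" by (simp add: L_def diff_divide_distrib)
  finally have ED: "(LINT \<omega>|M. D \<omega>) = (G a s2 - G a s1) / (4 * pi * ln (s2 / s1))" .
  have ae: "AE \<omega> in M. zero_process \<xi> \<omega> (ball a s1) \<le> ennreal (D \<omega>) \<and> ennreal (D \<omega>) \<le> zero_process \<xi> \<omega> (ball a s2) \<and> 0 \<le> D \<omega>"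
    using AE_simple_zeros
  proof eventually_elim
    case (elim \<omega>)
    have sub: "ball a (1 - norm a) \<subseteq> ball 0 1"
    proof
      fix x assume "x \<in> ball a (1 - norm a)"
      then show "x \<in> ball 0 1" using norm_triangle_sub[of x a] by (simp add: dist_norm norm_minus_commute)
    qed
    have hol: "X \<omega> holomorphic_on ball a (1 - norm a)"
      using X_holomorphic elim sub by (blast intro: holomorphic_on_subset)
    have simple: "deriv (X \<omega>) z \<noteq> 0" if "z \<in> ball a (1 - norm a)" "X \<omega> z = 0" for z
      using elim that sub by blast
    have s': "0 < s1" "s1 < s2" "s2 < 1 - norm a" using s by auto
    note jen = jensen_simple_zeros[OF hol simple s', folded J_def]
    have zp: "zero_process \<xi> \<omega> (ball a s) = ennreal (real (card {z \<in> ball a s. X \<omega> z = 0}))" if "s \<le> s2" for s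
    proof -
      have eq: "{z \<in> ball a s. norm z < 1 \<and> X \<omega> z = 0} = {z \<in> ball a s. X \<omega> z = 0}"
      proof -
        have "norm z < 1" if "z \<in> ball a s" for z
          using subsetD[OF sub, of z] that \<open>s \<le> s2\<close> s' by auto
        then show ?thesis by auto
      qed
      have "finite {z \<in> ball a s. X \<omega> z = 0}"
        by (rule finite_subset[OF _ jen(1)]) (use that in auto)
      then show ?thesis unfolding zero_process_def eq
        by (subst emeasure_count_space) (auto simp: ennreal_of_nat_eq_real_of_nat)
    qed
    have b1: "real (card {z \<in> ball a s1. X \<omega> z = 0}) \<le> D \<omega>"
      using jen(2) L unfolding D_def L_def[symmetric] by (simp add: pos_le_divide_eq)
    have b2: "D \<omega> \<le> real (card {z \<in> ball a s2. X \<omega> z = 0})"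
      using jen(3) L unfolding D_def L_def[symmetric] by (simp add: pos_divide_le_eq)
    show ?case using b1 b2 s' by (auto simp: zp intro!: ennreal_leI)
  qed
  show "0 \<le> (G a s2 - G a s1) / (4 * pi * ln (s2 / s1))"
  proof -
    have "AE \<omega> in M. 0 \<le> D \<omega>" using ae by eventually_elim simp
    then have "0 \<le> (LINT \<omega>|M. D \<omega>)" by (rule integral_nonneg_AE)
    then show ?thesis by (simp only: ED)
  qed
  have nn: "(\<integral>\<^sup>+\<omega>. ennreal (D \<omega>) \<partial>M) = ennreal (LINT \<omega>|M. D \<omega>)"
    by (rule nn_integral_eq_integral[OF Dint]) (use ae in auto)
  show "(\<integral>\<^sup>+\<omega>. zero_process \<xi> \<omega> (ball a s1) \<partial>M) \<le> ennreal ((G a s2 - G a s1) / (4 * pi * ln (s2 / s1)))"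
    unfolding ED[symmetric] nn[symmetric] by (rule nn_integral_mono_AE) (use ae in auto)
  show "ennreal ((G a s2 - G a s1) / (4 * pi * ln (s2 / s1))) \<le> (\<integral>\<^sup>+\<omega>. zero_process \<xi> \<omega> (ball a s2) \<partial>M)"
    unfolding ED[symmetric] nn[symmetric] by (rule nn_integral_mono_AE) (use ae in auto)
qed

end

section \<open>Second-order expansion of circle means of the log kernel\<close>

lemma ln_one_plus_expansion:
  fixes y :: real
  assumes "\<bar>y\<bar> \<le> 1 / 2"
  shows "\<bar>ln (1 + y) - (y - y\<^sup>2 / 2)\<bar> \<le> 2 * \<bar>y\<bar> ^ 3"
proof -
  define f where "f x = ln (1 + x) - (x - x\<^sup>2 / 2)" for x :: real
  have "norm (f y - f 0) \<le> (2 * y\<^sup>2) * norm (y - 0)"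
  proof (rule field_differentiable_bound[where S = "cball 0 \<bar>y\<bar>" and f' = "\<lambda>x. x\<^sup>2 / (1 + x)"])
    fix x :: real assume x: "x \<in> cball 0 \<bar>y\<bar>"
    then have x': "\<bar>x\<bar> \<le> \<bar>y\<bar>" by simp
    then have x1: "1 / 2 \<le> 1 + x" using assms by linarith
    have "(f has_field_derivative (1 / (1 + x) - (1 - x))) (at x)"
      unfolding f_def using x1 by (auto intro!: derivative_eq_intros)
    also have "1 / (1 + x) - (1 - x) = x\<^sup>2 / (1 + x)" using x1 by (simp add: field_simps power2_eq_square)
    finally show "(f has_field_derivative x\<^sup>2 / (1 + x)) (at x within cball 0 \<bar>y\<bar>)"
      by (rule has_field_derivative_at_within)
    have "x\<^sup>2 \<le> y\<^sup>2" using x' by (simp add: abs_le_square_iff)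
    then have "x\<^sup>2 / (1 + x) \<le> y\<^sup>2 / (1 / 2)" using x1 by (intro frac_le) auto
    then show "norm (x\<^sup>2 / (1 + x)) \<le> 2 * y\<^sup>2" using x1 by simp
  qed auto
  then show ?thesis by (simp add: f_def power3_eq_cube power2_eq_square abs_mult mult.assoc)
qed

text \<open>From \<open>1 / (1 - x) = 1 + x + x^2 + x^3 / (1 - x)\<close>; on the domain the last quotient has modulus at most
  \<open>2\<close>.\<close>

lemma inverse_norm_square_expansion:
  assumes x: "norm (x::complex) \<le> 1 / 2"
  shows "\<bar>1 / (norm (1 - x))\<^sup>2 - (1 + 2 * Re x + (norm x)\<^sup>2 + 2 * Re (x\<^sup>2))\<bar> \<le> 16 * norm x ^ 3"
proof -
  define n where "n = norm x"
  have n: "0 \<le> n" "n \<le> 1 / 2" using x by (auto simp: n_def)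
  have x1: "1 - x \<noteq> 0" using x by auto
  define u where "u = 1 / (1 - x)"
  define A where "A = 1 + x + x\<^sup>2"
  have u: "u = A + x ^ 3 * u"
    using x1 by (simp add: u_def A_def field_simps power2_eq_square power3_eq_cube)
  have "1 / 2 \<le> norm (1 - x)" using norm_triangle_ineq2[of 1 x] x by simp
  then have nu: "norm u \<le> 2" by (simp add: u_def norm_divide divide_le_eq)
  have nA: "norm A \<le> 2"
  proof -
    have "norm A \<le> norm (1 :: complex) + norm x + norm (x\<^sup>2)"
      unfolding A_def by (intro norm_triangle_le add_mono order_refl norm_triangle_ineq)
    also have "norm (x\<^sup>2) \<le> (1/2)\<^sup>2" unfolding norm_power using x by (intro power_mono) auto
    finally show ?thesis using x by (simp add: power2_eq_square)
  qed
  have sq: "(norm (a + b))\<^sup>2 = (norm a)\<^sup>2 + 2 * Re (a * cnj b) + (norm b)\<^sup>2" for a b :: complex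
    unfolding cmod_power2 by (simp add: power2_eq_square algebra_simps)
  have "(norm u)\<^sup>2 = (norm A)\<^sup>2 + 2 * Re (A * cnj (x ^ 3 * u)) + (norm (x ^ 3 * u))\<^sup>2"
    by (subst u) (rule sq)
  moreover have "(norm A)\<^sup>2 = 1 + 2 * Re x + (norm x)\<^sup>2 + 2 * Re (x\<^sup>2) + 2 * Re (x * cnj (x\<^sup>2)) + (norm (x\<^sup>2))\<^sup>2"
  proof -
    have "(norm A)\<^sup>2 = (norm (1 + x))\<^sup>2 + 2 * Re ((1 + x) * cnj (x\<^sup>2)) + (norm (x\<^sup>2))\<^sup>2"
      unfolding A_def by (rule sq)
    also have "(norm (1 + x))\<^sup>2 = 1 + 2 * Re x + (norm x)\<^sup>2"
      using sq[of 1 x] by simp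
    also have "Re ((1 + x) * cnj (x\<^sup>2)) = Re (x\<^sup>2) + Re (x * cnj (x\<^sup>2))"
      by (simp add: distrib_right del: complex_cnj_power)
    finally show ?thesis by simp
  qed
  moreover have "1 / (norm (1 - x))\<^sup>2 = (norm u)\<^sup>2" by (simp add: u_def norm_divide power_divide)
  ultimately have eq: "1 / (norm (1 - x))\<^sup>2 - (1 + 2 * Re x + (norm x)\<^sup>2 + 2 * Re (x\<^sup>2))
     = 2 * Re (x * cnj (x\<^sup>2)) + (norm (x\<^sup>2))\<^sup>2 + 2 * Re (A * cnj (x ^ 3 * u)) + (norm (x ^ 3 * u))\<^sup>2" by simp
  have b1: "\<bar>Re (x * cnj (x\<^sup>2))\<bar> \<le> n ^ 3"
    using abs_Re_le_cmod[of "x * cnj (x\<^sup>2)"] by (simp add: norm_mult norm_power n_def power3_eq_cube power2_eq_square)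
  have b2: "(norm (x\<^sup>2))\<^sup>2 \<le> n ^ 3"
  proof -
    have "(norm (x\<^sup>2))\<^sup>2 = n ^ 3 * n" by (simp add: norm_power norm_mult n_def power3_eq_cube power2_eq_square)
    also have "\<dots> \<le> n ^ 3 * 1" using n by (intro mult_left_mono) auto
    finally show ?thesis by simp
  qed
  have b3: "\<bar>Re (A * cnj (x ^ 3 * u))\<bar> \<le> 4 * n ^ 3"
  proof -
    have "\<bar>Re (A * cnj (x ^ 3 * u))\<bar> \<le> norm A * (n ^ 3 * norm u)"
      using abs_Re_le_cmod[of "A * cnj (x ^ 3 * u)"] by (simp add: norm_mult norm_power n_def)
    also have "\<dots> \<le> 2 * (n ^ 3 * 2)" using nA nu n by (intro mult_mono) auto
    finally show ?thesis by simp
  qed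
  have b4: "(norm (x ^ 3 * u))\<^sup>2 \<le> 4 * n ^ 3"
  proof -
    have "(norm (x ^ 3 * u))\<^sup>2 = n ^ 3 * n ^ 3 * (norm u)\<^sup>2" by (simp add: norm_mult norm_power n_def power2_eq_square)
    also have "\<dots> \<le> (n ^ 3 * 1) * 2\<^sup>2"
      using n nu by (intro mult_mono power_mono mult_left_mono power_le_one) auto
    finally show ?thesis by simp
  qed
  have "\<bar>1 / (norm (1 - x))\<^sup>2 - (1 + 2 * Re x + (norm x)\<^sup>2 + 2 * Re (x\<^sup>2))\<bar> \<le> 2 * n ^ 3 + n ^ 3 + 8 * n ^ 3 + 4 * n ^ 3"
    unfolding eq using b1 b2 b3 b4 by (simp only: abs_le_iff) (smt (verit) zero_le_power2)
  also have "\<dots> \<le> 16 * n ^ 3" using n by simp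
  finally show ?thesis by (simp add: n_def)
qed

lemma integral_arc_cis: "(LINT t|arc. cis t) = 0" "(LINT t|arc. (cis t)\<^sup>2) = 0"
  using holomorphic_mean_value[of "\<lambda>z. z" 0 2 1] holomorphic_mean_value[of "\<lambda>z. z\<^sup>2" 0 2 1]
  by (simp_all add: holomorphic_on_id[unfolded id_def] holomorphic_on_power)

lemma integral_arc_trig: "(LINT t|arc. Re (\<alpha> * cis t)) = 0" "(LINT t|arc. Re (\<beta> * (cis t)\<^sup>2)) = 0"
  "integrable arc (\<lambda>t. Re (\<alpha> * cis t))" "integrable arc (\<lambda>t. Re (\<beta> * (cis t)\<^sup>2))"
proof -
  have i: "integrable arc (\<lambda>t. \<alpha> * cis t)" "integrable arc (\<lambda>t. \<beta> * (cis t)\<^sup>2)"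
    by (auto intro!: integrable_arc_continuous continuous_intros)
  show "integrable arc (\<lambda>t. Re (\<alpha> * cis t))" "integrable arc (\<lambda>t. Re (\<beta> * (cis t)\<^sup>2))"
    by (rule integrable_Re[OF i(1)]) (rule integrable_Re[OF i(2)])
  show "(LINT t|arc. Re (\<alpha> * cis t)) = 0" "(LINT t|arc. Re (\<beta> * (cis t)\<^sup>2)) = 0"
    using i by (simp_all only: integral_Re integral_mult_right_zero integral_arc_cis mult_zero_right zero_complex.sel)
qed

context spectral_gaussian
begin

text \<open>The mixed moment \<open>E (X' z cnj (X z))\<close>, the holomorphic derivative of the kernel.\<close>

definition K1 :: "complex \<Rightarrow> complex" where
  "K1 z = (LINT t|F. of_real (1 / (norm (1 - z * cis (- t)))\<^sup>2) * (cis (- t) / (1 - z * cis (- t))))"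

text \<open>The moment \<open>E |X' z|^2\<close>.\<close>

definition K11 :: "complex \<Rightarrow> real" where
  "K11 z = (LINT t|F. 1 / (norm (1 - z * cis (- t))) ^ 4)"

text \<open>The mixed derivative of \<open>ln K\<close> in \<open>z\<close> and its conjugate.\<close>

definition intensity :: "complex \<Rightarrow> real" where
  "intensity z = (K11 z * K z - (norm (K1 z))\<^sup>2) / (K z)\<^sup>2"

text \<open>Factor \<open>1 - (a + h) e^(-it) = e t * (1 - h p t)\<close> and expand the second factor to second order
  under the integral, then expand the logarithm. The terms that are real parts of a multiple of \<open>h\<close> or
  \<open>h^2\<close> average out over circles, so only the coefficient of \<open>|h|^2\<close> is identified.\<close>

lemma log_K_expansion:
  assumes a: "norm a < 1"
  shows "\<exists>\<alpha> \<beta> C \<delta>. \<delta> > 0 \<and> (\<forall>h. norm h \<le> \<delta> \<longrightarrow>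
     \<bar>ln (K (a + h)) - (ln (K a) + Re (\<alpha> * h) + Re (\<beta> * h\<^sup>2) + intensity a * (norm h)\<^sup>2)\<bar> \<le> C * norm h ^ 3)"
proof -
  define P where "P = 1 / (1 - norm a)"
  have P: "P > 0" "1 \<le> P" using a by (auto simp: P_def field_simps)
  define e where "e t = 1 - a * cis (- t)" for t
  have e: "1 - norm a \<le> norm (e t)" for t unfolding e_def by (rule norm_one_minus_ge[OF a])
  then have e0: "e t \<noteq> 0" for t using a by (metis diff_gt_0_iff_gt linorder_not_less norm_zero)
  define p where "p t = cis (- t) / e t" for t
  define W where "W t = 1 / (norm (e t))\<^sup>2" for t
  have pP: "norm (p t) \<le> P" for t
    using e[of t] a by (simp add: p_def P_def norm_divide frac_le)
  have W0: "0 \<le> W t" for t by (simp add: W_def)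
  have em: "e \<in> borel_measurable borel"
    unfolding e_def by (intro borel_measurable_continuous_onI continuous_intros)
  have pm[measurable]: "p \<in> borel_measurable borel"
    unfolding p_def by (intro borel_measurable_divide em borel_measurable_continuous_onI continuous_intros)
  have Wm[measurable]: "W \<in> borel_measurable borel"
    unfolding W_def using em by measurable
  have iW: "integrable F W" using integrable_K[OF a] by (simp add: W_def[abs_def] e_def)
  have KW: "K a = (LINT t|F. W t)" by (simp add: K_def W_def e_def)
  have WP: "norm (W t) \<le> P\<^sup>2" for t
  proof -
    have "(1 - norm a)\<^sup>2 \<le> (norm (e t))\<^sup>2" using e[of t] a by (intro power_mono) auto
    then show ?thesis using a by (simp add: W_def P_def power_divide frac_le)
  qed
  have bW: "norm (W t * x) \<le> P\<^sup>2 * B" if "norm x \<le> B" for t and x B :: real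
    using WP[of t] that unfolding norm_mult by (intro mult_mono) auto
  have bWc: "norm (of_real (W t) * x) \<le> P\<^sup>2 * B" if "norm x \<le> B" for t B and x :: complex
    using WP[of t] that unfolding norm_mult by (intro mult_mono) auto
  have i1: "integrable F (\<lambda>t. of_real (W t) * p t)"
    by (rule integrable_bounded_F[where B = "P\<^sup>2 * P"]) (auto intro!: bWc pP)
  have i2: "integrable F (\<lambda>t. of_real (W t) * (p t)\<^sup>2)"
  proof (rule integrable_bounded_F[where B = "P\<^sup>2 * P\<^sup>2"])
    have "norm ((p t)\<^sup>2) \<le> P\<^sup>2" for t unfolding norm_power by (intro power_mono pP) simp
    then show "norm (of_real (W t) * (p t)\<^sup>2) \<le> P\<^sup>2 * P\<^sup>2" for t by (rule bWc)
  qed measurable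
  have i11: "integrable F (\<lambda>t. W t * (norm (p t))\<^sup>2)"
  proof (rule integrable_bounded_F[where B = "P\<^sup>2 * P\<^sup>2"])
    have "norm ((norm (p t))\<^sup>2) \<le> P\<^sup>2" for t using pP[of t] by (simp add: power_mono)
    then show "norm (W t * (norm (p t))\<^sup>2) \<le> P\<^sup>2 * P\<^sup>2" for t by (rule bW)
  qed measurable
  define k1 where "k1 = (LINT t|F. of_real (W t) * p t)"
  define k2 where "k2 = (LINT t|F. of_real (W t) * (p t)\<^sup>2)"
  define k11 where "k11 = (LINT t|F. W t * (norm (p t))\<^sup>2)"
  have k1: "k1 = K1 a" by (simp add: k1_def K1_def W_def p_def e_def)
  have "W t * (norm (p t))\<^sup>2 = 1 / (norm (e t)) ^ 4" for t
    by (simp add: W_def p_def norm_divide power_divide power_add[symmetric])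
  then have k11: "k11 = K11 a" by (simp add: k11_def K11_def e_def)
  have Kpos: "K a > 0" using K_ge[OF a] by simp
  define Q where "Q h = 2 * Re (h * k1) + (norm h)\<^sup>2 * k11 + 2 * Re (h\<^sup>2 * k2)" for h
  have Kexp: "\<bar>K (a + h) - (K a + Q h)\<bar> \<le> 16 * P ^ 3 * norm h ^ 3 * K a" if h: "norm h \<le> 1 / (2 * P)" for h
  proof -
    have hp: "norm (h * p t) \<le> 1 / 2" for t
    proof -
      have "norm (h * p t) \<le> (1 / (2 * P)) * P" unfolding norm_mult using h pP[of t] P by (intro mult_mono) auto
      then show ?thesis using P by simp
    qed
    have ah: "norm (a + h) < 1"
    proof -
      have "1 / (2 * P) < 1 / P" using P by (simp add: field_simps)
      then have "norm h < 1 - norm a" using h by (simp add: P_def)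
      then show ?thesis using norm_triangle_ineq[of a h] by linarith
    qed
    define E where "E t = W t * (1 / (norm (1 - h * p t))\<^sup>2 - (1 + 2 * Re (h * p t) + (norm (h * p t))\<^sup>2 + 2 * Re ((h * p t)\<^sup>2)))" for t
    have split: "1 / (norm (1 - (a + h) * cis (- t)))\<^sup>2 = W t / (norm (1 - h * p t))\<^sup>2" for t
    proof -
      have "1 - (a + h) * cis (- t) = e t * (1 - h * p t)"
        using e0[of t] by (simp add: p_def e_def[of t, symmetric] right_diff_distrib) (simp add: e_def algebra_simps)
      then show ?thesis by (simp add: W_def norm_mult power_mult_distrib)
    qed
    have KE: "K (a + h) = (LINT t|F. W t / (norm (1 - h * p t))\<^sup>2)" unfolding K_def split ..
    have iKE: "integrable F (\<lambda>t. W t / (norm (1 - h * p t))\<^sup>2)"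
      using integrable_K[OF ah] unfolding split .
    have q1: "integrable F (\<lambda>t. 2 * Re (h * (of_real (W t) * p t)))" and q2: "integrable F (\<lambda>t. 2 * Re (h\<^sup>2 * (of_real (W t) * (p t)\<^sup>2)))"
      and q3: "integrable F (\<lambda>t. (norm h)\<^sup>2 * (W t * (norm (p t))\<^sup>2))"
      by (intro integrable_mult_right integrable_Re i1 i2 i11)+
    have Eeq: "E t = W t / (norm (1 - h * p t))\<^sup>2 - (W t + 2 * Re (h * (of_real (W t) * p t))
        + (norm h)\<^sup>2 * (W t * (norm (p t))\<^sup>2) + 2 * Re (h\<^sup>2 * (of_real (W t) * (p t)\<^sup>2)))" for t
    proof -
      have r1: "Re (h * (of_real (W t) * p t)) = W t * Re (h * p t)" for t by (simp add: algebra_simps)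
      have r2: "Re (h\<^sup>2 * (of_real (W t) * (p t)\<^sup>2)) = W t * Re ((h * p t)\<^sup>2)" for t
      proof -
        have "h\<^sup>2 * (of_real (W t) * (p t)\<^sup>2) = of_real (W t) * (h * p t)\<^sup>2" by (simp add: power_mult_distrib)
        moreover have "Re (of_real c * w) = c * Re w" for c w by simp
        ultimately show ?thesis by (simp only:)
      qed
      show ?thesis unfolding E_def r1 r2 by (simp add: norm_mult power_mult_distrib right_diff_distrib distrib_left mult_ac)
    qed
    have iE: "integrable F E" unfolding Eeq[abs_def] using iKE iW q1 q2 q3
      by (intro Bochner_Integration.integrable_diff Bochner_Integration.integrable_add)
    have "(LINT t|F. E t) = K (a + h) - (K a + 2 * Re (h * k1) + (norm h)\<^sup>2 * k11 + 2 * Re (h\<^sup>2 * k2))"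
    proof -
      have j1: "integrable F (\<lambda>t. h * (of_real (W t) * p t))" and j2: "integrable F (\<lambda>t. h\<^sup>2 * (of_real (W t) * (p t)\<^sup>2))"
        by (intro integrable_mult_right i1 i2)+
      have s1: "(LINT t|F. 2 * Re (h * (of_real (W t) * p t))) = 2 * Re (h * k1)"
        unfolding k1_def by (simp only: integral_mult_right_zero integral_Re[OF j1])
      have s2: "(LINT t|F. 2 * Re (h\<^sup>2 * (of_real (W t) * (p t)\<^sup>2))) = 2 * Re (h\<^sup>2 * k2)"
        unfolding k2_def by (simp only: integral_mult_right_zero integral_Re[OF j2])
      have s3: "(LINT t|F. (norm h)\<^sup>2 * (W t * (norm (p t))\<^sup>2)) = (norm h)\<^sup>2 * k11"
        by (simp add: k11_def)
      show ?thesis unfolding Eeq KE KW s1[symmetric] s2[symmetric] s3[symmetric]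
        using iKE iW q1 q2 q3
        by (simp only: Bochner_Integration.integral_diff Bochner_Integration.integral_add
            Bochner_Integration.integrable_diff Bochner_Integration.integrable_add)
    qed
    then have "K (a + h) - (K a + Q h) = (LINT t|F. E t)" by (simp add: Q_def)
    then have "\<bar>K (a + h) - (K a + Q h)\<bar> \<le> (LINT t|F. \<bar>E t\<bar>)" by simp
    also have "\<dots> \<le> (LINT t|F. 16 * P ^ 3 * norm h ^ 3 * W t)"
    proof (rule integral_mono)
      show "integrable F (\<lambda>t. \<bar>E t\<bar>)" using iE by auto
      show "integrable F (\<lambda>t. 16 * P ^ 3 * norm h ^ 3 * W t)" using iW by auto
      fix t
      have "\<bar>E t\<bar> \<le> W t * (16 * norm (h * p t) ^ 3)"
        unfolding E_def abs_mult using W0[of t] inverse_norm_square_expansion[OF hp[of t]]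
        by (simp add: mult_left_mono)
      also have "\<dots> \<le> W t * (16 * (norm h * P) ^ 3)"
        using W0[of t] pP[of t] by (intro mult_left_mono power_mono) (auto simp: norm_mult mult_left_mono)
      finally show "\<bar>E t\<bar> \<le> 16 * P ^ 3 * norm h ^ 3 * W t" by (simp add: power_mult_distrib mult_ac)
    qed
    also have "\<dots> = 16 * P ^ 3 * norm h ^ 3 * K a" by (simp add: KW)
    finally show ?thesis .
  qed
  \<comment> \<open>A bound for \<open>|y| / |h|\<close>; the cubic remainder of the kernel is absorbed because \<open>|h| \<le> 1\<close>.\<close>
  define B where "B = (2 * norm k1 + \<bar>k11\<bar> + 2 * norm k2) / K a + 16 * P ^ 3"
  have B: "B \<ge> 16" using P Kpos unfolding B_def
    by (intro add_increasing) (auto intro!: divide_nonneg_nonneg add_nonneg_nonneg)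
  define \<delta> where "\<delta> = min (1 / (2 * P)) (1 / (2 * B))"
  have \<delta>: "\<delta> > 0" "\<delta> \<le> 1 / (2 * P)" "\<delta> \<le> 1 / (2 * B)" using P B by (auto simp: \<delta>_def)
  have "1 / (2 * B) \<le> 1" using B by simp
  then have \<delta>1: "\<delta> \<le> 1" using \<delta>(3) by linarith
  define \<alpha> where "\<alpha> = 2 * k1 / of_real (K a)"
  define \<beta> where "\<beta> = 2 * k2 / of_real (K a) - k1\<^sup>2 / of_real ((K a)\<^sup>2)"
  define D where "D = 16 * P ^ 3 + 2 * B ^ 3 + 2 * B\<^sup>2"
  have main: "\<bar>ln (K (a + h)) - (ln (K a) + Re (\<alpha> * h) + Re (\<beta> * h\<^sup>2) + intensity a * (norm h)\<^sup>2)\<bar> \<le> D * norm h ^ 3"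
    if h: "norm h \<le> \<delta>" for h
  proof -
    define n where "n = norm h"
    have n: "0 \<le> n" "n \<le> 1" "n \<le> 1 / (2 * P)" "n \<le> 1 / (2 * B)" using h \<delta> \<delta>1 by (auto simp: n_def)
    define y where "y = (K (a + h) - K a) / K a"
    define y1 where "y1 = 2 * Re (h * k1) / K a"
    define y2 where "y2 = ((norm h)\<^sup>2 * k11 + 2 * Re (h\<^sup>2 * k2)) / K a"
    have yy: "\<bar>y - (y1 + y2)\<bar> \<le> 16 * P ^ 3 * n ^ 3"
    proof -
      have "y - (y1 + y2) = (K (a + h) - (K a + Q h)) / K a"
        by (simp add: y_def y1_def y2_def Q_def diff_divide_distrib add_divide_distrib)
      also have "\<bar>\<dots>\<bar> \<le> 16 * P ^ 3 * n ^ 3 * K a / K a"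
        unfolding abs_divide using Kexp[of h] n Kpos by (simp add: n_def divide_le_eq)
      finally show ?thesis using Kpos by simp
    qed
    have y1b: "\<bar>y1\<bar> \<le> 2 * norm k1 / K a * n"
      using abs_Re_le_cmod[of "h * k1"] Kpos by (simp add: y1_def abs_divide abs_mult norm_mult n_def divide_right_mono mult.commute)
    have y2b: "\<bar>y2\<bar> \<le> (\<bar>k11\<bar> + 2 * norm k2) / K a * n\<^sup>2"
    proof -
      have "\<bar>(norm h)\<^sup>2 * k11 + 2 * Re (h\<^sup>2 * k2)\<bar> \<le> n\<^sup>2 * \<bar>k11\<bar> + 2 * (n\<^sup>2 * norm k2)"
        using abs_Re_le_cmod[of "h\<^sup>2 * k2"]
        by (intro order_trans[OF abs_triangle_ineq] add_mono) (auto simp: abs_mult norm_mult norm_power n_def)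
      then show ?thesis using Kpos by (simp add: y2_def abs_divide divide_right_mono algebra_simps)
    qed
    have n2: "n\<^sup>2 \<le> n" using n by (simp add: power2_eq_square mult_left_le)
    have n3: "n ^ 3 \<le> n\<^sup>2" using n by (simp add: power_decreasing)
    have yb2: "\<bar>y - y1\<bar> \<le> B * n\<^sup>2"
    proof -
      have "\<bar>y - y1\<bar> \<le> \<bar>y2\<bar> + 16 * P ^ 3 * n ^ 3" using yy by linarith
      also have "\<dots> \<le> (\<bar>k11\<bar> + 2 * norm k2) / K a * n\<^sup>2 + 16 * P ^ 3 * n\<^sup>2"
        using y2b n3 P by (intro add_mono mult_left_mono) auto
      also have "\<dots> \<le> B * n\<^sup>2"
        unfolding B_def distrib_right[symmetric] using Kpos
        by (intro mult_right_mono add_right_mono divide_right_mono) auto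
      finally show ?thesis .
    qed
    have yb: "\<bar>y\<bar> \<le> B * n"
    proof -
      have "\<bar>y\<bar> \<le> \<bar>y1\<bar> + (\<bar>y2\<bar> + 16 * P ^ 3 * n ^ 3)" using yy by linarith
      also have "\<dots> \<le> 2 * norm k1 / K a * n + ((\<bar>k11\<bar> + 2 * norm k2) / K a * n + 16 * P ^ 3 * n)"
      proof (intro add_mono y1b)
        have "(\<bar>k11\<bar> + 2 * norm k2) / K a * n\<^sup>2 \<le> (\<bar>k11\<bar> + 2 * norm k2) / K a * n"
          using n2 Kpos by (intro mult_left_mono) auto
        with y2b show "\<bar>y2\<bar> \<le> (\<bar>k11\<bar> + 2 * norm k2) / K a * n" by linarith
        show "16 * P ^ 3 * n ^ 3 \<le> 16 * P ^ 3 * n" using n2 n3 P by (intro mult_left_mono) auto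
      qed
      also have "\<dots> = B * n" by (simp add: B_def add_divide_distrib distrib_right)
      finally show ?thesis .
    qed
    have "B * n \<le> B * (1 / (2 * B))" using n B by (intro mult_left_mono) auto
    also have "\<dots> = 1 / 2" using B by simp
    finally have Bn: "B * n \<le> 1 / 2" .
    then have y_half: "\<bar>y\<bar> \<le> 1 / 2" using yb by linarith
    have y1b': "\<bar>y1\<bar> \<le> B * n"
    proof -
      have "2 * norm k1 / K a * n \<le> B * n"
        unfolding B_def using n P Kpos by (intro mult_right_mono) (auto simp: add_divide_distrib)
      with y1b show ?thesis by linarith
    qed
    have ln_eq: "ln (K (a + h)) = ln (K a) + ln (1 + y)"
    proof -
      have "K (a + h) = K a * (1 + y)" using Kpos by (simp add: y_def field_simps)
      then show ?thesis using Kpos y_half by (simp add: ln_mult)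
    qed
    have l1: "\<bar>ln (1 + y) - (y - y\<^sup>2 / 2)\<bar> \<le> 2 * B ^ 3 * n ^ 3"
    proof -
      have "\<bar>y\<bar> ^ 3 \<le> (B * n) ^ 3" using yb by (intro power_mono) auto
      then show ?thesis using ln_one_plus_expansion[OF y_half] by (simp add: power_mult_distrib)
    qed
    have l2: "\<bar>y\<^sup>2 - y1\<^sup>2\<bar> \<le> 2 * B\<^sup>2 * n ^ 3"
    proof -
      have "\<bar>y\<^sup>2 - y1\<^sup>2\<bar> = \<bar>y - y1\<bar> * \<bar>y + y1\<bar>"
        by (simp add: power2_eq_square square_diff_square_factored abs_mult mult.commute)
      also have "\<dots> \<le> (B * n\<^sup>2) * (2 * (B * n))"
        using yb2 yb y1b' by (intro mult_mono) auto
      also have "\<dots> = 2 * B\<^sup>2 * n ^ 3" by (simp add: power2_eq_square power3_eq_cube)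
      finally show ?thesis .
    qed
    have target: "Re (\<alpha> * h) + Re (\<beta> * h\<^sup>2) + intensity a * (norm h)\<^sup>2 = y1 + y2 - y1\<^sup>2 / 2"
    proof -
      have t1: "Re (\<alpha> * h) = y1"
      proof -
        have "\<alpha> * h = of_real (2 / K a) * (h * k1)" by (simp add: \<alpha>_def)
        then show ?thesis by (simp add: y1_def)
      qed
      have t2: "Re (\<beta> * h\<^sup>2) = 2 * Re (h\<^sup>2 * k2) / K a - Re ((h * k1)\<^sup>2) / (K a)\<^sup>2"
      proof -
        have "\<beta> * h\<^sup>2 = of_real (2 / K a) * (h\<^sup>2 * k2) - of_real (1 / (K a)\<^sup>2) * (h * k1)\<^sup>2"
          by (simp add: \<beta>_def left_diff_distrib right_diff_distrib power_mult_distrib mult_ac)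
        then show ?thesis by (simp del: of_real_divide of_real_power)
      qed
      have t3: "intensity a * (norm h)\<^sup>2 = (norm h)\<^sup>2 * k11 / K a - (norm (h * k1))\<^sup>2 / (K a)\<^sup>2"
        using Kpos unfolding intensity_def k1[symmetric] k11[symmetric]
        by (simp add: norm_mult power_mult_distrib diff_divide_distrib left_diff_distrib right_diff_distrib power2_eq_square mult_ac)
      have "2 * (Re w)\<^sup>2 = (norm w)\<^sup>2 + Re (w\<^sup>2)" for w :: complex
        unfolding cmod_power2 by (simp add: power2_eq_square)
      from this[of "h * k1"] have t4: "y1\<^sup>2 / 2 = (norm (h * k1))\<^sup>2 / (K a)\<^sup>2 + Re ((h * k1)\<^sup>2) / (K a)\<^sup>2"
        unfolding y1_def power_divide power_mult_distrib add_divide_distrib[symmetric] by simp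
      show ?thesis unfolding t1 t2 t3 t4 y2_def by (simp add: add_divide_distrib)
    qed
    have "\<bar>ln (K (a + h)) - (ln (K a) + Re (\<alpha> * h) + Re (\<beta> * h\<^sup>2) + intensity a * (norm h)\<^sup>2)\<bar>
        = \<bar>(ln (1 + y) - (y - y\<^sup>2 / 2)) + (y - (y1 + y2)) - (y\<^sup>2 - y1\<^sup>2) / 2\<bar>"
      using target unfolding ln_eq by (simp add: diff_divide_distrib)
    also have "\<dots> \<le> 2 * B ^ 3 * n ^ 3 + 16 * P ^ 3 * n ^ 3 + 2 * B\<^sup>2 * n ^ 3"
    proof -
      have "\<bar>u + v - w / 2\<bar> \<le> u' + v' + w'" if "\<bar>u\<bar> \<le> u'" "\<bar>v\<bar> \<le> v'" "\<bar>w\<bar> \<le> w'" for u v w u' v' w' :: real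
        using that by linarith
      from this[OF l1 yy l2] show ?thesis .
    qed
    also have "\<dots> = D * norm h ^ 3" by (simp add: D_def n_def algebra_simps)
    finally show ?thesis .
  qed
  show ?thesis using \<delta>(1) main by blast
qed

lemma G_expansion:
  assumes a: "norm a < 1"
  shows "\<exists>C \<delta>. \<delta> > 0 \<and> norm a + \<delta> < 1 \<and> (\<forall>s. 0 \<le> s \<longrightarrow> s \<le> \<delta> \<longrightarrow>
     \<bar>G a s - 2 * pi * (ln (K a) + intensity a * s\<^sup>2)\<bar> \<le> C * s ^ 3)"
proof -
  obtain \<alpha> \<beta> C \<delta> where d: "\<delta> > 0" and e: "\<And>h. norm h \<le> \<delta> \<Longrightarrow>
     \<bar>ln (K (a + h)) - (ln (K a) + Re (\<alpha> * h) + Re (\<beta> * h\<^sup>2) + intensity a * (norm h)\<^sup>2)\<bar> \<le> C * norm h ^ 3"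
    using log_K_expansion[OF a] by blast
  define \<delta>' where "\<delta>' = min \<delta> ((1 - norm a) / 2)"
  have d': "\<delta>' > 0" "norm a + \<delta>' < 1" "\<delta>' \<le> \<delta>" using d a by (auto simp: \<delta>'_def min_def field_simps)
  have "\<bar>G a s - 2 * pi * (ln (K a) + intensity a * s\<^sup>2)\<bar> \<le> 2 * pi * C * s ^ 3" if s: "0 \<le> s" "s \<le> \<delta>'" for s
  proof -
    define g where "g t = ln (K (a + of_real s * cis t))" for t
    define h where "h t = ln (K a) + Re (\<alpha> * of_real s * cis t) + Re (\<beta> * (of_real s)\<^sup>2 * (cis t)\<^sup>2) + intensity a * s\<^sup>2" for t
    have ig: "integrable arc g" unfolding g_def using s d' by (intro mean_log_expectation(2)) auto
    have ih: "integrable arc h" unfolding h_def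
      by (intro Bochner_Integration.integrable_add integral_arc_trig(3,4)) auto
    have "(LINT t|arc. h t) = 2 * pi * (ln (K a) + intensity a * s\<^sup>2)"
    proof -
      note i1 = integral_arc_trig(1)[of "\<alpha> * of_real s"] integral_arc_trig(3)[of "\<alpha> * of_real s"]
      note i2 = integral_arc_trig(2)[of "\<beta> * (of_real s)\<^sup>2"] integral_arc_trig(4)[of "\<beta> * (of_real s)\<^sup>2"]
      have "(LINT t|arc. h t) = (LINT t|arc. ln (K a)) + (LINT t|arc. Re (\<alpha> * of_real s * cis t))
          + (LINT t|arc. Re (\<beta> * (of_real s)\<^sup>2 * (cis t)\<^sup>2)) + (LINT t|arc. intensity a * s\<^sup>2)"
        unfolding h_def using i1(2) i2(2)
        by (simp only: Bochner_Integration.integral_add Bochner_Integration.integrable_add arc.integrable_const)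
      then show ?thesis unfolding i1(1) i2(1) by (simp add: algebra_simps)
    qed
    then have "G a s - 2 * pi * (ln (K a) + intensity a * s\<^sup>2) = (LINT t|arc. g t - h t)"
      using ig ih by (simp add: G_def g_def[symmetric])
    also have "\<bar>\<dots>\<bar> \<le> (LINT t|arc. \<bar>g t - h t\<bar>)" by (rule integral_abs_bound)
    also have "\<dots> \<le> (LINT t|arc. C * s ^ 3)"
    proof (rule integral_mono)
      show "integrable arc (\<lambda>t. \<bar>g t - h t\<bar>)" using ig ih by auto
      fix t
      show "\<bar>g t - h t\<bar> \<le> C * s ^ 3"
        using e[of "of_real s * cis t"] s d' by (simp add: g_def h_def norm_mult power_mult_distrib mult.assoc)
    qed simp
    also have "\<dots> = 2 * pi * C * s ^ 3" by simp
    finally show ?thesis .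
  qed
  then show ?thesis using d' by blast
qed

end

section \<open>The intensity as a function of the covariance kernel\<close>

context spectral_gaussian
begin

text \<open>Compare the circles of radii \<open>s\<close> and \<open>l s\<close> and let \<open>s \<rightarrow> 0\<close>. The ratio \<open>l\<close> is kept fixed
  because the Jensen inequalities lose a factor that tends to \<open>1\<close> only as \<open>l \<rightarrow> 1\<close>.\<close>

lemma intensity_sandwich:
  assumes rho: "one_intensity M \<xi> \<rho>" and a: "norm a < 1" and l: "l > 1" and \<epsilon>: "\<epsilon> > 0"
  shows "(\<rho> a - \<epsilon>) * pi \<le> intensity a * ((l\<^sup>2 - 1) / (2 * ln l))"
    and "intensity a * ((l\<^sup>2 - 1) / (2 * ln l)) \<le> (\<rho> a + \<epsilon>) * pi * l\<^sup>2"
proof -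
  obtain C \<delta> where d: "\<delta> > 0" "norm a + \<delta> < 1" and Ge: "\<And>s. 0 \<le> s \<Longrightarrow> s \<le> \<delta> \<Longrightarrow>
     \<bar>G a s - 2 * pi * (ln (K a) + intensity a * s\<^sup>2)\<bar> \<le> C * s ^ 3"
    using G_expansion[OF a] by blast
  have cont: "continuous_on (ball 0 1) \<rho>" and nonneg: "\<And>z. z \<in> ball 0 1 \<Longrightarrow> \<rho> z \<ge> 0"
    and int: "\<And>D. D \<in> sets borel \<Longrightarrow> D \<subseteq> ball 0 1 \<Longrightarrow> (\<integral>\<^sup>+\<omega>. zero_process \<xi> \<omega> D \<partial>M) = (\<integral>\<^sup>+z\<in>D. ennreal (\<rho> z) \<partial>lborel)"
    using rho by (auto simp: one_intensity_def)
  have a1: "a \<in> ball 0 1" using a by simp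
  have "isCont \<rho> a" using cont a1 by (simp add: continuous_on_eq_continuous_at)
  then obtain \<eta>0 where e0: "\<eta>0 > 0" "\<And>z. dist z a < \<eta>0 \<Longrightarrow> dist (\<rho> z) (\<rho> a) < \<epsilon>"
    using \<epsilon> unfolding continuous_at_eps_delta by (metis dist_norm real_norm_def)
  define \<eta> where "\<eta> = min \<eta>0 \<delta>"
  have \<eta>: "\<eta> > 0" "\<eta> \<le> \<delta>" "\<eta> \<le> \<eta>0" using e0 d by (auto simp: \<eta>_def)
  define I where "I s = (\<integral>\<^sup>+\<omega>. zero_process \<xi> \<omega> (ball a s) \<partial>M)" for s
  have ballin: "z \<in> ball 0 1" if "z \<in> ball a s" "s \<le> \<eta>" for z s
    using that \<eta> d norm_triangle_sub[of z a] by (simp add: dist_norm norm_minus_commute)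
  have close: "\<bar>\<rho> z - \<rho> a\<bar> < \<epsilon>" if "z \<in> ball a s" "s \<le> \<eta>" for z s
    using e0(2)[of z] that \<eta> by (simp add: dist_commute dist_real_def)
  have I: "I s = (\<integral>\<^sup>+z\<in>ball a s. ennreal (\<rho> z) \<partial>lborel)" if "s \<le> \<eta>" for s
    unfolding I_def using that ballin by (intro int) auto
  have const: "(\<integral>\<^sup>+z\<in>ball a s. ennreal c \<partial>lborel) = ennreal (c * pi * s\<^sup>2)" if "s \<ge> 0" for s c
  proof -
    have "(\<integral>\<^sup>+z\<in>ball a s. ennreal c \<partial>lborel) = ennreal c * emeasure lborel (ball a s)"
      by (subst nn_integral_cmult_indicator) auto
    also have "\<dots> = ennreal c * ennreal (pi * s\<^sup>2)"
      using that by (subst emeasure_ball) (auto simp: unit_ball_vol_2)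
    also have "\<dots> = ennreal (c * pi * s\<^sup>2)"
    proof (cases "c \<ge> 0")
      case True
      then show ?thesis by (simp add: ennreal_mult'[symmetric] mult.assoc)
    next
      case False
      then have "c * pi * s\<^sup>2 \<le> 0" by (simp add: mult_nonpos_nonneg)
      then show ?thesis using False by (simp add: ennreal_neg)
    qed
    finally show ?thesis .
  qed
  have lower: "ennreal ((\<rho> a - \<epsilon>) * pi * s\<^sup>2) \<le> I s" if "0 \<le> s" "s \<le> \<eta>" for s
    unfolding I[OF that(2)] const[OF that(1), symmetric]
    by (intro nn_integral_mono) (use close[OF _ that(2)] in \<open>auto simp: indicator_def intro!: ennreal_leI\<close>, smt (verit))
  have upper: "I s \<le> ennreal ((\<rho> a + \<epsilon>) * pi * s\<^sup>2)" if "0 \<le> s" "s \<le> \<eta>" for s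
    unfolding I[OF that(2)] const[OF that(1), symmetric]
    by (intro nn_integral_mono) (use close[OF _ that(2)] in \<open>auto simp: indicator_def intro!: ennreal_leI\<close>, smt (verit))
  have lnl: "ln l > 0" using l by simp
  define Q where "Q s = (G a (l * s) - G a s) / (4 * pi * ln l)" for s
  have Qexp: "\<bar>Q s - intensity a * ((l\<^sup>2 - 1) / (2 * ln l)) * s\<^sup>2\<bar> \<le> \<bar>C\<bar> * (l ^ 3 + 1) / (4 * pi * ln l) * s ^ 3"
    if s: "0 \<le> s" "l * s \<le> \<eta>" for s
  proof -
    have sl: "s \<le> l * s" using l s by (simp add: mult_le_cancel_right1)
    have mono: "C * x ^ 3 \<le> \<bar>C\<bar> * x ^ 3" if "x \<ge> 0" for x using that by (intro mult_right_mono) auto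
    have e1: "\<bar>G a s - 2 * pi * (ln (K a) + intensity a * s\<^sup>2)\<bar> \<le> \<bar>C\<bar> * s ^ 3"
      by (rule order_trans[OF Ge mono]) (use s sl \<eta> in auto)
    have e2: "\<bar>G a (l * s) - 2 * pi * (ln (K a) + intensity a * (l * s)\<^sup>2)\<bar> \<le> \<bar>C\<bar> * (l * s) ^ 3"
      by (rule order_trans[OF Ge mono]) (use s sl \<eta> in auto)
    have "\<bar>(G a (l * s) - G a s) - 2 * pi * intensity a * (l\<^sup>2 - 1) * s\<^sup>2\<bar>
      = \<bar>(G a (l * s) - 2 * pi * (ln (K a) + intensity a * (l * s)\<^sup>2)) - (G a s - 2 * pi * (ln (K a) + intensity a * s\<^sup>2))\<bar>"
      by (simp add: power_mult_distrib algebra_simps)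
    also have "\<dots> \<le> \<bar>C\<bar> * (l * s) ^ 3 + \<bar>C\<bar> * s ^ 3" using e1 e2 by linarith
    also have "\<dots> = \<bar>C\<bar> * (l ^ 3 + 1) * s ^ 3" by (simp add: power_mult_distrib algebra_simps)
    finally have num: "\<bar>(G a (l * s) - G a s) - 2 * pi * intensity a * (l\<^sup>2 - 1) * s\<^sup>2\<bar> \<le> \<bar>C\<bar> * (l ^ 3 + 1) * s ^ 3" .
    have "Q s - intensity a * ((l\<^sup>2 - 1) / (2 * ln l)) * s\<^sup>2
      = ((G a (l * s) - G a s) - 2 * pi * intensity a * (l\<^sup>2 - 1) * s\<^sup>2) / (4 * pi * ln l)"
    proof -
      have "i * (m / (2 * L)) * x = 2 * pi * i * m * x / (4 * pi * L)" for i m x L :: real by simp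
      from this[of "intensity a" "l\<^sup>2 - 1" "ln l" "s\<^sup>2"] show ?thesis
        unfolding Q_def by (simp only: diff_divide_distrib[symmetric])
    qed
    then have "\<bar>Q s - intensity a * ((l\<^sup>2 - 1) / (2 * ln l)) * s\<^sup>2\<bar> \<le> \<bar>C\<bar> * (l ^ 3 + 1) * s ^ 3 / (4 * pi * ln l)"
      using num lnl by (simp add: abs_divide divide_right_mono abs_mult)
    then show ?thesis by simp
  qed
  define k where "k = intensity a * ((l\<^sup>2 - 1) / (2 * ln l))"
  define D where "D = \<bar>C\<bar> * (l ^ 3 + 1) / (4 * pi * ln l)"
  have key: "(\<rho> a - \<epsilon>) * pi \<le> k + D * s" "k - D * s \<le> (\<rho> a + \<epsilon>) * pi * l\<^sup>2" if s: "0 < s" "l * s \<le> \<eta>" for s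
  proof -
    have sl: "s < l * s" using l s by simp
    have ls: "norm a + l * s < 1" "0 \<le> l * s" "s \<le> \<eta>" using s sl \<eta> d by linarith+
    have lls: "(l * s) / s = l" using s by simp
    note b = expected_zeros_bounds[OF s(1) sl ls(1), unfolded lls, folded Q_def I_def]
    have Q0: "Q s \<ge> 0" by (rule b(3))
    have "ennreal ((\<rho> a - \<epsilon>) * pi * s\<^sup>2) \<le> ennreal (Q s)"
      using lower[of s] b(1) s ls by (meson less_imp_le order_trans)
    then have "(\<rho> a - \<epsilon>) * pi * s\<^sup>2 \<le> Q s" using Q0 by (simp add: ennreal_le_iff)
    also have "\<dots> \<le> k * s\<^sup>2 + D * s ^ 3" using Qexp[of s] s unfolding k_def D_def by linarith
    also have "\<dots> = (k + D * s) * s\<^sup>2" by (simp add: power2_eq_square power3_eq_cube algebra_simps)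
    finally show "(\<rho> a - \<epsilon>) * pi \<le> k + D * s" using s by simp
    have "ennreal (Q s) \<le> ennreal ((\<rho> a + \<epsilon>) * pi * (l * s)\<^sup>2)"
      using upper[of "l * s"] b(2) s ls by (meson order_trans)
    moreover have "0 \<le> (\<rho> a + \<epsilon>) * pi * (l * s)\<^sup>2" using nonneg[OF a1] \<epsilon> by simp
    ultimately have "Q s \<le> (\<rho> a + \<epsilon>) * pi * (l * s)\<^sup>2" by (simp add: ennreal_le_iff)
    moreover have "k * s\<^sup>2 - D * s ^ 3 \<le> Q s" using Qexp[of s] s unfolding k_def D_def by linarith
    moreover have "k * s\<^sup>2 - D * s ^ 3 = (k - D * s) * s\<^sup>2" by (simp add: power2_eq_square power3_eq_cube algebra_simps)
    ultimately have "(k - D * s) * s\<^sup>2 \<le> ((\<rho> a + \<epsilon>) * pi * l\<^sup>2) * s\<^sup>2" by (simp add: power_mult_distrib mult_ac)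
    then show "k - D * s \<le> (\<rho> a + \<epsilon>) * pi * l\<^sup>2" using s by (simp add: mult_le_cancel_right)
  qed
  have ev: "eventually (\<lambda>s. 0 < s \<and> l * s \<le> \<eta>) (at_right 0)"
    using \<eta> l by (intro eventually_at_rightI[of 0 "\<eta> / l"]) (auto simp: field_simps)
  have "((\<lambda>s. k + D * s) \<longlongrightarrow> k + D * 0) (at_right 0)" by (intro tendsto_intros)
  then have "(\<rho> a - \<epsilon>) * pi \<le> k + D * 0"
    by (rule tendsto_lowerbound) (use ev key(1) in \<open>auto elim!: eventually_mono\<close>)
  then show "(\<rho> a - \<epsilon>) * pi \<le> intensity a * ((l\<^sup>2 - 1) / (2 * ln l))" by (simp add: k_def)
  have "((\<lambda>s. k - D * s) \<longlongrightarrow> k - D * 0) (at_right 0)" by (intro tendsto_intros)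
  then have "k - D * 0 \<le> (\<rho> a + \<epsilon>) * pi * l\<^sup>2"
    by (rule tendsto_upperbound) (use ev key(2) in \<open>auto elim!: eventually_mono\<close>)
  then show "intensity a * ((l\<^sup>2 - 1) / (2 * ln l)) \<le> (\<rho> a + \<epsilon>) * pi * l\<^sup>2" by (simp add: k_def)
qed

text \<open>The Edelman-Kostlan formula: let \<open>l \<rightarrow> 1\<close> in the sandwich, where \<open>(l^2 - 1) / (2 ln l) \<rightarrow> 1\<close>.\<close>

theorem one_intensity_eq:
  assumes rho: "one_intensity M \<xi> \<rho>" and a: "norm a < 1"
  shows "\<rho> a = intensity a / pi"
proof -
  \<comment> \<open>Both bounds of the sandwich meet in this limit.\<close>
  have lim: "((\<lambda>l::real. (l\<^sup>2 - 1) / (2 * ln l)) \<longlongrightarrow> 1) (at_right 1)" by real_asymp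
  then have lim1: "((\<lambda>l. intensity a * ((l\<^sup>2 - 1) / (2 * ln l))) \<longlongrightarrow> intensity a * 1) (at_right 1)"
    by (intro tendsto_intros)
  have ev: "eventually (\<lambda>l::real. l > 1) (at_right 1)" by (rule eventually_at_right_less)
  have "\<bar>intensity a - \<rho> a * pi\<bar> \<le> \<epsilon>" if \<epsilon>: "\<epsilon> > 0" for \<epsilon>
  proof -
    have e': "\<epsilon> / pi > 0" using \<epsilon> by simp
    have "(\<rho> a - \<epsilon> / pi) * pi \<le> intensity a * 1"
      by (rule tendsto_lowerbound[OF lim1])
         (use ev intensity_sandwich(1)[OF rho a _ e'] in \<open>auto elim!: eventually_mono\<close>)
    moreover have "intensity a * 1 \<le> (\<rho> a + \<epsilon> / pi) * pi * 1\<^sup>2"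
    proof (rule tendsto_le[OF _ _ lim1])
      show "((\<lambda>l. (\<rho> a + \<epsilon> / pi) * pi * l\<^sup>2) \<longlongrightarrow> (\<rho> a + \<epsilon> / pi) * pi * 1\<^sup>2) (at_right 1)"
        by (intro tendsto_intros)
    qed (use ev intensity_sandwich(2)[OF rho a _ e'] in \<open>auto elim!: eventually_mono\<close>)
    ultimately show ?thesis by (simp add: algebra_simps abs_le_iff)
  qed
  then have "\<bar>intensity a - \<rho> a * pi\<bar> \<le> 0" by (rule field_le_epsilon[of _ 0, simplified])
  then show ?thesis by (simp add: field_simps)
qed

end

section \<open>Integrals against powers of the Poisson denominator\<close>

text \<open>The denominator of the Poisson kernel, \<open>|1 - r e^(is)|^2\<close>.\<close>

definition pdenom :: "real \<Rightarrow> real \<Rightarrow> real" where "pdenom r s = 1 - 2 * r * cos s + r\<^sup>2"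

lemma pdenom_eq: "pdenom r s = (1 - r)\<^sup>2 + 2 * r * (1 - cos s)"
  by (simp add: pdenom_def power2_eq_square algebra_simps)

lemma pdenom_ge: "0 \<le> r \<Longrightarrow> (1 - r)\<^sup>2 \<le> pdenom r s"
  by (simp add: pdenom_eq)

lemma pdenom_pos: "0 \<le> r \<Longrightarrow> r < 1 \<Longrightarrow> 0 < pdenom r s"
  using pdenom_ge[of r s] by (smt (verit) zero_less_power)

lemma pdenom_measurable [measurable]: "pdenom r \<in> borel_measurable borel"
  unfolding pdenom_def by measurable

lemma pdenom_continuous: "continuous_on A (pdenom r)"
  unfolding pdenom_def by (intro continuous_intros)

lemma norm_eq_pdenom: "(norm (1 - of_real r * cis s))\<^sup>2 = pdenom r s"
proof -
  have "(norm (1 - of_real r * cis s))\<^sup>2 = (1 - r * cos s)\<^sup>2 + (r * sin s)\<^sup>2"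
    unfolding cmod_power2 by simp
  also have "\<dots> = 1 - 2 * r * cos s + r\<^sup>2 * ((cos s)\<^sup>2 + (sin s)\<^sup>2)"
    by algebra
  finally have "(norm (1 - of_real r * cis s))\<^sup>2 = 1 - 2 * r * cos s + r\<^sup>2 * ((cos s)\<^sup>2 + (sin s)\<^sup>2)" .
  then show ?thesis by (simp add: pdenom_def)
qed

lemma one_minus_mult_nonzero:
  assumes "0 \<le> r" "r < 1"
  obtains R where "1 < R" "\<And>z :: complex. z \<in> ball 0 R \<Longrightarrow> 1 - of_real r * z \<noteq> 0"
proof -
  have "1 - of_real r * z \<noteq> 0" if "z \<in> ball 0 (if r = 0 then 2 else 1 / r)" for z :: complex
  proof
    assume "1 - of_real r * z = 0"
    then have "norm (of_real r * z) = norm (1::complex)" by simp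
    then have "r * norm z = 1" using assms by (simp add: norm_mult)
    with that assms show False by (auto simp: field_simps split: if_splits)
  qed
  moreover have "1 < (if r = 0 then 2 else 1 / r)" using assms by auto
  ultimately show ?thesis using that by blast
qed

text \<open>The Poisson kernel is the real part of \<open>(1 + r \<zeta>) / (1 - r \<zeta>)\<close>, whose value at \<open>0\<close> is \<open>1\<close>.\<close>

lemma integral_poisson:
  assumes r: "0 \<le> r" "r < 1"
  shows "(LINT s|arc. 1 / pdenom r s) = 2 * pi / (1 - r\<^sup>2)"
proof -
  obtain R where R: "1 < R" and nz: "\<And>z :: complex. z \<in> ball 0 R \<Longrightarrow> 1 - of_real r * z \<noteq> 0"
    using one_minus_mult_nonzero[OF r] by blast
  have hol: "(\<lambda>z. (1 + of_real r * z) / (1 - of_real r * z)) holomorphic_on ball 0 R"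
    using nz by (intro holomorphic_intros) auto
  have eq: "Re ((1 + of_real r * cis s) / (1 - of_real r * cis s)) = (1 - r\<^sup>2) * (1 / pdenom r s)" for s
  proof -
    have "(1 + of_real r * cis s) / (1 - of_real r * cis s)
        = (1 + of_real r * cis s) * cnj (1 - of_real r * cis s) / of_real (pdenom r s)"
      by (subst complex_div_cnj) (simp add: norm_eq_pdenom)
    moreover have "Re ((1 + of_real r * cis s) * cnj (1 - of_real r * cis s)) = 1 - r\<^sup>2"
      by (simp add: algebra_simps power2_eq_square) (simp add: power2_eq_square[symmetric] distrib_left[symmetric])
    ultimately show ?thesis by (simp add: Re_divide_of_real)
  qed
  have "integrable arc (\<lambda>s. (1 + of_real r * cis s) / (1 - of_real r * cis s))"
    by (rule integrable_arc_continuous) (use nz R in \<open>auto intro!: continuous_intros simp: dist_norm\<close>)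
  then have "(LINT s|arc. (1 - r\<^sup>2) * (1 / pdenom r s))
      = Re (LINT s|arc. (1 + of_real r * cis s) / (1 - of_real r * cis s))"
    unfolding eq[symmetric] by (rule integral_Re)
  also have "\<dots> = 2 * pi" using holomorphic_mean_value[OF hol, of 1] R by simp
  finally have "(1 - r\<^sup>2) * (LINT s|arc. 1 / pdenom r s) = 2 * pi"
    by (simp only: integral_mult_right_zero)
  moreover have "r\<^sup>2 < 1" using r by (simp add: power_less_one_iff abs_square_less_1)
  ultimately show ?thesis by (simp add: field_simps)
qed

lemma integrable_over_pdenom:
  assumes r: "0 \<le> r" "r < 1" and h: "integrable arc h"
  shows "integrable arc (\<lambda>s. h s / pdenom r s ^ n)"
proof (rule Bochner_Integration.integrable_bound)
  show "integrable arc (\<lambda>s. h s / ((1 - r)\<^sup>2) ^ n)" using h by simp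
  show "(\<lambda>s. h s / pdenom r s ^ n) \<in> borel_measurable arc" using h by measurable
  have "norm (h s / pdenom r s ^ n) \<le> norm (h s / ((1 - r)\<^sup>2) ^ n)" for s
    using pdenom_pos[OF r, of s] pdenom_ge[OF r(1), of s] r
    by (auto simp: norm_divide norm_power intro!: divide_left_mono power_mono mult_pos_pos zero_less_power)
  then show "AE s in arc. norm (h s / pdenom r s ^ n) \<le> norm (h s / ((1 - r)\<^sup>2) ^ n)" by simp
qed

lemma integrable_arc_const [simp]: "integrable arc (\<lambda>_. c :: real)"
  by (rule integrable_arc_continuous) auto

lemma integrable_inverse_pdenom:
  assumes r: "0 \<le> r" "r < 1"
  shows "integrable arc (\<lambda>s. 1 / pdenom r s)" "integrable arc (\<lambda>s. 1 / (pdenom r s)\<^sup>2)"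
  using integrable_over_pdenom[OF r integrable_arc_const[of 1], of 1]
    integrable_over_pdenom[OF r integrable_arc_const[of 1], of 2] by simp_all

text \<open>The real part of \<open>\<zeta> / (1 - r \<zeta>)^2\<close>, which vanishes at \<open>0\<close>. It is the holomorphic derivative of the
  Poisson kernel; the vanishing says that the Poisson integral of a constant has no gradient.\<close>

lemma integral_poisson_derivative:
  assumes r: "0 \<le> r" "r < 1"
  shows "(LINT s|arc. ((1 + r\<^sup>2) * cos s - 2 * r) / (pdenom r s)\<^sup>2) = 0"
proof -
  obtain R where R: "1 < R" and nz: "\<And>z :: complex. z \<in> ball 0 R \<Longrightarrow> 1 - of_real r * z \<noteq> 0"
    using one_minus_mult_nonzero[OF r] by blast
  have hol: "(\<lambda>z. z / (1 - of_real r * z)\<^sup>2) holomorphic_on ball 0 R"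
    using nz by (intro holomorphic_intros) auto
  have eq: "Re (cis s / (1 - of_real r * cis s)\<^sup>2) = ((1 + r\<^sup>2) * cos s - 2 * r) / (pdenom r s)\<^sup>2" for s
  proof -
    have "cis s / (1 - of_real r * cis s)\<^sup>2
        = cis s * cnj ((1 - of_real r * cis s)\<^sup>2) / of_real ((pdenom r s)\<^sup>2)"
      by (subst complex_div_cnj) (simp only: norm_power norm_eq_pdenom)
    also have "cis s * cnj ((1 - of_real r * cis s)\<^sup>2) = cis s - 2 * of_real r + of_real (r\<^sup>2) * cis (- s)"
    proof -
      have "cis s * cnj ((1 - of_real r * cis s)\<^sup>2) = cis s * (1 - of_real r * cis (-s))\<^sup>2"
        by (simp add: cis_cnj)
      also have "\<dots> = cis s - 2 * of_real r * (cis s * cis (-s)) + of_real r ^2 * (cis s * cis (-s)) * cis (-s)"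
        by (simp add: power2_eq_square algebra_simps)
      also have "cis s * cis (-s) = 1" by (simp add: cis_mult)
      finally show ?thesis by simp
    qed
    finally show ?thesis by (simp add: Re_divide_of_real algebra_simps flip: of_real_power of_real_mult)
  qed
  have "integrable arc (\<lambda>s. cis s / (1 - of_real r * cis s)\<^sup>2)"
    by (rule integrable_arc_continuous) (use nz R in \<open>auto intro!: continuous_intros simp: dist_norm\<close>)
  then have "(LINT s|arc. ((1 + r\<^sup>2) * cos s - 2 * r) / (pdenom r s)\<^sup>2)
      = Re (LINT s|arc. cis s / (1 - of_real r * cis s)\<^sup>2)"
    by (simp flip: eq)
  also have "\<dots> = 0" using holomorphic_mean_value[OF hol, of 1] R by simp
  finally show ?thesis .
qed

text \<open>Writing \<open>cos s\<close> through the denominator turns \<open>integral_poisson_derivative\<close> into a linear relation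
  between the integrals of its first two inverse powers.\<close>

lemma integral_inverse_pdenom_squared:
  assumes r: "0 \<le> r" "r < 1"
  shows "(LINT s|arc. 1 / (pdenom r s)\<^sup>2) = 2 * pi * (1 + r\<^sup>2) / (1 - r\<^sup>2) ^ 3"
proof (cases "r = 0")
  case True then show ?thesis by (simp add: pdenom_def)
next
  case False
  have y: "1 - r\<^sup>2 > 0" using r by (simp add: power_less_one_iff abs_square_less_1)
  have pw: "((1 + r\<^sup>2) * cos s - 2 * r) / (pdenom r s)\<^sup>2
     = ((1 - r\<^sup>2)\<^sup>2 * (1 / (pdenom r s)\<^sup>2) - (1 + r\<^sup>2) * (1 / pdenom r s)) / (2 * r)" for s
  proof -
    have c: "cos s = (1 + r\<^sup>2 - pdenom r s) / (2 * r)" using False by (simp add: pdenom_def)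
    show ?thesis unfolding c using pdenom_pos[OF r, of s] False
      by (simp add: field_simps power2_eq_square)
  qed
  have "0 = (LINT s|arc. ((1 - r\<^sup>2)\<^sup>2 * (1 / (pdenom r s)\<^sup>2) - (1 + r\<^sup>2) * (1 / pdenom r s)) / (2 * r))"
    using integral_poisson_derivative[OF r] unfolding pw by simp
  also have "\<dots> = ((1 - r\<^sup>2)\<^sup>2 * (LINT s|arc. 1 / (pdenom r s)\<^sup>2) - (1 + r\<^sup>2) * (LINT s|arc. 1 / pdenom r s)) / (2 * r)"
    using integrable_inverse_pdenom[OF r]
    by (simp only: integral_divide_zero integral_mult_right_zero Bochner_Integration.integral_diff integrable_mult_right)
  finally have eq0: "0 = ((1 - r\<^sup>2)\<^sup>2 * (LINT s|arc. 1 / (pdenom r s)\<^sup>2) - (1 + r\<^sup>2) * (2 * pi / (1 - r\<^sup>2))) / (2 * r)"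
    by (simp only: integral_poisson[OF r])
  have "A = B" if "0 = (A - B) / (2 * r)" for A B using that False by simp
  from this[OF eq0] have eq: "(1 - r\<^sup>2)\<^sup>2 * (LINT s|arc. 1 / (pdenom r s)\<^sup>2) = (1 + r\<^sup>2) * (2 * pi / (1 - r\<^sup>2))" .
  have "X = 2 * pi * c / Y ^ 3" if "Y > 0" "Y\<^sup>2 * X = c * (2 * pi / Y)" for X Y c :: real
  proof -
    have "X = Y\<^sup>2 * X / Y\<^sup>2" using that(1) by simp
    also have "\<dots> = c * (2 * pi / Y) / Y\<^sup>2" by (simp only: that(2))
    also have "\<dots> = 2 * pi * c / Y ^ 3" by (simp add: power2_eq_square power3_eq_cube) (simp only: mult_ac)
    finally show ?thesis .
  qed
  from this[OF y eq] show ?thesis .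
qed

lemma frac_identity_1: fixes d p r c :: real assumes "d \<noteq> 0" "p \<noteq> 0" "r \<noteq> 0" "p\<^sup>2 - c = 2 * r"
  shows "(2 * pi / (d * p) - d\<^sup>2 * (2 * pi * c / (d * p) ^ 3)) / (2 * r) = 2 * pi / (p\<^sup>2 * (d * p))"
proof -
  have "2 * pi / (d * p) - d\<^sup>2 * (2 * pi * c / (d * p) ^ 3) = 2 * pi * (p\<^sup>2 - c) / (d * p ^ 3)"
    using assms(1,2) by (simp add: field_simps power2_eq_square power3_eq_cube)
  then show ?thesis using assms by (simp add: power2_eq_square power3_eq_cube)
qed
lemma frac_identity_2: fixes d p r :: real assumes "d \<noteq> 0" "p \<noteq> 0" "r \<noteq> 0" "p\<^sup>2 - d = r * (3 + r)"
  shows "(2 * pi / p - d\<^sup>2 * (2 * pi / (p\<^sup>2 * (d * p)))) / (2 * r) = pi * (3 + r) / p ^ 3"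
proof -
  have "2 * pi / p - d\<^sup>2 * (2 * pi / (p\<^sup>2 * (d * p))) = 2 * pi * (p\<^sup>2 - d) / p ^ 3"
    using assms(1,2) by (simp add: field_simps power2_eq_square power3_eq_cube)
  then show ?thesis using assms by (simp add: power3_eq_cube)
qed
lemma frac_identity_3: fixes d p r :: real assumes "d \<noteq> 0" "p \<noteq> 0" "4 - (3 + r) * d = p\<^sup>2"
  shows "2 * (2 * pi / (p\<^sup>2 * (d * p))) - pi * (3 + r) / p ^ 3 = pi / (d * p)"
proof -
  have "2 * (2 * pi / (p\<^sup>2 * (d * p))) - pi * (3 + r) / p ^ 3 = pi * (4 - (3 + r) * d) / (d * p ^ 3)"
    using assms(1,2) by (simp add: field_simps power2_eq_square power3_eq_cube)
  then show ?thesis using assms by (simp add: power2_eq_square power3_eq_cube)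
qed
lemma y_pos: "0 \<le> r \<Longrightarrow> r < 1 \<Longrightarrow> 0 < 1 - (r::real)\<^sup>2"
  by (simp add: power_less_one_iff abs_square_less_1)

context
  fixes r :: real
  assumes r: "0 < r" "r < 1"
begin

lemma integrable_cos_over_pdenom:
  "integrable arc (\<lambda>s. (1 - cos s) ^ k / pdenom r s ^ n)"
  by (rule integrable_over_pdenom) (use r in \<open>auto intro!: integrable_arc_continuous continuous_intros\<close>)

text \<open>Since \<open>2 r (1 - cos s) = pdenom r s - (1 - r)^2\<close>, every factor \<open>1 - cos s\<close> lowers either the power of
  the denominator or the power of \<open>1 - cos s\<close>.\<close>

lemma integral_cos_over_q_step:
  "(LINT s|arc. (1 - cos s) ^ (k + 1) / pdenom r s ^ (n + 1))
     = ((LINT s|arc. (1 - cos s) ^ k / pdenom r s ^ n) - (1 - r)\<^sup>2 * (LINT s|arc. (1 - cos s) ^ k / pdenom r s ^ (n + 1))) / (2 * r)"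
proof -
  have pw: "(1 - cos s) ^ (k + 1) / pdenom r s ^ (n + 1)
     = ((1 - cos s) ^ k / pdenom r s ^ n - (1 - r)\<^sup>2 * ((1 - cos s) ^ k / pdenom r s ^ (n + 1))) / (2 * r)" for s
  proof -
    have q0: "pdenom r s \<noteq> 0" using pdenom_pos[of r s] r by simp
    have c: "1 - cos s = (pdenom r s - (1 - r)\<^sup>2) / (2 * r)" using r by (simp add: pdenom_eq)
    have "((1 - cos s) ^ k / pdenom r s ^ n - (1 - r)\<^sup>2 * ((1 - cos s) ^ k / pdenom r s ^ (n + 1))) / (2 * r)
      = (1 - cos s) ^ k * ((pdenom r s - (1 - r)\<^sup>2) / (2 * r)) / pdenom r s ^ (n + 1)"
      using q0 r by (simp add: divide_simps) (simp add: algebra_simps)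
    then show ?thesis unfolding c[symmetric] by simp
  qed
  show ?thesis unfolding pw
    by (simp only: integral_divide_zero integral_mult_right_zero Bochner_Integration.integral_diff
        integrable_cos_over_pdenom integrable_mult_right)
qed

lemma y_factor: "1 - r\<^sup>2 = (1 - r) * (1 + r)"
  by (simp add: power2_eq_square algebra_simps)

lemma integral_m_over_pdenom: "(LINT s|arc. (1 - cos s) / pdenom r s) = 2 * pi / (1 + r)"
proof -
  have "(LINT s|arc. (1 - cos s) / pdenom r s) = (2 * pi - (1 - r)\<^sup>2 * (LINT s|arc. 1 / pdenom r s)) / (2 * r)"
    using integral_cos_over_q_step[of 0 0] by simp
  also have "(LINT s|arc. 1 / pdenom r s) = 2 * pi / ((1 - r) * (1 + r))"
    using integral_poisson[of r] r unfolding y_factor by simp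
  also have "(2 * pi - (1 - r)\<^sup>2 * (2 * pi / ((1 - r) * (1 + r)))) / (2 * r) = 2 * pi / (1 + r)"
    using r by (simp add: divide_simps power2_eq_square) (simp add: algebra_simps)
  finally show ?thesis .
qed

lemma integral_m_over_pdenom_sq: "(LINT s|arc. (1 - cos s) / (pdenom r s)\<^sup>2) = 2 * pi / ((1 + r)\<^sup>2 * (1 - r\<^sup>2))"
proof -
  have "(LINT s|arc. (1 - cos s) / (pdenom r s)\<^sup>2)
      = ((LINT s|arc. 1 / pdenom r s) - (1 - r)\<^sup>2 * (LINT s|arc. 1 / (pdenom r s)\<^sup>2)) / (2 * r)"
    using integral_cos_over_q_step[of 0 1] by (simp only: one_add_one power_one_right add_0 power_0)
  also have "(LINT s|arc. 1 / pdenom r s) = 2 * pi / ((1 - r) * (1 + r))"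
    using integral_poisson[of r] r unfolding y_factor by simp
  also have "(LINT s|arc. 1 / (pdenom r s)\<^sup>2) = 2 * pi * (1 + r\<^sup>2) / ((1 - r) * (1 + r)) ^ 3"
    using integral_inverse_pdenom_squared[of r] r unfolding y_factor by simp
  also have "(2 * pi / ((1 - r) * (1 + r)) - (1 - r)\<^sup>2 * (2 * pi * (1 + r\<^sup>2) / ((1 - r) * (1 + r)) ^ 3)) / (2 * r)
      = 2 * pi / ((1 + r)\<^sup>2 * ((1 - r) * (1 + r)))"
    using r by (intro frac_identity_1) (simp_all add: power2_sum)
  finally show ?thesis unfolding y_factor .
qed

lemma integral_m2_over_pdenom_sq: "(LINT s|arc. (1 - cos s)\<^sup>2 / (pdenom r s)\<^sup>2) = pi * (3 + r) / (1 + r) ^ 3"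
proof -
  have "(LINT s|arc. (1 - cos s)\<^sup>2 / (pdenom r s)\<^sup>2)
      = ((LINT s|arc. (1 - cos s) / pdenom r s) - (1 - r)\<^sup>2 * (LINT s|arc. (1 - cos s) / (pdenom r s)\<^sup>2)) / (2 * r)"
    using integral_cos_over_q_step[of 1 1] by (simp only: one_add_one power_one_right)
  also have "\<dots> = (2 * pi / (1 + r) - (1 - r)\<^sup>2 * (2 * pi / ((1 + r)\<^sup>2 * ((1 - r) * (1 + r))))) / (2 * r)"
    by (simp only: integral_m_over_pdenom integral_m_over_pdenom_sq y_factor)
  also have "\<dots> = pi * (3 + r) / (1 + r) ^ 3"
    using r by (intro frac_identity_2) (simp_all add: power2_eq_square algebra_simps)
  finally show ?thesis .
qed

lemma integral_sin2_over_pdenom_sq: "(LINT s|arc. (sin s)\<^sup>2 / (pdenom r s)\<^sup>2) = pi / (1 - r\<^sup>2)"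
proof -
  have pw: "(sin s)\<^sup>2 / (pdenom r s)\<^sup>2 = 2 * ((1 - cos s) / (pdenom r s)\<^sup>2) - (1 - cos s)\<^sup>2 / (pdenom r s)\<^sup>2" for s
    by (simp add: sin_squared_eq power2_eq_square diff_divide_distrib[symmetric] algebra_simps)
  have "(LINT s|arc. (sin s)\<^sup>2 / (pdenom r s)\<^sup>2)
      = 2 * (LINT s|arc. (1 - cos s) / (pdenom r s)\<^sup>2) - (LINT s|arc. (1 - cos s)\<^sup>2 / (pdenom r s)\<^sup>2)"
    unfolding pw using integrable_cos_over_pdenom[of 1 2] integrable_cos_over_pdenom[of 2 2]
    by (simp only: power_one_right Bochner_Integration.integral_diff integrable_mult_right integral_mult_right_zero)
  also have "\<dots> = 2 * (2 * pi / ((1 + r)\<^sup>2 * ((1 - r) * (1 + r)))) - pi * (3 + r) / (1 + r) ^ 3"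
    by (simp only: integral_m_over_pdenom_sq integral_m2_over_pdenom_sq y_factor)
  also have "\<dots> = pi / ((1 - r) * (1 + r))"
    using r by (intro frac_identity_3) (simp_all add: power2_eq_square algebra_simps)
  finally show ?thesis unfolding y_factor .
qed

end

text \<open>Convergence as \<open>r \<rightarrow> 1\<close> with rate \<open>1 - r\<close>, closed under the field operations. The asymptotic
  expansions below are assembled from these closure rules.\<close>

definition approaches :: "(real \<Rightarrow> real) \<Rightarrow> real \<Rightarrow> bool" where
  "approaches F L \<longleftrightarrow> (\<lambda>r. F r - L) \<in> O[at_left 1](\<lambda>r. 1 - r)"

lemma approachesI:
  assumes "\<And>r. 1/2 \<le> r \<Longrightarrow> r < 1 \<Longrightarrow> \<bar>F r - L\<bar> \<le> B * (1 - r)"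
  shows "approaches F L"
  unfolding approaches_def
proof (rule bigoI)
  have "eventually (\<lambda>r::real. r \<in> {1/2<..<1}) (at_left 1)"
    by (intro eventually_at_leftI[of "1/2"]) auto
  then show "eventually (\<lambda>r. norm (F r - L) \<le> B * norm (1 - r)) (at_left 1)"
    by eventually_elim (use assms in auto)
qed

lemma approaches_cong:
  assumes "approaches F L" "\<And>r. 1/2 \<le> r \<Longrightarrow> r < 1 \<Longrightarrow> F r = G r"
  shows "approaches G L"
proof -
  have "eventually (\<lambda>r::real. r \<in> {1/2<..<1}) (at_left 1)"
    by (intro eventually_at_leftI[of "1/2"]) auto
  then have "eventually (\<lambda>r. F r - L = G r - L) (at_left 1)"
    by eventually_elim (use assms in auto)
  from iffD1[OF landau_o.big.in_cong[OF this] assms(1)[unfolded approaches_def]]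
  show ?thesis unfolding approaches_def .
qed

lemma approaches_const: "approaches (\<lambda>_. c) c" by (simp add: approaches_def)

lemma approaches_id: "approaches (\<lambda>r. r) 1"
  by (rule approachesI[of _ _ 1]) auto

lemma approaches_tendsto: assumes "approaches F L" shows "(F \<longlongrightarrow> L) (at_left 1)"
proof -
  obtain c where c: "eventually (\<lambda>r. norm (F r - L) \<le> c * norm (1 - r)) (at_left 1)"
    using assms unfolding approaches_def by (elim landau_o.bigE) auto
  have "((\<lambda>r::real. c * norm (1 - r)) \<longlongrightarrow> c * norm (1 - 1 :: real)) (at_left 1)"
    by (intro tendsto_intros)
  then have "((\<lambda>r. F r - L) \<longlongrightarrow> 0) (at_left 1)"
    by (intro Lim_null_comparison[OF c]) simp
  then show ?thesis by (simp add: LIM_zero_iff)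
qed

lemma tendsto_imp_bounded: "((F :: real \<Rightarrow> real) \<longlongrightarrow> L) (at_left 1) \<Longrightarrow> F \<in> O[at_left 1](\<lambda>_. 1)"
  by (rule bigoI_tendsto[where c = L]) simp_all

lemma approaches_O1: assumes "approaches F L" shows "F \<in> O[at_left 1](\<lambda>_. 1)"
  using approaches_tendsto[OF assms] by (rule tendsto_imp_bounded)

lemma approaches_add: "approaches F L \<Longrightarrow> approaches G K \<Longrightarrow> approaches (\<lambda>r. F r + G r) (L + K)"
  unfolding approaches_def using sum_in_bigo(1)[of "\<lambda>r. F r - L" _ _ "\<lambda>r. G r - K"]
  by (simp add: algebra_simps)

lemma approaches_diff: "approaches F L \<Longrightarrow> approaches G K \<Longrightarrow> approaches (\<lambda>r. F r - G r) (L - K)"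
  unfolding approaches_def using sum_in_bigo(2)[of "\<lambda>r. F r - L" _ _ "\<lambda>r. G r - K"]
  by (simp add: algebra_simps)

lemma approaches_mult:
  assumes F: "approaches F L" and G: "approaches G K" shows "approaches (\<lambda>r. F r * G r) (L * K)"
proof -
  have "(\<lambda>r. (F r - L) * G r) \<in> O[at_left 1](\<lambda>r. (1 - r) * 1)"
    using F approaches_O1[OF G] unfolding approaches_def by (rule landau_o.big.mult)
  moreover have "(\<lambda>r. L * (G r - K)) \<in> O[at_left 1](\<lambda>r. 1 * (1 - r))"
    by (rule landau_o.big.mult[OF _ G[unfolded approaches_def]]) simp
  ultimately have "(\<lambda>r. (F r - L) * G r + L * (G r - K)) \<in> O[at_left 1](\<lambda>r. 1 - r)"
    unfolding mult_1 mult_1_right by (rule sum_in_bigo(1))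
  then show ?thesis unfolding approaches_def by (simp add: algebra_simps)
qed

lemma approaches_inverse:
  assumes F: "approaches F L" and L: "L \<noteq> 0" shows "approaches (\<lambda>r. inverse (F r)) (inverse L)"
proof -
  have lim: "((\<lambda>r. - inverse (F r) * inverse L) \<longlongrightarrow> - inverse L * inverse L) (at_left 1)"
    by (intro tendsto_intros approaches_tendsto[OF F] L)
  then have O: "(\<lambda>r. (F r - L) * (- inverse (F r) * inverse L)) \<in> O[at_left 1](\<lambda>r. (1 - r) * 1)"
    using F unfolding approaches_def by (intro landau_o.big.mult tendsto_imp_bounded)
  have "eventually (\<lambda>r. F r \<noteq> 0) (at_left 1)"
    using approaches_tendsto[OF F] L by (rule tendsto_imp_eventually_ne)
  then have "eventually (\<lambda>r. (F r - L) * (- inverse (F r) * inverse L) = inverse (F r) - inverse L) (at_left 1)"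
    by eventually_elim (use L in \<open>auto simp: field_simps\<close>)
  from iffD1[OF landau_o.big.in_cong[OF this] O] show ?thesis unfolding approaches_def mult_1_right .
qed

lemma approaches_divide:
  "approaches F L \<Longrightarrow> approaches G K \<Longrightarrow> K \<noteq> 0 \<Longrightarrow> approaches (\<lambda>r. F r / G r) (L / K)"
  unfolding divide_inverse by (intro approaches_mult approaches_inverse)

lemma approaches_power: "approaches F L \<Longrightarrow> approaches (\<lambda>r. F r ^ n) (L ^ n)"
  by (induction n) (auto intro: approaches_mult approaches_const)

lemmas approaches_intros = approaches_const approaches_id approaches_add approaches_diff
  approaches_mult approaches_divide approaches_power

section \<open>Densities that vanish to fourth order\<close>

text \<open>Vanishing at \<open>0\<close> to fourth order, measured by \<open>(1 - cos s)^2\<close>. Away from \<open>0\<close> only integrability is asked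
  for, through the weight \<open>w\<close>; the extra factor \<open>1 - cos s\<close> in front of \<open>w\<close> keeps the weight from
  spoiling the bound near \<open>0\<close>, where a merely integrable factor would cost the rate of convergence.\<close>

definition flat :: "(real \<Rightarrow> real) \<Rightarrow> bool" where
  "flat h \<longleftrightarrow> h \<in> borel_measurable arc \<and>
     (\<exists>C w. C \<ge> 0 \<and> integrable arc w \<and> (\<forall>s\<in>{-pi..pi}. 0 \<le> w s \<and>
        \<bar>h s\<bar> \<le> C * (1 - cos s)\<^sup>2 * (1 + (1 - cos s) * w s)))"

lemma flat_measurable: "flat h \<Longrightarrow> h \<in> borel_measurable arc" by (simp add: flat_def)

lemma flat_times_m: assumes "flat h" shows "flat (\<lambda>s. h s * (1 - cos s))"
proof -
  obtain C w where C: "C \<ge> 0" "integrable arc w" "\<And>s. s \<in> {-pi..pi} \<Longrightarrow> 0 \<le> w s"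
    "\<And>s. s \<in> {-pi..pi} \<Longrightarrow> \<bar>h s\<bar> \<le> C * (1 - cos s)\<^sup>2 * (1 + (1 - cos s) * w s)"
    using assms unfolding flat_def by blast
  have "\<bar>h s * (1 - cos s)\<bar> \<le> (2 * C) * (1 - cos s)\<^sup>2 * (1 + (1 - cos s) * w s)" if "s \<in> {-pi..pi}" for s
  proof -
    have c: "0 \<le> 1 - cos s" "1 - cos s \<le> 2" using cos_ge_minus_one[of s] by auto
    have "\<bar>h s * (1 - cos s)\<bar> = \<bar>h s\<bar> * (1 - cos s)" using c by (simp add: abs_mult)
    also have "\<dots> \<le> (C * (1 - cos s)\<^sup>2 * (1 + (1 - cos s) * w s)) * 2"
      using C that c by (intro mult_mono) auto
    finally show ?thesis by (simp add: algebra_simps)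
  qed
  moreover have "(\<lambda>s. h s * (1 - cos s)) \<in> borel_measurable arc"
    using flat_measurable[OF assms] by measurable
  ultimately show ?thesis using C unfolding flat_def
    by (intro conjI exI[of _ "2 * C"] exI[of _ w]) auto
qed

lemma flat_integrable_over_m:
  assumes "flat h" shows "integrable arc (\<lambda>s. h s / (1 - cos s)\<^sup>2)"
proof -
  obtain C w where C: "C \<ge> 0" "integrable arc w" "\<And>s. s \<in> {-pi..pi} \<Longrightarrow> 0 \<le> w s"
    "\<And>s. s \<in> {-pi..pi} \<Longrightarrow> \<bar>h s\<bar> \<le> C * (1 - cos s)\<^sup>2 * (1 + (1 - cos s) * w s)"
    using assms unfolding flat_def by blast
  show ?thesis
  proof (rule Bochner_Integration.integrable_bound)
    show "integrable arc (\<lambda>s. C * (1 + 2 * w s))" using C by simp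
    show "(\<lambda>s. h s / (1 - cos s)\<^sup>2) \<in> borel_measurable arc"
      using flat_measurable[OF assms] by measurable
    have "norm (h s / (1 - cos s)\<^sup>2) \<le> norm (C * (1 + 2 * w s))" if s: "s \<in> {-pi..pi}" for s
    proof (cases "cos s = 1")
      case False
      have c: "0 < 1 - cos s" "1 - cos s \<le> 2" using cos_ge_minus_one[of s] cos_le_one[of s] False by (auto simp: less_le)
      have "\<bar>h s\<bar> \<le> (C * (1 + (1 - cos s) * w s)) * (1 - cos s)\<^sup>2" using C(4)[OF s] by (simp add: ac_simps)
      also have "\<dots> \<le> (C * (1 + 2 * w s)) * (1 - cos s)\<^sup>2"
        using C(1) C(3)[OF s] c by (intro mult_right_mono mult_left_mono add_left_mono) auto
      finally show ?thesis using c C(1) C(3)[OF s] by (simp add: divide_le_eq)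
    qed (use C in auto)
    then show "AE s in arc. norm (h s / (1 - cos s)\<^sup>2) \<le> norm (C * (1 + 2 * w s))" by (intro AE_I2) auto
  qed
qed

lemma flat_integrable: assumes "flat h" shows "integrable arc h"
proof -
  obtain C w where C: "C \<ge> 0" "\<And>s. s \<in> {-pi..pi} \<Longrightarrow> \<bar>h s\<bar> \<le> C * (1 - cos s)\<^sup>2 * (1 + (1 - cos s) * w s)"
    using assms unfolding flat_def by blast
  have h0: "h s = 0" if "cos s = 1" "s \<in> {-pi..pi}" for s using C(2)[OF that(2)] that by simp
  show ?thesis
  proof (rule Bochner_Integration.integrable_bound)
    show "integrable arc (\<lambda>s. 4 * (h s / (1 - cos s)\<^sup>2))"
      by (intro integrable_mult_right flat_integrable_over_m assms)
    show "h \<in> borel_measurable arc" by (rule flat_measurable[OF assms])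
    have "norm (h s) \<le> norm (4 * (h s / (1 - cos s)\<^sup>2))" if "s \<in> {-pi..pi}" for s
    proof (cases "cos s = 1")
      case False
      have c: "0 < 1 - cos s" "1 - cos s \<le> 2" using cos_ge_minus_one[of s] cos_le_one[of s] False by (auto simp: less_le)
      have "(1 - cos s)\<^sup>2 \<le> 2\<^sup>2" using c by (intro power_mono) auto
      then have "\<bar>h s\<bar> * (1 - cos s)\<^sup>2 \<le> \<bar>h s\<bar> * 4" by (intro mult_left_mono) auto
      then show ?thesis using c by (simp add: field_simps abs_mult)
    qed (use h0 that in auto)
    then show "AE s in arc. norm (h s) \<le> norm (4 * (h s / (1 - cos s)\<^sup>2))" by (intro AE_I2) auto
  qed
qed

text \<open>With \<open>e = 1 - r\<close>, \<open>m = 1 - cos s\<close> and \<open>Q = pdenom r s\<close> one has \<open>2 m - Q = e (2 m - e)\<close>,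
  and both \<open>m\<close> and \<open>e^2\<close> are at most \<open>Q\<close>. Hence the integrand differs from its limit by at most a multiple of
  \<open>e + e^2 / Q + e w\<close>. The middle term is only bounded pointwise, but the Poisson integral
  of \<open>1 / Q\<close> is of order \<open>1 / e\<close>, so it too contributes order \<open>e\<close>.\<close>

lemma flat_over_pdenom_sq:
  assumes "flat h"
  shows "approaches (\<lambda>r. LINT s|arc. h s / (pdenom r s)\<^sup>2) ((LINT s|arc. h s / (1 - cos s)\<^sup>2) / 4)"
proof -
  obtain C w where C: "C \<ge> 0" "integrable arc w" "\<And>s. s \<in> {-pi..pi} \<Longrightarrow> 0 \<le> w s"
    "\<And>s. s \<in> {-pi..pi} \<Longrightarrow> \<bar>h s\<bar> \<le> C * (1 - cos s)\<^sup>2 * (1 + (1 - cos s) * w s)"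
    using assms unfolding flat_def by blast
  show ?thesis
  proof (rule approachesI)
    fix r :: real assume r: "1/2 \<le> r" "r < 1"
    define e where "e = 1 - r"
    have e: "0 < e" "e \<le> 1/2" using r by (auto simp: e_def)
    have int: "integrable arc (\<lambda>s. h s / (pdenom r s)\<^sup>2)"
      using flat_integrable[OF assms] r by (intro integrable_over_pdenom) auto
    have iq: "integrable arc (\<lambda>s. 1 / pdenom r s)" using integrable_inverse_pdenom(1)[of r] r by simp
    have pw: "\<bar>h s / (pdenom r s)\<^sup>2 - h s / (1 - cos s)\<^sup>2 / 4\<bar>
        \<le> C * (3/2 * e + 3/4 * e\<^sup>2 * (1 / pdenom r s) + 4 * e * w s)" if s: "s \<in> {-pi..pi}" for s
    proof (cases "cos s = 1")
      case True
      then have "h s = 0" using C(4)[OF s] by simp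
      moreover have "0 \<le> pdenom r s" using pdenom_pos[of r s] r by simp
      ultimately show ?thesis using C(1) C(3)[OF s] e by simp
    next
      case False
      define m where "m = 1 - cos s"
      define Q where "Q = pdenom r s"
      have m: "0 < m" "m \<le> 2" using cos_ge_minus_one[of s] cos_le_one[of s] False by (auto simp: m_def less_le)
      have Q: "Q = e\<^sup>2 + 2 * r * m" by (simp add: Q_def m_def e_def pdenom_eq)
      have Qpos: "Q > 0" using pdenom_pos[of r s] r by (simp add: Q_def)
      have "1 * m \<le> 2 * r * m" using r m by (intro mult_right_mono) auto
      then have mQ: "m \<le> Q" using Q by (smt (verit) zero_le_power2)
      have eQ: "e\<^sup>2 \<le> Q" using Q m r by simp
      have eq: "h s / Q\<^sup>2 - h s / m\<^sup>2 / 4 = h s / m\<^sup>2 * ((e * (2 * m - e)) * (2 * m + Q) / (4 * Q\<^sup>2))"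
      proof -
        have "e * (2 * m - e) = 2 * m - Q" unfolding Q by (simp add: e_def power2_eq_square algebra_simps)
        then have "(e * (2 * m - e)) * (2 * m + Q) = 4 * m\<^sup>2 - Q\<^sup>2"
          by (simp only:) (simp add: power2_eq_square algebra_simps)
        then have "(e * (2 * m - e)) * (2 * m + Q) / (4 * Q\<^sup>2) = m\<^sup>2 / Q\<^sup>2 - 1 / 4"
          using Qpos by (simp add: diff_divide_distrib)
        then show ?thesis using m by (simp only:) (simp add: right_diff_distrib)
      qed
      have b1: "\<bar>h s / m\<^sup>2\<bar> \<le> C * (1 + m * w s)"
        using C(4)[OF s] m by (simp add: m_def[symmetric] divide_le_eq ac_simps)
      have b2: "\<bar>(e * (2 * m - e)) * (2 * m + Q) / (4 * Q\<^sup>2)\<bar> \<le> e * (2 * m + e) * (3 * Q) / (4 * Q\<^sup>2)"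
      proof -
        have "\<bar>e * (2 * m - e) * (2 * m + Q)\<bar> \<le> e * (2 * m + e) * (3 * Q)"
          unfolding abs_mult using e m mQ Qpos by (intro mult_mono) auto
        then show ?thesis by (simp add: abs_divide divide_right_mono)
      qed
      also have "\<dots> = (3/2 * e * m + 3/4 * e\<^sup>2) / Q"
        using Qpos by (simp add: field_simps power2_eq_square)
      finally have b3: "\<bar>(e * (2 * m - e)) * (2 * m + Q) / (4 * Q\<^sup>2)\<bar> \<le> (3/2 * e * m + 3/4 * e\<^sup>2) / Q" .
      have "\<bar>h s / Q\<^sup>2 - h s / m\<^sup>2 / 4\<bar> \<le> (C * (1 + m * w s)) * ((3/2 * e * m + 3/4 * e\<^sup>2) / Q)"
        unfolding eq abs_mult[of "h s / m\<^sup>2"] using b1 b3 order_trans[OF abs_ge_zero b1] by (intro mult_mono) auto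
      also have "\<dots> = C * ((3/2 * e * (m / Q) + 3/4 * e\<^sup>2 * (1 / Q)) + w s * (m * (3/2 * e * (m / Q)) + m / Q * (3/4 * e\<^sup>2)))"
      proof -
        have "C * (1 + m * w') * (P + N * z) = C * ((P + N * z) + w' * (m * P + m * z * N))" for w' P N z :: real
          by (simp add: algebra_simps)
        from this[of "w s" "3/2 * e * (m / Q)" "3/4 * e\<^sup>2" "1 / Q"] show ?thesis
          by (simp add: add_divide_distrib)
      qed
      also have "\<dots> \<le> C * ((3/2 * e + 3/4 * e\<^sup>2 * (1 / Q)) + w s * (4 * e))"
      proof (intro mult_left_mono add_mono C(1) C(3) s order_refl)
        have mq1: "m / Q \<le> 1" "0 \<le> m / Q" using mQ Qpos m by auto
        show "3/2 * e * (m / Q) \<le> 3/2 * e" using mult_left_mono[OF mq1(1), of "3/2 * e"] e by simp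
        have "m * (3/2 * e * (m / Q)) \<le> 2 * (3/2 * e * 1)" using mq1 m e by (intro mult_mono mult_nonneg_nonneg) auto
        moreover have "m / Q * (3/4 * e\<^sup>2) \<le> 1 * (3/4 * e)"
          using mq1 e by (intro mult_mono) (auto simp: power2_eq_square mult_left_le)
        ultimately show "m * (3/2 * e * (m / Q)) + m / Q * (3/4 * e\<^sup>2) \<le> 4 * e" using e by linarith
      qed (use e in auto)
      finally show ?thesis by (simp add: m_def Q_def ac_simps)
    qed
    have "\<bar>(LINT s|arc. h s / (pdenom r s)\<^sup>2) - (LINT s|arc. h s / (1 - cos s)\<^sup>2) / 4\<bar>
        = \<bar>LINT s|arc. h s / (pdenom r s)\<^sup>2 - h s / (1 - cos s)\<^sup>2 / 4\<bar>"
      using int flat_integrable_over_m[OF assms]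
      by (subst Bochner_Integration.integral_diff) (auto simp only: integrable_divide integral_divide_zero)
    also have "\<dots> \<le> (LINT s|arc. \<bar>h s / (pdenom r s)\<^sup>2 - h s / (1 - cos s)\<^sup>2 / 4\<bar>)"
      by (rule integral_abs_bound)
    also have "\<dots> \<le> (LINT s|arc. C * (3/2 * e + 3/4 * e\<^sup>2 * (1 / pdenom r s) + 4 * e * w s))"
      using int flat_integrable_over_m[OF assms] iq C(2) pw
      by (intro integral_mono)
         (auto simp only: space_arc intro!: integrable_abs Bochner_Integration.integrable_diff Bochner_Integration.integrable_add integrable_mult_right integrable_divide integrable_arc_const)
    also have "\<dots> = C * (3/2 * e * (2 * pi) + 3/4 * e\<^sup>2 * (2 * pi / (1 - r\<^sup>2)) + 4 * e * (LINT s|arc. w s))"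
    proof -
      have "(LINT s|arc. C * (3/2 * e + 3/4 * e\<^sup>2 * (1 / pdenom r s) + 4 * e * w s))
          = C * ((LINT s|arc. 3/2 * e) + 3/4 * e\<^sup>2 * (LINT s|arc. 1 / pdenom r s) + 4 * e * (LINT s|arc. w s))"
        using iq C(2) by (simp only: Bochner_Integration.integral_add Bochner_Integration.integrable_add
            integrable_mult_right integral_mult_right_zero integrable_arc_const)
      also have "(LINT s|arc. 3/2 * e) = 3/2 * e * (2 * pi)" by simp
      also have "(LINT s|arc. 1 / pdenom r s) = 2 * pi / (1 - r\<^sup>2)" using integral_poisson[of r] r by simp
      finally show ?thesis .
    qed
    also have "\<dots> \<le> C * (3/2 * e * (2 * pi) + 3/4 * e * (2 * pi) + 4 * e * (LINT s|arc. w s))"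
    proof (intro mult_left_mono add_mono order_refl C(1))
      have "e\<^sup>2 / (1 - r\<^sup>2) \<le> e"
      proof -
        have "1 - r\<^sup>2 = e * (1 + r)" by (simp add: e_def power2_eq_square algebra_simps)
        then show ?thesis using e r by (simp add: power2_eq_square divide_le_eq)
      qed
      then show "3/4 * e\<^sup>2 * (2 * pi / (1 - r\<^sup>2)) \<le> 3/4 * e * (2 * pi)"
        using mult_left_mono[of "e\<^sup>2 / (1 - r\<^sup>2)" e "3/4 * (2 * pi)"]
        by (simp only: times_divide_eq_right times_divide_eq_left mult_ac) simp
    qed (use e in auto)
    also have "\<dots> = C * (3 * pi + 3/2 * pi + 4 * (LINT s|arc. w s)) * (1 - r)"
      by (simp add: e_def field_simps)
    finally show "\<bar>(LINT s|arc. h s / (pdenom r s)\<^sup>2) - (LINT s|arc. h s / (1 - cos s)\<^sup>2) / 4\<bar>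
       \<le> C * (3 * pi + 3/2 * pi + 4 * (LINT s|arc. w s)) * (1 - r)" .
  qed
qed

lemma approaches_rewrite: "approaches F L \<Longrightarrow> L = K \<Longrightarrow> approaches F K" by simp

lemma flat_cancel:
  "(LINT s|arc. (h s * (1 - cos s)) / (1 - cos s)\<^sup>2) = (LINT s|arc. h s / (1 - cos s))"
  by (intro Bochner_Integration.integral_cong refl) (auto simp: power2_eq_square)

text \<open>Multiplying by \<open>pdenom r s = (1 - r)^2 + 2 r (1 - cos s)\<close> reduces the first power of the denominator
  to the second one.\<close>

lemma flat_over_pdenom:
  assumes "flat h"
  shows "approaches (\<lambda>r. LINT s|arc. h s / pdenom r s) ((LINT s|arc. h s / (1 - cos s)) / 2)"
proof -
  have "approaches (\<lambda>r. (1 - r)\<^sup>2 * (LINT s|arc. h s / (pdenom r s)\<^sup>2) + 2 * r * (LINT s|arc. (h s * (1 - cos s)) / (pdenom r s)\<^sup>2))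
     ((1 - 1)\<^sup>2 * ((LINT s|arc. h s / (1 - cos s)\<^sup>2) / 4) + 2 * 1 * ((LINT s|arc. (h s * (1 - cos s)) / (1 - cos s)\<^sup>2) / 4))"
    by (intro approaches_intros flat_over_pdenom_sq flat_times_m assms)
  then have "approaches (\<lambda>r. (1 - r)\<^sup>2 * (LINT s|arc. h s / (pdenom r s)\<^sup>2) + 2 * r * (LINT s|arc. (h s * (1 - cos s)) / (pdenom r s)\<^sup>2))
     ((LINT s|arc. h s / (1 - cos s)) / 2)"
    by (rule approaches_rewrite) (simp add: flat_cancel)
  then show ?thesis
  proof (rule approaches_cong)
    fix r :: real assume r: "1/2 \<le> r" "r < 1"
    have pw: "h s / pdenom r s = (1 - r)\<^sup>2 * (h s / (pdenom r s)\<^sup>2) + 2 * r * ((h s * (1 - cos s)) / (pdenom r s)\<^sup>2)" for s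
    proof -
      have "pdenom r s \<noteq> 0" using pdenom_pos[of r s] r by simp
      then have "h s / pdenom r s = h s * pdenom r s / (pdenom r s)\<^sup>2" by (simp add: power2_eq_square)
      also have "\<dots> = h s * ((1 - r)\<^sup>2 + 2 * r * (1 - cos s)) / (pdenom r s)\<^sup>2" by (simp only: pdenom_eq[symmetric])
      also have "h s * ((1 - r)\<^sup>2 + 2 * r * (1 - cos s)) = (1 - r)\<^sup>2 * h s + 2 * r * (h s * (1 - cos s))"
        by (simp only: distrib_left mult_ac)
      finally show ?thesis by (simp only: add_divide_distrib times_divide_eq_right)
    qed
    have "integrable arc (\<lambda>s. h s / (pdenom r s)\<^sup>2)" "integrable arc (\<lambda>s. (h s * (1 - cos s)) / (pdenom r s)\<^sup>2)"
      using flat_integrable[OF assms] flat_integrable[OF flat_times_m[OF assms]] r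
      by (intro integrable_over_pdenom; simp)+
    then show "(1 - r)\<^sup>2 * (LINT s|arc. h s / (pdenom r s)\<^sup>2) + 2 * r * (LINT s|arc. (h s * (1 - cos s)) / (pdenom r s)\<^sup>2)
        = (LINT s|arc. h s / pdenom r s)"
      unfolding pw by (simp only: Bochner_Integration.integral_add integrable_mult_right integral_mult_right_zero)
  qed
qed

lemma flat_cos_over_pdenom_sq:
  assumes "flat h"
  shows "approaches (\<lambda>r. LINT s|arc. h s * (cos s - r) / (pdenom r s)\<^sup>2) (- (LINT s|arc. h s / (1 - cos s)) / 4)"
proof -
  have "approaches (\<lambda>r. (1 - r) * (LINT s|arc. h s / (pdenom r s)\<^sup>2) - (LINT s|arc. (h s * (1 - cos s)) / (pdenom r s)\<^sup>2))
     ((1 - 1) * ((LINT s|arc. h s / (1 - cos s)\<^sup>2) / 4) - ((LINT s|arc. (h s * (1 - cos s)) / (1 - cos s)\<^sup>2) / 4))"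
    by (intro approaches_intros flat_over_pdenom_sq flat_times_m assms)
  then have "approaches (\<lambda>r. (1 - r) * (LINT s|arc. h s / (pdenom r s)\<^sup>2) - (LINT s|arc. (h s * (1 - cos s)) / (pdenom r s)\<^sup>2))
     (- (LINT s|arc. h s / (1 - cos s)) / 4)"
    by (rule approaches_rewrite) (simp add: flat_cancel)
  then show ?thesis
  proof (rule approaches_cong)
    fix r :: real assume r: "1/2 \<le> r" "r < 1"
    have pw: "h s * (cos s - r) / (pdenom r s)\<^sup>2 = (1 - r) * (h s / (pdenom r s)\<^sup>2) - (h s * (1 - cos s)) / (pdenom r s)\<^sup>2" for s
    proof -
      have "h s * (cos s - r) = (1 - r) * h s - h s * (1 - cos s)" by (simp add: algebra_simps)
      then show ?thesis by (simp only: diff_divide_distrib times_divide_eq_right)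
    qed
    have "integrable arc (\<lambda>s. h s / (pdenom r s)\<^sup>2)" "integrable arc (\<lambda>s. (h s * (1 - cos s)) / (pdenom r s)\<^sup>2)"
      using flat_integrable[OF assms] flat_integrable[OF flat_times_m[OF assms]] r
      by (intro integrable_over_pdenom; simp)+
    then show "(1 - r) * (LINT s|arc. h s / (pdenom r s)\<^sup>2) - (LINT s|arc. (h s * (1 - cos s)) / (pdenom r s)\<^sup>2)
        = (LINT s|arc. h s * (cos s - r) / (pdenom r s)\<^sup>2)"
      unfolding pw by (simp only: Bochner_Integration.integral_diff integrable_mult_right integral_mult_right_zero)
  qed
qed

section \<open>Boundary behaviour of the intensity\<close>

lemma AE_arc_cos_neq: "AE s in arc. cos s \<noteq> 1"
  using AE_arc_cis_neq[of 1]
proof eventually_elim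
  case (elim s)
  show "cos s \<noteq> 1"
  proof
    assume "cos s = 1"
    moreover from this have "sin s = 0" using sin_cos_squared_add[of s] by simp
    ultimately show False using elim by (simp add: complex_eq_iff)
  qed
qed


lemma approaches_cong_ev:
  assumes "approaches F L" "eventually (\<lambda>r. F r = G r) (at_left 1)"
  shows "approaches G L"
proof -
  have "eventually (\<lambda>r. F r - L = G r - L) (at_left 1)"
    using assms(2) by eventually_elim simp
  from iffD1[OF landau_o.big.in_cong[OF this] assms(1)[unfolded approaches_def]]
  show ?thesis unfolding approaches_def .
qed

lemma eventually_half_one: "eventually (\<lambda>r::real. 1/2 < r \<and> r < 1) (at_left 1)"
  by (intro eventually_at_leftI[of "1/2"]) auto

lemma integral_cos_minus_r_over_pdenom_sq:
  assumes r: "0 \<le> r" "r < 1"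
  shows "(LINT s|arc. (cos s - r) / (pdenom r s)\<^sup>2) = 2 * pi * r / (1 - r\<^sup>2)\<^sup>2"
    and "integrable arc (\<lambda>s. (cos s - r) / (pdenom r s)\<^sup>2)"
proof -
  show int: "integrable arc (\<lambda>s. (cos s - r) / (pdenom r s)\<^sup>2)"
    by (rule integrable_over_pdenom[OF r]) (auto intro!: integrable_arc_continuous continuous_intros)
  have pw: "((1 + r\<^sup>2) * cos s - 2 * r) / (pdenom r s)\<^sup>2
     = (1 - r\<^sup>2) * ((cos s - r) / (pdenom r s)\<^sup>2) - r * (1 / pdenom r s)" for s
  proof -
    have q0: "pdenom r s \<noteq> 0" using pdenom_pos[OF r, of s] by simp
    have "(1 + r\<^sup>2) * cos s - 2 * r = (1 - r\<^sup>2) * (cos s - r) - r * pdenom r s"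
      unfolding pdenom_def by (simp add: power2_eq_square algebra_simps)
    then have "((1 + r\<^sup>2) * cos s - 2 * r) / (pdenom r s)\<^sup>2
        = (1 - r\<^sup>2) * ((cos s - r) / (pdenom r s)\<^sup>2) - r * (pdenom r s / (pdenom r s)\<^sup>2)"
      by (simp only:) (subst diff_divide_distrib, simp only: times_divide_eq_right)
    also have "pdenom r s / (pdenom r s)\<^sup>2 = 1 / pdenom r s" using q0 by (simp add: power2_eq_square)
    finally show ?thesis .
  qed
  have "0 = (1 - r\<^sup>2) * (LINT s|arc. (cos s - r) / (pdenom r s)\<^sup>2) - r * (LINT s|arc. 1 / pdenom r s)"
    using integral_poisson_derivative[OF r] unfolding pw using int integrable_inverse_pdenom(1)[OF r]
    by (simp only: Bochner_Integration.integral_diff integrable_mult_right integral_mult_right_zero)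
  then have e: "0 = (1 - r\<^sup>2) * (LINT s|arc. (cos s - r) / (pdenom r s)\<^sup>2) - r * (2 * pi / (1 - r\<^sup>2))"
    by (simp only: integral_poisson[OF r])
  have "X = 2 * pi * r / Y\<^sup>2" if "0 = Y * X - r * (2 * pi / Y)" "Y > 0" for X Y :: real
  proof -
    have "X = Y * X / Y" using that(2) by simp
    also have "Y * X = r * (2 * pi / Y)" using that(1) by simp
    also have "r * (2 * pi / Y) / Y = 2 * pi * r / Y\<^sup>2"
      by (simp add: power2_eq_square) 
    finally show ?thesis .
  qed
  from this[OF e y_pos[OF r]] show "(LINT s|arc. (cos s - r) / (pdenom r s)\<^sup>2) = 2 * pi * r / (1 - r\<^sup>2)\<^sup>2" .
qed

text \<open>The even part \<open>fh\<close> and the odd part \<open>fo\<close> of a density with prescribed jets at \<open>0\<close>. Only the product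
  of \<open>fo\<close> with \<open>sin\<close> occurs in the kernels, hence the shape of the second assumption.\<close>

locale boundary_expansion =
  fixes fh fo :: "real \<Rightarrow> real" and f0 a b :: real
  assumes flat_even: "flat (\<lambda>s. fh s - f0 - a * (1 - cos s))"
    and flat_odd: "flat (\<lambda>s. fo s * sin s - b * (sin s)\<^sup>2)"
begin

text \<open>The remainders \<open>R\<close>, \<open>S\<close> are flat. On a radius, \<open>A0\<close>, \<open>A2\<close> are the kernels \<open>K\<close>, \<open>K11\<close>, and \<open>A1\<close>,
  \<open>B1\<close> are the real and imaginary parts of \<open>K1\<close> up to a unimodular factor. The constant \<open>T1\<close> is
  \<open>I_op (T_op fh)\<close>.\<close>

definition "R s = fh s - f0 - a * (1 - cos s)"
definition "S s = fo s * sin s - b * (sin s)\<^sup>2"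
definition "A0 r = (LINT s|arc. fh s / pdenom r s)"
definition "A1 r = (LINT s|arc. fh s * (cos s - r) / (pdenom r s)\<^sup>2)"
definition "A2 r = (LINT s|arc. fh s / (pdenom r s)\<^sup>2)"
definition "B1 r = (LINT s|arc. fo s * sin s / (pdenom r s)\<^sup>2)"
definition "T1 = (LINT s|arc. (fh s - f0) / (1 - cos s)) / (2 * pi)"

lemma flat_R: "flat R" using flat_even by (simp add: R_def[abs_def])
lemma flat_S: "flat S" using flat_odd by (simp add: S_def[abs_def])

lemma T1_eq: "T1 = a + (LINT s|arc. R s / (1 - cos s)) / (2 * pi)"
proof -
  have int: "integrable arc (\<lambda>s. R s / (1 - cos s))"
    using flat_integrable_over_m[OF flat_times_m[OF flat_R]]
    by (rule Bochner_Integration.integrable_cong[THEN iffD1, rotated -1]) (auto simp: power2_eq_square)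
  have "(LINT s|arc. (fh s - f0) / (1 - cos s)) = (LINT s|arc. a + R s / (1 - cos s))"
  proof (rule integral_cong_AE)
    show "AE s in arc. (fh s - f0) / (1 - cos s) = a + R s / (1 - cos s)"
      using AE_arc_cos_neq by eventually_elim (simp add: R_def field_simps)
    show "(\<lambda>s. a + R s / (1 - cos s)) \<in> borel_measurable arc" using int by simp
    have "(\<lambda>s. (fh s - f0) / (1 - cos s)) = (\<lambda>s. (R s + a * (1 - cos s)) / (1 - cos s))" by (simp add: R_def)
    then show "(\<lambda>s. (fh s - f0) / (1 - cos s)) \<in> borel_measurable arc"
      using flat_measurable[OF flat_R] by simp
  qed
  also have "\<dots> = 2 * pi * a + (LINT s|arc. R s / (1 - cos s))" using int by simp
  finally show ?thesis by (simp add: T1_def add_divide_distrib)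
qed

context
  fixes r :: real
  assumes r: "0 < r" "r < 1"
begin

lemma r': "0 \<le> r" "r < 1" using r by auto

lemma int_R: "integrable arc (\<lambda>s. R s / pdenom r s)" "integrable arc (\<lambda>s. R s / (pdenom r s)\<^sup>2)"
  "integrable arc (\<lambda>s. R s * (cos s - r) / (pdenom r s)\<^sup>2)"
proof -
  show "integrable arc (\<lambda>s. R s / pdenom r s)" "integrable arc (\<lambda>s. R s / (pdenom r s)\<^sup>2)"
    using integrable_over_pdenom[OF r' flat_integrable[OF flat_R], of 1]
      integrable_over_pdenom[OF r' flat_integrable[OF flat_R], of 2] by simp_all
  have "integrable arc (\<lambda>s. (1 - r) * R s - R s * (1 - cos s))"
    by (intro Bochner_Integration.integrable_diff integrable_mult_right flat_integrable flat_R flat_times_m)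
  then have "integrable arc (\<lambda>s. R s * (cos s - r))" by (simp add: algebra_simps)
  from integrable_over_pdenom[OF r' this, of 2] show "integrable arc (\<lambda>s. R s * (cos s - r) / (pdenom r s)\<^sup>2)" .
qed

lemma int_m: "integrable arc (\<lambda>s. (1 - cos s) / pdenom r s)" "integrable arc (\<lambda>s. (1 - cos s) / (pdenom r s)\<^sup>2)"
  "integrable arc (\<lambda>s. (1 - cos s)\<^sup>2 / (pdenom r s)\<^sup>2)"
  using integrable_cos_over_pdenom[OF r, of 1 1] integrable_cos_over_pdenom[OF r, of 1 2] integrable_cos_over_pdenom[OF r, of 2 2]
  by simp_all

lemma fh_eq: "fh s = f0 + a * (1 - cos s) + R s" by (simp add: R_def)

lemma A0_eq: "A0 r = f0 * (2 * pi / (1 - r\<^sup>2)) + a * (2 * pi / (1 + r)) + (LINT s|arc. R s / pdenom r s)"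
proof -
  have pw: "fh s / pdenom r s = f0 * (1 / pdenom r s) + a * ((1 - cos s) / pdenom r s) + R s / pdenom r s" for s
    by (simp add: fh_eq add_divide_distrib)
  show ?thesis unfolding A0_def pw
    using integrable_inverse_pdenom(1)[OF r'] int_m int_R
    by (simp only: Bochner_Integration.integral_add Bochner_Integration.integrable_add integrable_mult_right integral_mult_right_zero
        integral_poisson[OF r'] integral_m_over_pdenom[OF r])
qed

lemma A2_eq: "A2 r = f0 * (LINT s|arc. 1 / (pdenom r s)\<^sup>2) + a * (2 * pi / ((1 + r)\<^sup>2 * (1 - r\<^sup>2))) + (LINT s|arc. R s / (pdenom r s)\<^sup>2)"
proof -
  have pw: "fh s / (pdenom r s)\<^sup>2 = f0 * (1 / (pdenom r s)\<^sup>2) + a * ((1 - cos s) / (pdenom r s)\<^sup>2) + R s / (pdenom r s)\<^sup>2" for s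
    by (simp add: fh_eq add_divide_distrib)
  show ?thesis unfolding A2_def pw
    using integrable_inverse_pdenom(2)[OF r'] int_m int_R
    by (simp only: Bochner_Integration.integral_add Bochner_Integration.integrable_add integrable_mult_right integral_mult_right_zero
        integral_m_over_pdenom_sq[OF r])
qed

lemma m_cos_integral: "(LINT s|arc. (1 - cos s) * (cos s - r) / (pdenom r s)\<^sup>2) = - pi / (1 + r)\<^sup>2"
  "integrable arc (\<lambda>s. (1 - cos s) * (cos s - r) / (pdenom r s)\<^sup>2)"
proof -
  have pw: "(1 - cos s) * (cos s - r) / (pdenom r s)\<^sup>2 = (1 - r) * ((1 - cos s) / (pdenom r s)\<^sup>2) - (1 - cos s)\<^sup>2 / (pdenom r s)\<^sup>2" for s
  proof -
    have "(1 - cos s) * (cos s - r) = (1 - r) * (1 - cos s) - (1 - cos s)\<^sup>2"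
      by (simp add: power2_eq_square algebra_simps)
    then show ?thesis by (simp only:) (subst diff_divide_distrib, simp only: times_divide_eq_right)
  qed
  show "integrable arc (\<lambda>s. (1 - cos s) * (cos s - r) / (pdenom r s)\<^sup>2)"
    unfolding pw using int_m by (intro Bochner_Integration.integrable_diff integrable_mult_right)
  have "(LINT s|arc. (1 - cos s) * (cos s - r) / (pdenom r s)\<^sup>2)
      = (1 - r) * (2 * pi / ((1 + r)\<^sup>2 * (1 - r\<^sup>2))) - pi * (3 + r) / (1 + r) ^ 3"
    unfolding pw using int_m
    by (simp only: Bochner_Integration.integral_diff integrable_mult_right integral_mult_right_zero
        integral_m_over_pdenom_sq[OF r] integral_m2_over_pdenom_sq[OF r])
  also have "\<dots> = - pi / (1 + r)\<^sup>2"
  proof -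
    have "d * (2 * pi / (p\<^sup>2 * (d * p))) - pi * (3 + r) / p ^ 3 = - pi / p\<^sup>2"
      if "d \<noteq> 0" "p \<noteq> 0" "2 - (3 + r) = - p" for d p :: real
    proof -
      have "d * (2 * pi / (p\<^sup>2 * (d * p))) = 2 * pi / p ^ 3"
        using that(1,2) by (simp add: power2_eq_square power3_eq_cube mult.assoc)
      then have "d * (2 * pi / (p\<^sup>2 * (d * p))) - pi * (3 + r) / p ^ 3 = pi * (2 - (3 + r)) / p ^ 3"
        by (simp only: diff_divide_distrib[symmetric]) (simp add: algebra_simps)
      then show ?thesis unfolding that(3) using that(2) by (simp add: power2_eq_square power3_eq_cube)
    qed
    from this[of "1 - r" "1 + r"] show ?thesis using r
      by (simp add: power2_eq_square algebra_simps)
  qed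
  finally show "(LINT s|arc. (1 - cos s) * (cos s - r) / (pdenom r s)\<^sup>2) = - pi / (1 + r)\<^sup>2" .
qed

lemma A1_eq: "A1 r = f0 * (2 * pi * r / (1 - r\<^sup>2)\<^sup>2) + a * (- pi / (1 + r)\<^sup>2) + (LINT s|arc. R s * (cos s - r) / (pdenom r s)\<^sup>2)"
proof -
  have pw: "fh s * (cos s - r) / (pdenom r s)\<^sup>2 = f0 * ((cos s - r) / (pdenom r s)\<^sup>2)
     + a * ((1 - cos s) * (cos s - r) / (pdenom r s)\<^sup>2) + R s * (cos s - r) / (pdenom r s)\<^sup>2" for s
    by (simp only: fh_eq distrib_right add_divide_distrib times_divide_eq_right mult.assoc)
  show ?thesis unfolding A1_def pw
    using integral_cos_minus_r_over_pdenom_sq(2)[OF r'] m_cos_integral(2) int_R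
    by (simp only: Bochner_Integration.integral_add Bochner_Integration.integrable_add integrable_mult_right integral_mult_right_zero
        integral_cos_minus_r_over_pdenom_sq(1)[OF r'] m_cos_integral(1))
qed

lemma B1_eq: "B1 r = b * (pi / (1 - r\<^sup>2)) + (LINT s|arc. S s / (pdenom r s)\<^sup>2)"
proof -
  have pw: "fo s * sin s / (pdenom r s)\<^sup>2 = b * ((sin s)\<^sup>2 / (pdenom r s)\<^sup>2) + S s / (pdenom r s)\<^sup>2" for s
    by (simp add: S_def add_divide_distrib[symmetric])
  have "integrable arc (\<lambda>s. (sin s)\<^sup>2 / (pdenom r s)\<^sup>2)"
    by (rule integrable_over_pdenom[OF r']) (auto intro!: integrable_arc_continuous continuous_intros)
  moreover have "integrable arc (\<lambda>s. S s / (pdenom r s)\<^sup>2)"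
    by (rule integrable_over_pdenom[OF r' flat_integrable[OF flat_S]])
  ultimately show ?thesis unfolding B1_def pw
    by (simp only: Bochner_Integration.integral_add integrable_mult_right integral_mult_right_zero
        integral_sin2_over_pdenom_sq[OF r])
qed

text \<open>The Poisson integral \<open>(1 - |z|^2) K z\<close> is harmonic; this is its radial form, and pointwise it is the
  identity \<open>1 - r^2 = pdenom r s + 2 r (cos s - r)\<close>.\<close>

lemma A2_recursion: "(1 - r\<^sup>2) * A2 r = A0 r + 2 * r * A1 r"
proof -
  have pw: "(1 - r\<^sup>2) * (fh s / (pdenom r s)\<^sup>2) = fh s / pdenom r s + 2 * r * (fh s * (cos s - r) / (pdenom r s)\<^sup>2)" for s
  proof -
    have q0: "pdenom r s \<noteq> 0" using pdenom_pos[OF r', of s] by simp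
    have "(1 - r\<^sup>2) * fh s = fh s * pdenom r s + 2 * r * (fh s * (cos s - r))"
      by (simp add: pdenom_def power2_eq_square algebra_simps)
    then have "(1 - r\<^sup>2) * (fh s / (pdenom r s)\<^sup>2) = fh s * pdenom r s / (pdenom r s)\<^sup>2 + 2 * r * (fh s * (cos s - r) / (pdenom r s)\<^sup>2)"
      by (simp only: times_divide_eq_right add_divide_distrib)
    also have "fh s * pdenom r s / (pdenom r s)\<^sup>2 = fh s / pdenom r s" using q0 by (simp add: power2_eq_square)
    finally show ?thesis .
  qed
  have ifh: "integrable arc fh"
  proof -
    have "integrable arc (\<lambda>s. f0 + a * (1 - cos s))"
      by (intro integrable_arc_continuous continuous_intros)
    then have "integrable arc (\<lambda>s. f0 + a * (1 - cos s) + R s)"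
      by (rule Bochner_Integration.integrable_add) (rule flat_integrable[OF flat_R])
    then show ?thesis by (simp add: R_def)
  qed
  have icos: "integrable arc (\<lambda>s. fh s * (cos s - r))"
  proof (rule Bochner_Integration.integrable_bound)
    show "integrable arc (\<lambda>s. 2 * fh s)" using ifh by simp
    show "(\<lambda>s. fh s * (cos s - r)) \<in> borel_measurable arc" using ifh by measurable
    have "\<bar>cos s - r\<bar> \<le> 2" for s
      using cos_ge_minus_one[of s] cos_le_one[of s] r unfolding abs_le_iff by linarith
    then have "norm (fh s * (cos s - r)) \<le> norm (2 * fh s)" for s
      using mult_left_mono[of "\<bar>cos s - r\<bar>" 2 "\<bar>fh s\<bar>"] by (simp add: abs_mult mult.commute)
    then show "AE s in arc. norm (fh s * (cos s - r)) \<le> norm (2 * fh s)" by simp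
  qed
  have "integrable arc (\<lambda>s. fh s / pdenom r s)" using integrable_over_pdenom[OF r' ifh, of 1] by simp
  moreover have "integrable arc (\<lambda>s. fh s * (cos s - r) / (pdenom r s)\<^sup>2)"
    by (rule integrable_over_pdenom[OF r' icos])
  moreover have "(1 - r\<^sup>2) * A2 r = (LINT s|arc. (1 - r\<^sup>2) * (fh s / (pdenom r s)\<^sup>2))"
    by (simp only: A2_def integral_mult_right_zero)
  ultimately show ?thesis unfolding pw A0_def A1_def
    by (simp only: Bochner_Integration.integral_add integrable_mult_right integral_mult_right_zero)
qed

end

abbreviation "Y r \<equiv> 1 - (r::real)\<^sup>2"
text \<open>The value of \<open>intensity\<close> on the radius.\<close>

definition "zero_density r = (A2 r * A0 r - (A1 r)\<^sup>2 - (B1 r)\<^sup>2) / (A0 r)\<^sup>2"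

lemma approaches_Y: "approaches Y 0"
  by (rule approaches_rewrite[of _ "1 - 1\<^sup>2"]) (intro approaches_intros, simp)

text \<open>By \<open>A2_recursion\<close> the quotient is \<open>1 / (1 - r^2)^2 - |D + i Y B1|^2 / (Y A0)^2\<close>, where, up to
  constant factors, \<open>Y A0\<close> is the Poisson integral of the density and \<open>D\<close>, \<open>Y B1\<close> are the
  components of its gradient. In \<open>D\<close> the terms
  that come from \<open>f0\<close> cancel identically.\<close>

lemma density_interior:
  assumes f0: "f0 > 0"
  shows "approaches (\<lambda>r. zero_density r - 1 / (Y r)\<^sup>2) (- (1 / (4 * f0\<^sup>2) * (b\<^sup>2 + T1\<^sup>2)))"
proof -
  define D where "D r = Y r * A1 r - r * A0 r" for r
  have u: "approaches (\<lambda>r. Y r * A0 r) (2 * pi * f0)"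
  proof (rule approaches_cong)
    show "approaches (\<lambda>r. f0 * (2 * pi) + Y r * (a * (2 * pi / (1 + r)) + (LINT s|arc. R s / pdenom r s))) (2 * pi * f0)"
      by (rule approaches_rewrite[of _ "f0 * (2 * pi) + 0 * (a * (2 * pi / (1 + 1)) + (LINT s|arc. R s / (1 - cos s)) / 2)"])
         (intro approaches_intros approaches_Y flat_over_pdenom flat_R, simp_all)
    fix r :: real assume r: "1/2 \<le> r" "r < 1"
    then show "f0 * (2 * pi) + Y r * (a * (2 * pi / (1 + r)) + (LINT s|arc. R s / pdenom r s)) = Y r * A0 r"
      using A0_eq[of r] y_pos[of r] by (simp add: distrib_left)
  qed
  have d: "approaches D (- pi * T1)"
  proof (rule approaches_cong)
    show "approaches (\<lambda>r. - pi * a + (Y r * (LINT s|arc. R s * (cos s - r) / (pdenom r s)\<^sup>2) - r * (LINT s|arc. R s / pdenom r s))) (- pi * T1)"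
      by (rule approaches_rewrite[of _ "- pi * a + (0 * (- (LINT s|arc. R s / (1 - cos s)) / 4) - 1 * ((LINT s|arc. R s / (1 - cos s)) / 2))"])
         (intro approaches_intros approaches_Y flat_over_pdenom flat_cos_over_pdenom_sq flat_R, simp add: T1_eq distrib_left)
    fix r :: real assume r: "1/2 \<le> r" "r < 1"
    define X1 X2 where "X1 = (LINT s|arc. R s * (cos s - r) / (pdenom r s)\<^sup>2)" and "X2 = (LINT s|arc. R s / pdenom r s)"
    have r0: "0 < r" "r < 1" using r by auto
    have y0: "Y r \<noteq> 0" using y_pos[of r] r by simp
    have "D r = f0 * (Y r * (2 * pi * r / (Y r)\<^sup>2) - r * (2 * pi / Y r))
       + a * (Y r * (- pi / (1 + r)\<^sup>2) - r * (2 * pi / (1 + r))) + (Y r * X1 - r * X2)"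
      unfolding D_def A0_eq[OF r0] A1_eq[OF r0] X1_def[symmetric] X2_def[symmetric] by (simp add: distrib_left right_diff_distrib mult_ac)
    also have "Y r * (2 * pi * r / (Y r)\<^sup>2) - r * (2 * pi / Y r) = 0"
      using y0 by (simp add: power2_eq_square[of "Y r"])
    also have "Y r * (- pi / (1 + r)\<^sup>2) - r * (2 * pi / (1 + r)) = - pi"
    proof -
      have "(1 - r) * p * (- pi / p\<^sup>2) - r * (2 * pi / p) = - pi * ((1 - r + 2 * r) / p)" if "p \<noteq> 0" for p
        using that by (simp add: power2_eq_square add_divide_distrib diff_divide_distrib algebra_simps)
      from this[of "1 + r"] show ?thesis using r by (simp add: power2_eq_square algebra_simps)
    qed
    finally show "- pi * a + (Y r * (LINT s|arc. R s * (cos s - r) / (pdenom r s)\<^sup>2) - r * (LINT s|arc. R s / pdenom r s)) = D r"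
      by (simp add: X1_def X2_def)
  qed
  have bb: "approaches (\<lambda>r. Y r * B1 r) (pi * b)"
  proof (rule approaches_cong)
    show "approaches (\<lambda>r. b * pi + Y r * (LINT s|arc. S s / (pdenom r s)\<^sup>2)) (pi * b)"
      by (rule approaches_rewrite[of _ "b * pi + 0 * ((LINT s|arc. S s / (1 - cos s)\<^sup>2) / 4)"])
         (intro approaches_intros approaches_Y flat_over_pdenom_sq flat_S, simp)
    fix r :: real assume r: "1/2 \<le> r" "r < 1"
    then show "b * pi + Y r * (LINT s|arc. S s / (pdenom r s)\<^sup>2) = Y r * B1 r"
      using B1_eq[of r] y_pos[of r] by (simp add: distrib_left)
  qed
  have "approaches (\<lambda>r. 0 - ((D r)\<^sup>2 + (Y r * B1 r)\<^sup>2) / (Y r * A0 r)\<^sup>2)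
     (0 - ((- pi * T1)\<^sup>2 + (pi * b)\<^sup>2) / (2 * pi * f0)\<^sup>2)"
    by (intro approaches_intros d u bb) (use f0 in auto)
  then have "approaches (\<lambda>r. 0 - ((D r)\<^sup>2 + (Y r * B1 r)\<^sup>2) / (Y r * A0 r)\<^sup>2)
     (- (1 / (4 * f0\<^sup>2) * (b\<^sup>2 + T1\<^sup>2)))"
  proof (rule approaches_rewrite)
    have "((- pi * T1)\<^sup>2 + (pi * b)\<^sup>2) / (2 * pi * f0)\<^sup>2 = pi\<^sup>2 * (b\<^sup>2 + T1\<^sup>2) / (pi\<^sup>2 * (4 * f0\<^sup>2))"
      by (simp add: power_mult_distrib distrib_left add.commute)
    then show "0 - ((- pi * T1)\<^sup>2 + (pi * b)\<^sup>2) / (2 * pi * f0)\<^sup>2 = - (1 / (4 * f0\<^sup>2) * (b\<^sup>2 + T1\<^sup>2))"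
      by simp
  qed
  then show ?thesis
  proof (rule approaches_cong_ev)
    have "eventually (\<lambda>r. Y r * A0 r \<noteq> 0) (at_left 1)"
      using approaches_tendsto[OF u] by (rule tendsto_imp_eventually_ne) (use f0 in auto)
    then show "eventually (\<lambda>r. 0 - ((D r)\<^sup>2 + (Y r * B1 r)\<^sup>2) / (Y r * A0 r)\<^sup>2 = zero_density r - 1 / (Y r)\<^sup>2) (at_left 1)"
      using eventually_half_one
    proof eventually_elim
      case (elim r)
      define y where "y = Y r"
      have r: "0 < r" "r < 1" and nz: "y \<noteq> 0" "A0 r \<noteq> 0" using elim by (auto simp: y_def)
      have yr: "y + r\<^sup>2 = 1" "y * A1 r - r * A0 r = D r" by (simp_all add: y_def D_def)
      have "y\<^sup>2 * (A2 r * A0 r - (A1 r)\<^sup>2 - (B1 r)\<^sup>2) = y * (y * A2 r) * A0 r - (y * A1 r)\<^sup>2 - (y * B1 r)\<^sup>2"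
        by (simp add: power2_eq_square algebra_simps)
      also have "y * A2 r = A0 r + 2 * r * A1 r" unfolding y_def by (rule A2_recursion[OF r])
      also have "y * (A0 r + 2 * r * A1 r) * A0 r - (y * A1 r)\<^sup>2 - (y * B1 r)\<^sup>2
          = (y + r\<^sup>2) * (A0 r)\<^sup>2 - (y * A1 r - r * A0 r)\<^sup>2 - (y * B1 r)\<^sup>2"
        by (simp add: power2_eq_square algebra_simps)
      also have "\<dots> = (A0 r)\<^sup>2 - (D r)\<^sup>2 - (y * B1 r)\<^sup>2" by (simp only: yr mult_1)
      finally have key: "y\<^sup>2 * (A2 r * A0 r - (A1 r)\<^sup>2 - (B1 r)\<^sup>2) = (A0 r)\<^sup>2 - ((D r)\<^sup>2 + (y * B1 r)\<^sup>2)" by simp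
      have "zero_density r = y\<^sup>2 * (A2 r * A0 r - (A1 r)\<^sup>2 - (B1 r)\<^sup>2) / (y * A0 r)\<^sup>2"
        using nz by (simp add: zero_density_def power_mult_distrib)
      also have "\<dots> = 1 / y\<^sup>2 - ((D r)\<^sup>2 + (y * B1 r)\<^sup>2) / (y * A0 r)\<^sup>2"
        unfolding key diff_divide_distrib using nz by (simp add: power_mult_distrib)
      finally show ?case by (simp add: y_def)
    qed
  qed
qed

context
  assumes f0: "f0 = 0" and b: "b = 0" and T1: "T1 \<noteq> 0"
begin

lemma A0_limit: "approaches A0 (pi * T1)"
proof (rule approaches_cong)
  show "approaches (\<lambda>r. a * (2 * pi / (1 + r)) + (LINT s|arc. R s / pdenom r s)) (pi * T1)"
    by (rule approaches_rewrite[of _ "a * (2 * pi / (1 + 1)) + (LINT s|arc. R s / (1 - cos s)) / 2"])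
       (intro approaches_intros flat_over_pdenom flat_R, simp_all add: T1_eq distrib_left)
qed (use A0_eq f0 in auto)

lemma A1_limit: "approaches A1 (a * (- pi / 4) + (- (LINT s|arc. R s / (1 - cos s)) / 4))"
proof (rule approaches_cong)
  show "approaches (\<lambda>r. a * (- pi / (1 + r)\<^sup>2) + (LINT s|arc. R s * (cos s - r) / (pdenom r s)\<^sup>2))
     (a * (- pi / 4) + (- (LINT s|arc. R s / (1 - cos s)) / 4))"
    by (rule approaches_rewrite[of _ "a * (- pi / (1 + 1)\<^sup>2) + (- (LINT s|arc. R s / (1 - cos s)) / 4)"])
       (intro approaches_intros flat_cos_over_pdenom_sq flat_R, simp_all)
qed (use A1_eq f0 in auto)

lemma B1_limit: "approaches B1 ((LINT s|arc. S s / (1 - cos s)\<^sup>2) / 4)"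
  by (rule approaches_cong[OF flat_over_pdenom_sq[OF flat_S]]) (use B1_eq b in auto)

text \<open>Only \<open>A2\<close> blows up, through the exact integral of \<open>(1 - cos s) / (pdenom r s)^2\<close>.\<close>

lemma density_boundary_zero: "(\<lambda>r. zero_density r - 1 / Y r * (a / (2 * T1))) \<in> O[at_left 1](\<lambda>_. 1)"
proof -
  have nz: "pi * T1 \<noteq> 0" using T1 by simp
  define G where "G r = a * (2 * pi / ((1 + r)\<^sup>2 * A0 r)) - a / (2 * T1)" for r
  have "approaches (\<lambda>r. a * (2 * pi / ((1 + r)\<^sup>2 * A0 r))) (a * (2 * pi / ((1 + 1)\<^sup>2 * (pi * T1))))"
    by (intro approaches_intros A0_limit) (use nz in auto)
  then have "approaches (\<lambda>r. a * (2 * pi / ((1 + r)\<^sup>2 * A0 r))) (a / (2 * T1))"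
    by (rule approaches_rewrite) simp
  then have "G \<in> O[at_left 1](\<lambda>r. 1 - r)" by (simp add: approaches_def G_def[abs_def])
  moreover have "(\<lambda>r::real. 1 / (1 + r)) \<in> O[at_left 1](\<lambda>_. 1)"
    by (rule approaches_O1[of _ "1 / (1 + 1)"]) (intro approaches_intros, simp)
  moreover have "(\<lambda>r::real. 1 / (1 - r)) \<in> O[at_left 1](\<lambda>r. 1 / (1 - r))" by simp
  ultimately have "(\<lambda>r. G r * ((1 / (1 + r)) * (1 / (1 - r)))) \<in> O[at_left 1](\<lambda>r. (1 - r) * (1 * (1 / (1 - r))))"
    by (intro landau_o.big.mult)
  also have "(\<lambda>r. (1 - r) * (1 * (1 / (1 - r)))) \<in> O[at_left 1](\<lambda>_. 1 :: real)"
    by (rule bigoI[of _ 1]) (auto intro!: always_eventually)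
  finally have O1: "(\<lambda>r. G r * ((1 / (1 + r)) * (1 / (1 - r)))) \<in> O[at_left 1](\<lambda>_. 1)" .
  have "approaches (\<lambda>r. (LINT s|arc. R s / (pdenom r s)\<^sup>2) / A0 r - ((A1 r)\<^sup>2 + (B1 r)\<^sup>2) / (A0 r)\<^sup>2)
     ((LINT s|arc. R s / (1 - cos s)\<^sup>2) / 4 / (pi * T1) - ((a * (- pi / 4) + (- (LINT s|arc. R s / (1 - cos s)) / 4))\<^sup>2
       + ((LINT s|arc. S s / (1 - cos s)\<^sup>2) / 4)\<^sup>2) / (pi * T1)\<^sup>2)"
    by (intro approaches_intros A0_limit A1_limit B1_limit flat_over_pdenom_sq flat_R) (use nz in auto)
  from sum_in_bigo(1)[OF O1 approaches_O1[OF this]]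
  have O2: "(\<lambda>r. G r * ((1 / (1 + r)) * (1 / (1 - r))) + ((LINT s|arc. R s / (pdenom r s)\<^sup>2) / A0 r - ((A1 r)\<^sup>2 + (B1 r)\<^sup>2) / (A0 r)\<^sup>2)) \<in> O[at_left 1](\<lambda>_. 1)" .
  have "eventually (\<lambda>r. A0 r \<noteq> 0) (at_left 1)"
    using approaches_tendsto[OF A0_limit] nz by (rule tendsto_imp_eventually_ne)
  then have "eventually (\<lambda>r. G r * ((1 / (1 + r)) * (1 / (1 - r))) + ((LINT s|arc. R s / (pdenom r s)\<^sup>2) / A0 r - ((A1 r)\<^sup>2 + (B1 r)\<^sup>2) / (A0 r)\<^sup>2)
      = zero_density r - 1 / Y r * (a / (2 * T1))) (at_left 1)"
    using eventually_half_one
  proof eventually_elim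
    case (elim r)
    have r: "0 < r" "r < 1" using elim by auto
    have Y: "Y r = (1 - r) * (1 + r)" by (simp add: power2_eq_square algebra_simps)
    have "zero_density r = A2 r / A0 r - ((A1 r)\<^sup>2 + (B1 r)\<^sup>2) / (A0 r)\<^sup>2"
      using elim by (simp add: zero_density_def diff_divide_distrib add_divide_distrib power2_eq_square)
    also have "A2 r / A0 r = a * (2 * pi / ((1 + r)\<^sup>2 * A0 r)) * (1 / Y r) + (LINT s|arc. R s / (pdenom r s)\<^sup>2) / A0 r"
      unfolding A2_eq[OF r] f0 by (simp add: add_divide_distrib ac_simps)
    also have "a * (2 * pi / ((1 + r)\<^sup>2 * A0 r)) * (1 / Y r) = G r * (1 / Y r) + 1 / Y r * (a / (2 * T1))"
      unfolding G_def left_diff_distrib by (simp only: mult.commute[of "1 / Y r"])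
    finally show ?case by (simp add: Y)
  qed
  from iffD1[OF landau_o.big.in_cong[OF this] O2] show ?thesis .
qed

text \<open>All four integrals now converge. In the limit \<open>A0 = -2 A1\<close>, which is why a single combination of
  squares remains.\<close>

lemma density_boundary_double_zero:
  assumes a: "a = 0"
  shows "approaches zero_density ((((LINT s|arc. R s / (1 - cos s)\<^sup>2) / (2 * pi))\<^sup>2
     - ((LINT s|arc. R s / (1 - cos s)\<^sup>2) / (2 * pi) - T1)\<^sup>2
     - ((LINT s|arc. S s / (1 - cos s)\<^sup>2) / (2 * pi))\<^sup>2) / (4 * T1\<^sup>2))"
proof -
  define U V W where "U = (LINT s|arc. R s / (1 - cos s)\<^sup>2)" and "V = (LINT s|arc. R s / (1 - cos s))"
    and "W = (LINT s|arc. S s / (1 - cos s)\<^sup>2)"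
  have nz: "pi * T1 \<noteq> 0" using T1 by simp
  have V: "V = 2 * pi * T1" using T1_eq a by (simp add: V_def)
  have A2: "approaches A2 (U / 4)"
    unfolding U_def by (rule approaches_cong[OF flat_over_pdenom_sq[OF flat_R]]) (use A2_eq f0 a in auto)
  have A1: "approaches A1 (- V / 4)" using A1_limit a by (simp add: V_def)
  have "approaches zero_density ((U / 4 * (pi * T1) - (- V / 4)\<^sup>2 - (W / 4)\<^sup>2) / (pi * T1)\<^sup>2)"
    unfolding zero_density_def[abs_def] W_def by (intro approaches_intros A0_limit A1 A2 B1_limit) (use nz in auto)
  then have "approaches zero_density (((U / (2 * pi))\<^sup>2 - (U / (2 * pi) - T1)\<^sup>2 - (W / (2 * pi))\<^sup>2) / (4 * T1\<^sup>2))"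
  proof (rule approaches_rewrite)
    define u w where "u = U / (2 * pi)" and "w = W / (2 * pi)"
    have U: "U = 2 * pi * u" and W: "W = 2 * pi * w" by (auto simp: u_def w_def)
    have eq: "U / 4 * (pi * T1) - (- V / 4)\<^sup>2 - (W / 4)\<^sup>2 = (pi\<^sup>2 / 4) * (u\<^sup>2 - (u - T1)\<^sup>2 - w\<^sup>2)"
      unfolding U W V by (simp add: power2_eq_square algebra_simps)
    have cancel: "(pi\<^sup>2 / 4) * X / (pi * T1)\<^sup>2 = X / (4 * T1\<^sup>2)" for X
      by (simp add: power_mult_distrib)
    show "(U / 4 * (pi * T1) - (- V / 4)\<^sup>2 - (W / 4)\<^sup>2) / (pi * T1)\<^sup>2
       = ((U / (2 * pi))\<^sup>2 - (U / (2 * pi) - T1)\<^sup>2 - (W / (2 * pi))\<^sup>2) / (4 * T1\<^sup>2)"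
      unfolding eq u_def[symmetric] w_def[symmetric] by (rule cancel)
  qed
  then show ?thesis by (simp add: U_def W_def)
qed

end
end

section \<open>Radial restriction of the kernel\<close>

lemma cis_wrap: "cis (wrap x) = cis x"
proof -
  have "cis (wrap x) = cis x * cis (2 * pi * of_int (- \<lceil>(x - pi) / (2 * pi)\<rceil>))"
    unfolding cis_mult wrap_def by simp
  also have "cis (2 * pi * of_int (- \<lceil>(x - pi) / (2 * pi)\<rceil>)) = 1"
    by (rule cis_multiple_2pi) simp
  finally show ?thesis by simp
qed

lemma wrap_range: "wrap x \<in> {-pi<..pi}"
proof -
  define c where "c = of_int \<lceil>(x - pi) / (2 * pi)\<rceil> - (x - pi) / (2 * pi)"
  have c: "0 \<le> c" "c < 1" unfolding c_def by linarith+
  have "wrap x = pi - 2 * pi * c" by (simp add: wrap_def c_def field_simps)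
  moreover have "2 * pi * c < 2 * pi * 1" using c by (intro mult_strict_left_mono) auto
  moreover have "0 \<le> 2 * pi * c" using c by simp
  ultimately show ?thesis by auto
qed

lemma measurable_wrap [measurable]: "wrap \<in> borel_measurable borel"
  unfolding wrap_def[abs_def] by measurable

lemma integral_arc_reflect:
  fixes h :: "real \<Rightarrow> real"
  shows "(LINT s|arc. h (- s)) = (LINT s|arc. h s)"
  unfolding integral_arc set_lebesgue_integral_def
  by (subst (2) lborel_integral_real_affine[where c = "-1" and t = 0]) (auto simp: indicator_def intro!: Bochner_Integration.integral_cong)

lemma integrable_arc_reflect:
  fixes h :: "real \<Rightarrow> real"
  assumes "integrable arc h" shows "integrable arc (\<lambda>s. h (- s))"
proof -
  have "integrable lborel (\<lambda>s. indicator {-pi..pi} (- s) *\<^sub>R h (- s))"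
    using lborel_integrable_real_affine[of "\<lambda>s. indicator {-pi..pi} s *\<^sub>R h s" "-1" 0] assms
    by (simp add: integrable_arc_iff set_integrable_def)
  moreover have "indicator {-pi..pi} (- s) = (indicator {-pi..pi} s :: real)" for s
    by (auto simp: indicator_def)
  ultimately show ?thesis by (simp add: integrable_arc_iff set_integrable_def)
qed

text \<open>Against an even weight the odd part of \<open>h\<close> integrates to zero.\<close>

lemma integral_sym_part:
  assumes h: "integrable arc (\<lambda>s. h s * e s)" and e: "\<And>s. e (- s) = e s"
  shows "(LINT s|arc. sym_part h s * e s) = (LINT s|arc. h s * e s)"
proof -
  have i: "integrable arc (\<lambda>s. h (- s) * e s)" using integrable_arc_reflect[OF h] by (simp add: e)
  have "(LINT s|arc. sym_part h s * e s) = (LINT s|arc. (h s * e s + h (- s) * e s) / 2)"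
    by (simp add: sym_part_def distrib_right)
  also have "\<dots> = ((LINT s|arc. h s * e s) + (LINT s|arc. h (- s) * e s)) / 2"
    using h i by (simp only: integral_divide_zero Bochner_Integration.integral_add)
  also have "(LINT s|arc. h (- s) * e s) = (LINT s|arc. h s * e s)"
    using integral_arc_reflect[of "\<lambda>s. h s * e s"] by (simp add: e)
  finally show ?thesis by simp
qed

lemma integral_antisym_part:
  assumes h: "integrable arc (\<lambda>s. h s * e s)" and e: "\<And>s. e (- s) = - e s"
  shows "(LINT s|arc. antisym_part h s * e s) = (LINT s|arc. h s * e s)"
proof -
  have i: "integrable arc (\<lambda>s. h (- s) * e s)" using integrable_arc_reflect[OF h] by (simp add: e)
  have "(LINT s|arc. antisym_part h s * e s) = (LINT s|arc. (h s * e s - h (- s) * e s) / 2)"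
    by (simp add: antisym_part_def left_diff_distrib)
  also have "\<dots> = ((LINT s|arc. h s * e s) - (LINT s|arc. h (- s) * e s)) / 2"
    using h i by (simp only: integral_divide_zero Bochner_Integration.integral_diff)
  also have "(LINT s|arc. h (- s) * e s) = - (LINT s|arc. h s * e s)"
    using integral_arc_reflect[of "\<lambda>s. h s * e s"] by (simp add: e)
  finally show ?thesis by simp
qed

locale spectral_density = spectral_gaussian M \<xi> \<gamma> F
  for M :: "'a measure" and \<xi> \<gamma> F +
  fixes \<phi> :: real and f :: "real \<Rightarrow> real"
  assumes f_meas [measurable]: "f \<in> borel_measurable borel"
    and f_nonneg: "\<And>s. f s \<ge> 0"
    and f_density: "rotated_measure F \<phi> = density (restrict_space lborel {-pi<..pi}) (\<lambda>s. ennreal (f s))"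
begin

lemma measurable_rotation: "(\<lambda>t. wrap (t - \<phi>)) \<in> F \<rightarrow>\<^sub>M restrict_space borel {-pi<..pi}"
  by (intro measurable_restrict_space2 measurable_F) (use wrap_range in auto)

lemma prob_space_rotated: "prob_space (rotated_measure F \<phi>)"
  unfolding rotated_measure_def by (rule F.prob_space_distr[OF measurable_rotation])

lemma integral_half_open:
  fixes h :: "real \<Rightarrow> 'b::{banach,second_countable_topology}"
  assumes [measurable]: "h \<in> borel_measurable borel"
  shows "(LINT s|restrict_space lborel {-pi<..pi}. h s) = (LINT s|arc. h s)"
proof -
  have "(LINT s|restrict_space lborel {-pi<..pi}. h s) = (LBINT s:{-pi<..pi}. h s)"
    by (subst integral_restrict_space) (auto simp: set_lebesgue_integral_def)
  also have "\<dots> = (LBINT s:{-pi..pi}. h s)"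
    unfolding set_lebesgue_integral_def
  proof (rule integral_cong_AE)
    show "AE s in lborel. indicator {-pi<..pi} s *\<^sub>R h s = indicator {-pi..pi} s *\<^sub>R h s"
      using AE_lborel_singleton[of "-pi"] by eventually_elim (auto simp: indicator_def)
  qed auto
  finally show ?thesis by (simp add: integral_arc)
qed

lemma integrable_half_open:
  fixes h :: "real \<Rightarrow> 'b::{banach,second_countable_topology}"
  assumes [measurable]: "h \<in> borel_measurable borel"
  shows "integrable (restrict_space lborel {-pi<..pi}) h \<longleftrightarrow> integrable arc h"
proof -
  have "integrable (restrict_space lborel {-pi<..pi}) h \<longleftrightarrow> integrable lborel (\<lambda>s. indicator {-pi<..pi} s *\<^sub>R h s)"
    by (subst integrable_restrict_space) auto
  also have "\<dots> \<longleftrightarrow> integrable lborel (\<lambda>s. indicator {-pi..pi} s *\<^sub>R h s)"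
  proof (rule integrable_cong_AE)
    show "AE s in lborel. indicator {-pi<..pi} s *\<^sub>R h s = indicator {-pi..pi} s *\<^sub>R h s"
      using AE_lborel_singleton[of "-pi"] by eventually_elim (auto simp: indicator_def)
  qed auto
  finally show ?thesis by (simp add: integrable_arc_iff set_integrable_def)
qed

lemma measurable_half_open: "h \<in> borel_measurable borel \<Longrightarrow> h \<in> borel_measurable (restrict_space lborel {-pi<..pi})"
  by (rule measurable_restrict_space1) simp

lemma f_integrable: "integrable arc f" and f_integral: "(LINT s|arc. f s) = 1"
proof -
  interpret R: prob_space "rotated_measure F \<phi>" by (rule prob_space_rotated)
  have m: "f \<in> borel_measurable (restrict_space lborel {-pi<..pi})" by (rule measurable_half_open) simp
  have "integrable (rotated_measure F \<phi>) (\<lambda>_. 1 :: real)" by simp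
  then have i: "integrable (restrict_space lborel {-pi<..pi}) f"
    unfolding f_density using m f_nonneg by (subst (asm) integrable_density) auto
  then show "integrable arc f" by (subst (asm) integrable_half_open) auto
  have "1 = (LINT s|rotated_measure F \<phi>. (1 :: real))" using R.prob_space by simp
  also have "\<dots> = (LINT s|restrict_space lborel {-pi<..pi}. f s)"
    unfolding f_density using m f_nonneg by (subst integral_density) auto
  also have "\<dots> = (LINT s|arc. f s)" by (rule integral_half_open) simp
  finally show "(LINT s|arc. f s) = 1" by simp
qed

text \<open>Functions of \<open>cis (t - \<phi>)\<close> do not see the reduction of \<open>t - \<phi>\<close> modulo \<open>2 pi\<close>, so they are integrated
  by the density of the rotated measure.\<close>

lemma integral_F_rotate:
  fixes g :: "complex \<Rightarrow> 'b::{banach,second_countable_topology}"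
  assumes [measurable]: "g \<in> borel_measurable borel"
  shows "(LINT t|F. g (cis (t - \<phi>))) = (LINT s|arc. f s *\<^sub>R g (cis s))"
proof -
  have gm[measurable]: "(\<lambda>s. g (cis s)) \<in> borel_measurable borel"
    by (rule measurable_compose[OF borel_measurable_continuous_onI]) (auto intro!: continuous_intros)
  have m: "(\<lambda>s. g (cis s)) \<in> borel_measurable (restrict_space lborel {-pi<..pi})" "f \<in> borel_measurable (restrict_space lborel {-pi<..pi})"
    by (rule measurable_half_open, simp)+
  have m': "(\<lambda>s. g (cis s)) \<in> borel_measurable (restrict_space borel {-pi<..pi})"
    by (rule measurable_restrict_space1) simp
  have "(LINT t|F. g (cis (t - \<phi>))) = (LINT t|F. g (cis (wrap (t - \<phi>))))" by (simp add: cis_wrap)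
  also have "\<dots> = (LINT s|rotated_measure F \<phi>. g (cis s))"
    unfolding rotated_measure_def by (subst integral_distr[OF measurable_rotation m']) simp
  also have "\<dots> = (LINT s|restrict_space lborel {-pi<..pi}. f s *\<^sub>R g (cis s))"
    unfolding f_density using m f_nonneg by (subst integral_density) auto
  also have "\<dots> = (LINT s|arc. f s *\<^sub>R g (cis s))" by (rule integral_half_open) simp
  finally show ?thesis .
qed

lemma integrable_f_over_pdenom:
  assumes r: "0 \<le> r" "r < 1" and c: "continuous_on UNIV c"
  shows "integrable arc (\<lambda>s. f s * (c s / pdenom r s ^ n))"
proof -
  have "continuous_on {-pi..pi} (\<lambda>s. c s / pdenom r s ^ n)"
    using pdenom_pos[OF r] by (intro continuous_intros pdenom_continuous continuous_on_subset[OF c]) (auto simp: less_imp_neq[symmetric])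
  then have "bounded ((\<lambda>s. c s / pdenom r s ^ n) ` {-pi..pi})"
    by (intro compact_imp_bounded compact_continuous_image) auto
  then obtain B where B: "\<And>s. s \<in> {-pi..pi} \<Longrightarrow> norm (c s / pdenom r s ^ n) \<le> B"
    unfolding bounded_iff by blast
  have [measurable]: "c \<in> borel_measurable borel" using c by (rule borel_measurable_continuous_onI)
  show ?thesis
  proof (rule Bochner_Integration.integrable_bound)
    show "integrable arc (\<lambda>s. B * f s)" using f_integrable by simp
    show "(\<lambda>s. f s * (c s / pdenom r s ^ n)) \<in> borel_measurable arc" by measurable
    have "norm (f s * (c s / pdenom r s ^ n)) \<le> norm (B * f s)" if "s \<in> {-pi..pi}" for s
    proof -
      have "\<bar>f s\<bar> * \<bar>c s / pdenom r s ^ n\<bar> \<le> \<bar>f s\<bar> * \<bar>B\<bar>"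
        using B[OF that] by (intro mult_left_mono) auto
      then show ?thesis by (simp add: abs_mult mult.commute)
    qed
    then show "AE s in arc. norm (f s * (c s / pdenom r s ^ n)) \<le> norm (B * f s)" by (intro AE_I2) auto
  qed
qed

text \<open>After rotating by \<open>\<phi>\<close> the weights of \<open>K\<close> and \<open>K11\<close> are even. That of \<open>K1\<close> is
  \<open>(e^(-is) - r) / (pdenom r s)^2\<close> up to a unimodular factor, with even real and odd imaginary part.\<close>

lemma K_radial:
  assumes r: "0 \<le> r" "r < 1"
  shows "K (of_real r * cis \<phi>) = (LINT s|arc. sym_part f s / pdenom r s)"
    and "K11 (of_real r * cis \<phi>) = (LINT s|arc. sym_part f s / (pdenom r s)\<^sup>2)"
    and "(norm (K1 (of_real r * cis \<phi>)))\<^sup>2 = (LINT s|arc. sym_part f s * (cos s - r) / (pdenom r s)\<^sup>2)\<^sup>2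
      + (LINT s|arc. antisym_part f s * sin s / (pdenom r s)\<^sup>2)\<^sup>2"
proof -
  have n: "1 - of_real r * cis \<phi> * cis (- t) = 1 - of_real r * cnj (cis (t - \<phi>))" for t
    by (simp add: cis_cnj cis_mult mult.assoc)
  have qn: "(norm (1 - of_real r * cnj (cis s)))\<^sup>2 = pdenom r s" for s
    using norm_eq_pdenom[of r s] by (metis complex_cnj_cnj complex_cnj_complex_of_real complex_cnj_diff complex_cnj_mult complex_cnj_one complex_mod_cnj)
  have qe: "pdenom r (- s) = pdenom r s" for s by (simp add: pdenom_def)
  have c1: "(\<lambda>w. norm (1 - of_real r * cnj w)) \<in> borel_measurable borel"
    by (intro borel_measurable_continuous_onI continuous_intros)
  have i: "integrable arc (\<lambda>s. f s * (c s / pdenom r s ^ n))" if "continuous_on UNIV c" for c n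
    by (rule integrable_f_over_pdenom[OF r that])
  have "K (of_real r * cis \<phi>) = (LINT s|arc. f s * (1 / pdenom r s))"
    unfolding K_def n using integral_F_rotate[of "\<lambda>w. 1 / (norm (1 - of_real r * cnj w))\<^sup>2"] c1 by (simp add: qn)
  also have "\<dots> = (LINT s|arc. sym_part f s * (1 / pdenom r s))"
    using i[of "\<lambda>_. 1" 1] by (subst integral_sym_part) (auto simp: qe)
  finally show "K (of_real r * cis \<phi>) = (LINT s|arc. sym_part f s / pdenom r s)" by simp
  have q2: "(norm (1 - of_real r * cnj (cis s))) ^ 4 = (pdenom r s)\<^sup>2" for s
    unfolding qn[symmetric] by (simp add: power_mult[symmetric])
  have "K11 (of_real r * cis \<phi>) = (LINT s|arc. f s * (1 / (pdenom r s)\<^sup>2))"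
    unfolding K11_def n using integral_F_rotate[of "\<lambda>w. 1 / (norm (1 - of_real r * cnj w)) ^ 4"] c1 by (simp add: q2)
  also have "\<dots> = (LINT s|arc. sym_part f s * (1 / (pdenom r s)\<^sup>2))"
    using i[of "\<lambda>_. 1" 2] by (subst integral_sym_part) (auto simp: qe)
  finally show "K11 (of_real r * cis \<phi>) = (LINT s|arc. sym_part f s / (pdenom r s)\<^sup>2)" by simp
  define g where "g w = of_real (1 / (norm (1 - of_real r * cnj w))\<^sup>2) * (cnj w / (1 - of_real r * cnj w))" for w :: complex
  have gm: "g \<in> borel_measurable borel"
  proof -
    have "(\<lambda>w. 1 - of_real r * cnj w) \<in> borel_measurable borel" "(\<lambda>w. cnj w) \<in> borel_measurable borel"
      by (intro borel_measurable_continuous_onI continuous_intros)+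
    then show ?thesis unfolding g_def using c1 by measurable
  qed
  have gval: "g (cis s) = (cis (- s) - of_real r) / of_real ((pdenom r s)\<^sup>2)" for s
  proof -
    have q0: "pdenom r s \<noteq> 0" using pdenom_pos[OF r, of s] by simp
    have "cnj (cis s) / (1 - of_real r * cnj (cis s))
       = cnj (cis s) * cnj (1 - of_real r * cnj (cis s)) / of_real (pdenom r s)"
      by (subst complex_div_cnj) (simp only: qn)
    also have "cnj (cis s) * cnj (1 - of_real r * cnj (cis s)) = cis (- s) - of_real r"
      by (simp add: cis_cnj right_diff_distrib cis_mult mult.left_commute)
    finally show ?thesis unfolding g_def qn by (simp add: power2_eq_square)
  qed
  have "K1 (of_real r * cis \<phi>) = (LINT t|F. cis (- \<phi>) * g (cis (t - \<phi>)))"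
    unfolding K1_def n
  proof (intro Bochner_Integration.integral_cong refl)
    fix t
    have "cis (- t) = cis (- \<phi>) * cnj (cis (t - \<phi>))" by (simp add: cis_cnj cis_mult)
    then show "of_real (1 / (norm (1 - of_real r * cnj (cis (t - \<phi>))))\<^sup>2) * (cis (- t) / (1 - of_real r * cnj (cis (t - \<phi>))))
      = cis (- \<phi>) * g (cis (t - \<phi>))" by (simp add: g_def)
  qed
  also have "\<dots> = cis (- \<phi>) * (LINT s|arc. f s *\<^sub>R g (cis s))"
    by (simp add: integral_F_rotate[OF gm])
  finally have K1: "K1 (of_real r * cis \<phi>) = cis (- \<phi>) * (LINT s|arc. f s *\<^sub>R g (cis s))" .
  have fg: "f s *\<^sub>R g (cis s) = Complex (f s * ((cos s - r) / (pdenom r s)\<^sup>2)) (- (f s * (sin s / (pdenom r s)\<^sup>2)))" for s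
    unfolding gval by (simp add: complex_eq_iff Re_divide_of_real Im_divide_of_real del: of_real_power)
  have ic: "integrable arc (\<lambda>s. f s * ((cos s - r) / (pdenom r s)\<^sup>2))" "integrable arc (\<lambda>s. f s * (sin s / (pdenom r s)\<^sup>2))"
    by (rule i, intro continuous_intros)+
  have ig: "integrable arc (\<lambda>s. f s *\<^sub>R g (cis s))"
    unfolding fg Complex_eq using ic by (intro Bochner_Integration.integrable_add integrable_mult_right integrable_of_real Bochner_Integration.integrable_minus)
  have "(LINT s|arc. f s *\<^sub>R g (cis s)) = Complex (LINT s|arc. f s * ((cos s - r) / (pdenom r s)\<^sup>2)) (- (LINT s|arc. f s * (sin s / (pdenom r s)\<^sup>2)))"
    using integral_Re[OF ig] integral_Im[OF ig] unfolding fg by (simp add: complex_eq_iff)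
  then have "(norm (K1 (of_real r * cis \<phi>)))\<^sup>2 = (LINT s|arc. f s * ((cos s - r) / (pdenom r s)\<^sup>2))\<^sup>2 + (LINT s|arc. f s * (sin s / (pdenom r s)\<^sup>2))\<^sup>2"
    unfolding K1 by (simp add: norm_mult cmod_power2)
  also have "(LINT s|arc. f s * ((cos s - r) / (pdenom r s)\<^sup>2)) = (LINT s|arc. sym_part f s * ((cos s - r) / (pdenom r s)\<^sup>2))"
    by (rule integral_sym_part[symmetric, OF ic(1)]) (simp add: qe)
  also have "(LINT s|arc. f s * (sin s / (pdenom r s)\<^sup>2)) = (LINT s|arc. antisym_part f s * (sin s / (pdenom r s)\<^sup>2))"
    by (rule integral_antisym_part[symmetric, OF ic(2)]) (simp add: qe)
  finally show "(norm (K1 (of_real r * cis \<phi>)))\<^sup>2 = (LINT s|arc. sym_part f s * (cos s - r) / (pdenom r s)\<^sup>2)\<^sup>2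
      + (LINT s|arc. antisym_part f s * sin s / (pdenom r s)\<^sup>2)\<^sup>2" by simp
qed

end

section \<open>Smooth spectral densities\<close>

lemma one_minus_cos_expansion: "\<bar>(1 - cos s) - s\<^sup>2 / 2\<bar> \<le> s ^ 4 / 24" for s :: real
proof -
  obtain t where "cos s = (\<Sum>m<4. cos_coeff m * s ^ m) + cos (t + 1/2 * real 4 * pi) / fact 4 * s ^ 4"
    using Maclaurin_cos_expansion[of s 4] by blast
  then have "(1 - cos s) - s\<^sup>2 / 2 = - (cos (t + 1/2 * real 4 * pi) / 24 * s ^ 4)"
  proof -
    have "{..<4} = {0, 1, 2, 3 :: nat}" by auto
    moreover have "cos_coeff 2 = - 1 / 2" "cos_coeff 3 = 0" "cos_coeff (Suc 0) = 0" "cos_coeff 0 = 1"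
      by (simp_all add: cos_coeff_def)
    moreover have "fact 4 = (24 :: real)" by (simp add: fact_numeral)
    moreover note \<open>cos s = _\<close>
    ultimately show ?thesis by simp
  qed
  then have "\<bar>(1 - cos s) - s\<^sup>2 / 2\<bar> = \<bar>cos (t + 1/2 * real 4 * pi)\<bar> * (s ^ 4 / 24)"
    by (simp add: abs_mult)
  also have "\<dots> \<le> 1 * (s ^ 4 / 24)" by (intro mult_right_mono) auto
  finally show ?thesis by simp
qed

lemma sin_minus_self_bound: "\<bar>sin s - s\<bar> \<le> \<bar>s\<bar> ^ 3" for s :: real
proof -
  have "\<bar>sin s - (\<Sum>m<3. sin_coeff m * s ^ m)\<bar> \<le> inverse (fact 3) * \<bar>s\<bar> ^ 3"
    by (rule Maclaurin_sin_bound)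
  moreover have "(\<Sum>m<3. sin_coeff m * s ^ m) = s"
    by (simp add: eval_nat_numeral sin_coeff_def lessThan_Suc)
  moreover have "inverse (fact 3) * \<bar>s\<bar> ^ 3 \<le> 1 * \<bar>s\<bar> ^ 3"
    by (intro mult_right_mono) (auto simp: eval_nat_numeral)
  ultimately show ?thesis by simp
qed

lemma one_minus_cos_ge: assumes "\<bar>s\<bar> \<le> 1" shows "s\<^sup>2 / 4 \<le> 1 - cos (s :: real)"
proof -
  have "s\<^sup>2 \<le> 1" using assms by (simp add: abs_square_le_1)
  then have "s\<^sup>2 * s\<^sup>2 \<le> s\<^sup>2 * 1" by (intro mult_left_mono) auto
  then have "s ^ 4 \<le> s\<^sup>2" by (simp add: power_add[symmetric])
  then show ?thesis using one_minus_cos_expansion[of s] zero_le_power2[of s] unfolding abs_le_iff by linarith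
qed

text \<open>Near \<open>0\<close>, \<open>1 - cos s\<close> is at least \<open>s^2 / 4\<close>; at distance more than \<open>e\<close> it is bounded below, so that a mere
  integrable bound suffices there.\<close>

lemma flatI:
  assumes h: "h \<in> borel_measurable arc" and w: "integrable arc w" "\<And>s. 0 \<le> w s"
    and e: "0 < e" "e \<le> 1" and near: "\<And>s. \<bar>s\<bar> \<le> e \<Longrightarrow> \<bar>h s\<bar> \<le> B * s ^ 4"
    and far: "\<And>s. \<bar>h s\<bar> \<le> D * (1 + w s)"
  shows "flat h"
proof -
  define m0 where "m0 = 1 - cos e"
  have m0: "m0 > 0"
  proof -
    have "0 < e\<^sup>2 / 4" using e by simp
    also have "\<dots> \<le> m0" unfolding m0_def using e by (intro one_minus_cos_ge) auto
    finally show ?thesis .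
  qed
  have D0: "D \<ge> 0"
  proof (rule ccontr)
    assume "\<not> D \<ge> 0"
    then have "D * (1 + w 0) < 0" using w(2)[of 0] by (intro mult_neg_pos) auto
    then show False using far[of 0] by linarith
  qed
  define C where "C = 16 * \<bar>B\<bar> + D / m0\<^sup>2"
  have C0: "0 \<le> C" using D0 by (simp add: C_def)
  have "\<bar>h s\<bar> \<le> C * (1 - cos s)\<^sup>2 * (1 + (1 - cos s) * (w s / m0))" if s: "s \<in> {-pi..pi}" for s
  proof (cases "\<bar>s\<bar> \<le> e")
    case True
    have m: "s\<^sup>2 / 4 \<le> 1 - cos s" using True e by (intro one_minus_cos_ge) auto
    have "(s\<^sup>2 / 4)\<^sup>2 \<le> (1 - cos s)\<^sup>2" using m by (intro power_mono) auto
    then have s4: "s ^ 4 \<le> 16 * (1 - cos s)\<^sup>2" by (simp add: power_divide power_mult[symmetric])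
    have "\<bar>h s\<bar> \<le> \<bar>B\<bar> * s ^ 4"
      by (rule order_trans[OF near[OF True]]) (intro mult_right_mono, auto)
    also have "\<dots> \<le> \<bar>B\<bar> * (16 * (1 - cos s)\<^sup>2)" using s4 by (intro mult_left_mono) auto
    also have "\<dots> \<le> C * (1 - cos s)\<^sup>2"
      unfolding C_def distrib_right using D0 by simp
    also have "\<dots> \<le> C * (1 - cos s)\<^sup>2 * (1 + (1 - cos s) * (w s / m0))"
    proof -
      have "1 \<le> 1 + (1 - cos s) * (w s / m0)" using w(2)[of s] m0 by simp
      from mult_left_mono[OF this, of "C * (1 - cos s)\<^sup>2"] show ?thesis using C0 by simp
    qed
    finally show ?thesis .
  next
    case False
    have "cos \<bar>s\<bar> \<le> cos e" using False e s by (intro cos_monotone_0_pi_le) auto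
    then have m: "m0 \<le> 1 - cos s" by (simp add: m0_def)
    have "D * (1 + w s) \<le> (D / m0\<^sup>2 * (1 - cos s)\<^sup>2) * (1 + (1 - cos s) * (w s / m0))"
    proof (rule mult_mono)
      have "m0\<^sup>2 \<le> (1 - cos s)\<^sup>2" using m m0 by (intro power_mono) auto
      then have "1 \<le> (1 - cos s)\<^sup>2 / m0\<^sup>2" using m0 by simp
      from mult_left_mono[OF this D0] show "D \<le> D / m0\<^sup>2 * (1 - cos s)\<^sup>2" by simp
      have "1 \<le> (1 - cos s) / m0" using m m0 by simp
      from mult_right_mono[OF this w(2)[of s]] show "1 + w s \<le> 1 + (1 - cos s) * (w s / m0)" by simp
    qed (use D0 w(2)[of s] in auto)
    also have "\<dots> \<le> C * (1 - cos s)\<^sup>2 * (1 + (1 - cos s) * (w s / m0))"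
      using w(2)[of s] m0 by (intro mult_right_mono) (auto simp: C_def)
    finally show ?thesis using far[of s] by linarith
  qed
  then show ?thesis unfolding flat_def using h C0 w m0
    by (intro conjI exI[of _ C] exI[of _ "\<lambda>s. w s / m0"]) auto
qed

lemma smooth_at_derivative:
  assumes "smooth_at f 0"
  obtains e where "0 < e" "e \<le> 1" "\<And>n x. \<bar>x\<bar> < e \<Longrightarrow> ((deriv ^^ n) f has_field_derivative (deriv ^^ Suc n) f x) (at x)"
proof -
  obtain e where e: "e > 0" "\<And>n x. x \<in> ball 0 e \<Longrightarrow> (deriv ^^ n) f field_differentiable (at x)"
    using assms unfolding smooth_at_def by blast
  have "((deriv ^^ n) f has_field_derivative (deriv ^^ Suc n) f x) (at x)" if "\<bar>x\<bar> < min e 1" for n x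
    using e(2)[of x n] that by (simp add: dist_norm DERIV_deriv_iff_field_differentiable)
  then show ?thesis using that[of "min e 1"] e(1) by auto
qed

lemma smooth_taylor:
  assumes "smooth_at f 0"
  obtains e B d where "0 < e" "e \<le> 1"
    "\<And>s. \<bar>s\<bar> \<le> e \<Longrightarrow> \<bar>f s - (f 0 + deriv f 0 * s + (deriv ^^ 2) f 0 / 2 * s\<^sup>2 + d * s ^ 3)\<bar> \<le> B * s ^ 4"
proof -
  obtain e where e: "0 < e" "e \<le> 1" "\<And>n x. \<bar>x\<bar> < e \<Longrightarrow> ((deriv ^^ n) f has_field_derivative (deriv ^^ Suc n) f x) (at x)"
    using smooth_at_derivative[OF assms] by blast
  have "continuous_on {- e / 2..e / 2} ((deriv ^^ 4) f)"
    by (rule continuous_at_imp_continuous_on) (use e in \<open>auto intro!: DERIV_isCont[OF e(3)]\<close>)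
  then have "bounded ((deriv ^^ 4) f ` {- e / 2..e / 2})"
    by (intro compact_imp_bounded compact_continuous_image) auto
  then obtain B where B: "\<And>s. s \<in> {- e / 2..e / 2} \<Longrightarrow> norm ((deriv ^^ 4) f s) \<le> B"
    unfolding bounded_iff by blast
  have main: "\<bar>f s - (f 0 + deriv f 0 * s + (deriv ^^ 2) f 0 / 2 * s\<^sup>2 + (deriv ^^ 3) f 0 / 6 * s ^ 3)\<bar> \<le> B / 24 * s ^ 4"
    if s: "\<bar>s\<bar> \<le> e / 2" for s
  proof -
    have "\<exists>t. \<bar>t\<bar> \<le> \<bar>s\<bar> \<and> f s = (\<Sum>m<4. (deriv ^^ m) f 0 / fact m * s ^ m) + (deriv ^^ 4) f t / fact 4 * s ^ 4"
      by (rule Maclaurin_bi_le) (use e s in auto)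
    then obtain t where t: "\<bar>t\<bar> \<le> \<bar>s\<bar>" "f s = (\<Sum>m<4. (deriv ^^ m) f 0 / fact m * s ^ m) + (deriv ^^ 4) f t / fact 4 * s ^ 4" by blast
    have fct: "fact 2 = (2 :: real)" "fact 3 = (6 :: real)" "fact 4 = (24 :: real)" by (simp_all add: fact_numeral)
    have "(\<Sum>m<4. (deriv ^^ m) f 0 / fact m * s ^ m) = f 0 + deriv f 0 * s + (deriv ^^ 2) f 0 / 2 * s\<^sup>2 + (deriv ^^ 3) f 0 / 6 * s ^ 3"
    proof -
      have "{..<4} = {0, 1, 2, 3 :: nat}" by auto
      then show ?thesis by (simp add: fct)
    qed
    with t have "f s - (f 0 + deriv f 0 * s + (deriv ^^ 2) f 0 / 2 * s\<^sup>2 + (deriv ^^ 3) f 0 / 6 * s ^ 3) = (deriv ^^ 4) f t / 24 * s ^ 4"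
      by (simp only: fct)
    moreover have "norm ((deriv ^^ 4) f t) \<le> B" using t s by (intro B) auto
    then have "\<bar>(deriv ^^ 4) f t / 24 * s ^ 4\<bar> \<le> B / 24 * s ^ 4"
      by (simp add: abs_mult mult_right_mono)
    ultimately show ?thesis by (simp only:)
  qed
  have "0 < e / 2" "e / 2 \<le> 1" using e by auto
  from that[OF this main] show ?thesis .
qed

text \<open>The iterated derivative is taken of the function \<open>deriv h\<close>, so \<open>h\<close> has to be differentiated in a whole
  neighbourhood.\<close>

lemma second_derivative_at_0:
  fixes h :: "real \<Rightarrow> real"
  assumes "e > 0" "\<And>x. \<bar>x\<bar> < e \<Longrightarrow> (h has_field_derivative h' x) (at x)" "(h' has_field_derivative d) (at 0)"
  shows "(deriv ^^ 2) h 0 = d"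
proof -
  have "eventually (\<lambda>x. x \<in> ball 0 e) (nhds (0 :: real))" using assms(1) by (intro eventually_nhds_in_open) auto
  then have "eventually (\<lambda>x. deriv h x = h' x) (nhds 0)"
    by eventually_elim (use assms(2) in \<open>auto intro!: DERIV_imp_deriv simp: dist_norm\<close>)
  then have "deriv (deriv h) 0 = deriv h' 0" by (rule deriv_cong_ev) simp
  also have "\<dots> = d" using assms(3) by (rule DERIV_imp_deriv)
  finally show ?thesis by (simp add: numeral_2_eq_2)
qed

lemma second_derivatives_of_parts:
  assumes "smooth_at f 0"
  shows "(deriv ^^ 2) (sym_part f) 0 = (deriv ^^ 2) f 0"
    and "(deriv ^^ 2) (\<lambda>s. sym_part f s * cos s) 0 = (deriv ^^ 2) f 0 - f 0"
    and "(deriv ^^ 2) (\<lambda>s. antisym_part f s * sin s) 0 = 2 * deriv f 0"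
proof -
  obtain e where e: "0 < e" "e \<le> 1" "\<And>n x. \<bar>x\<bar> < e \<Longrightarrow> ((deriv ^^ n) f has_field_derivative (deriv ^^ Suc n) f x) (at x)"
    using smooth_at_derivative[OF assms] by blast
  define f1 where "f1 = deriv f"
  define f2 where "f2 = (deriv ^^ 2) f"
  have d1: "(f has_field_derivative f1 x) (at x)" if "\<bar>x\<bar> < e" for x using e(3)[OF that, of 0] by (simp add: f1_def)
  have d2: "(f1 has_field_derivative f2 x) (at x)" if "\<bar>x\<bar> < e" for x
    using e(3)[OF that, of 1] by (simp add: f1_def f2_def numeral_2_eq_2)
  have m1: "((\<lambda>x. f (- x)) has_field_derivative - f1 (- x)) (at x)" if "\<bar>x\<bar> < e" for x
    using d1[of "- x"] that by (simp add: DERIV_mirror)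
  have m2: "((\<lambda>x. f1 (- x)) has_field_derivative - f2 (- x)) (at x)" if "\<bar>x\<bar> < e" for x
    using d2[of "- x"] that by (simp add: DERIV_mirror)
  have s1: "(sym_part f has_field_derivative (f1 x - f1 (- x)) / 2) (at x)" if "\<bar>x\<bar> < e" for x
    unfolding sym_part_def[abs_def] using DERIV_cdivide[OF DERIV_add[OF d1[OF that] m1[OF that]], of 2] by simp
  have s2: "((\<lambda>x. (f1 x - f1 (- x)) / 2) has_field_derivative (f2 x + f2 (- x)) / 2) (at x)" if "\<bar>x\<bar> < e" for x
    using DERIV_cdivide[OF DERIV_diff[OF d2[OF that] m2[OF that]], of 2] by simp
  have a1: "(antisym_part f has_field_derivative (f1 x + f1 (- x)) / 2) (at x)" if "\<bar>x\<bar> < e" for x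
    unfolding antisym_part_def[abs_def] using DERIV_cdivide[OF DERIV_diff[OF d1[OF that] m1[OF that]], of 2] by simp
  have a2: "((\<lambda>x. (f1 x + f1 (- x)) / 2) has_field_derivative (f2 x - f2 (- x)) / 2) (at x)" if "\<bar>x\<bar> < e" for x
    using DERIV_cdivide[OF DERIV_add[OF d2[OF that] m2[OF that]], of 2] by simp
  have z: "\<bar>0 :: real\<bar> < e" using e by simp
  show "(deriv ^^ 2) (sym_part f) 0 = (deriv ^^ 2) f 0"
    using second_derivative_at_0[OF e(1) s1 s2[OF z]] by (simp add: f2_def)
  have sc: "((\<lambda>s. sym_part f s * cos s) has_field_derivative (f1 x - f1 (- x)) / 2 * cos x - sym_part f x * sin x) (at x)"
    if "\<bar>x\<bar> < e" for x
    by (rule derivative_eq_intros s1[OF that] refl | simp)+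
  have sc2: "((\<lambda>x. (f1 x - f1 (- x)) / 2 * cos x - sym_part f x * sin x) has_field_derivative f2 0 - f 0) (at 0)"
    by (rule derivative_eq_intros s1[OF z] s2[OF z] refl | simp add: sym_part_def)+
  show "(deriv ^^ 2) (\<lambda>s. sym_part f s * cos s) 0 = (deriv ^^ 2) f 0 - f 0"
    using second_derivative_at_0[OF e(1) sc sc2] by (simp add: f2_def)
  have as: "((\<lambda>s. antisym_part f s * sin s) has_field_derivative (f1 x + f1 (- x)) / 2 * sin x + antisym_part f x * cos x) (at x)"
    if "\<bar>x\<bar> < e" for x
    by (rule derivative_eq_intros a1[OF that] refl | simp)+
  have as2: "((\<lambda>x. (f1 x + f1 (- x)) / 2 * sin x + antisym_part f x * cos x) has_field_derivative 2 * f1 0) (at 0)"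
    by (rule derivative_eq_intros a1[OF z] a2[OF z] refl | simp add: antisym_part_def)+
  show "(deriv ^^ 2) (\<lambda>s. antisym_part f s * sin s) 0 = 2 * deriv f 0"
    using second_derivative_at_0[OF e(1) as as2] by (simp add: f1_def)
qed

lemma AE_arc_nonzero: "AE s in arc. s \<noteq> 0 \<and> cos s \<noteq> 1"
  using AE_arc_cos_neq by eventually_elim auto

text \<open>The value that \<open>T_op\<close> has at \<open>0\<close> by definition affects the integral on a null set only.\<close>

lemma I_op_T_op:
  assumes [measurable]: "h \<in> borel_measurable borel"
  shows "I_op (T_op h) = (LINT s|arc. (h s - h 0) / (1 - cos s)) / (2 * pi)"
proof -
  have "(LINT s|arc. T_op h s) = (LINT s|arc. (h s - h 0) / (1 - cos s))"
  proof (rule integral_cong_AE)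
    show "AE s in arc. T_op h s = (h s - h 0) / (1 - cos s)"
      using AE_arc_nonzero by eventually_elim (simp add: T_op_def)
  qed (simp_all add: T_op_def[abs_def])
  then show ?thesis by (simp add: I_op_def integral_arc)
qed

lemma I_op_T_op_T_op:
  assumes [measurable]: "h \<in> borel_measurable borel" and h: "h 0 = 0" "(deriv ^^ 2) h 0 = 0"
  shows "I_op (T_op (T_op h)) = (LINT s|arc. h s / (1 - cos s)\<^sup>2) / (2 * pi)"
proof -
  have m: "T_op h \<in> borel_measurable borel" by (simp add: T_op_def[abs_def])
  have "(LINT s|arc. (T_op h s - T_op h 0) / (1 - cos s)) = (LINT s|arc. h s / (1 - cos s)\<^sup>2)"
  proof (rule integral_cong_AE)
    show "AE s in arc. (T_op h s - T_op h 0) / (1 - cos s) = h s / (1 - cos s)\<^sup>2"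
      using AE_arc_nonzero by eventually_elim (use h in \<open>simp add: T_op_def power2_eq_square\<close>)
    show "(\<lambda>s. (T_op h s - T_op h 0) / (1 - cos s)) \<in> borel_measurable arc" using m by measurable
  qed simp
  then show ?thesis by (simp add: I_op_T_op[OF m])
qed

lemma approaches_imp_bigo:
  assumes "approaches F L" shows "(\<lambda>r. c * (F r - L)) \<in> O[at_left 1](\<lambda>r. 1 - r\<^sup>2)"
proof -
  obtain B where "eventually (\<lambda>r. norm (F r - L) \<le> B * norm (1 - r)) (at_left 1)"
    using assms unfolding approaches_def by (elim landau_o.bigE) auto
  then have "eventually (\<lambda>r. norm (c * (F r - L)) \<le> (\<bar>c\<bar> * \<bar>B\<bar>) * norm (1 - r\<^sup>2)) (at_left 1)"
    using eventually_half_one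
  proof eventually_elim
    case (elim r)
    have "1 - r \<le> (1 - r) * (1 + r)" using elim by (simp add: mult_le_cancel_left1)
    also have "\<dots> = 1 - r\<^sup>2" by (simp add: power2_eq_square algebra_simps)
    finally have le: "norm (1 - r) \<le> norm (1 - r\<^sup>2)" using elim by simp
    have "B * norm (1 - r) \<le> \<bar>B\<bar> * norm (1 - r)" by (intro mult_right_mono) auto
    with elim(1) have "norm (F r - L) \<le> \<bar>B\<bar> * norm (1 - r)" by (rule order_trans)
    also have "\<dots> \<le> \<bar>B\<bar> * norm (1 - r\<^sup>2)" using le by (intro mult_left_mono) auto
    finally have "\<bar>c\<bar> * norm (F r - L) \<le> \<bar>c\<bar> * (\<bar>B\<bar> * norm (1 - r\<^sup>2))" by (intro mult_left_mono) auto
    then show ?case by (simp add: abs_mult mult.assoc)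
  qed
  then show ?thesis by (rule bigoI)
qed

lemma even_odd_average:
  fixes x y p w u v E :: real
  assumes "\<bar>x - (p + u + w + v)\<bar> \<le> E" "\<bar>y - (p - u + w - v)\<bar> \<le> E"
  shows "\<bar>(x + y) / 2 - p - w\<bar> \<le> E" "\<bar>(x - y) / 2 - (u + v)\<bar> \<le> E"
proof -
  show "\<bar>(x + y) / 2 - p - w\<bar> \<le> E" using assms unfolding add_divide_distrib diff_divide_distrib by linarith
  show "\<bar>(x - y) / 2 - (u + v)\<bar> \<le> E" using assms unfolding add_divide_distrib diff_divide_distrib by linarith
qed

context spectral_density
begin

lemma parts_meas [measurable]: "sym_part f \<in> borel_measurable borel" "antisym_part f \<in> borel_measurable borel"
  unfolding sym_part_def[abs_def] antisym_part_def[abs_def] by measurable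

lemma sym_part_integrable: "integrable arc (sym_part f)" and sym_part_integral: "(LINT s|arc. sym_part f s) = 1"
proof -
  show "integrable arc (sym_part f)"
    unfolding sym_part_def[abs_def] using f_integrable integrable_arc_reflect[OF f_integrable] by auto
  show "(LINT s|arc. sym_part f s) = 1"
    using integral_sym_part[of f "\<lambda>_. 1"] f_integrable f_integral by simp
qed

lemma sym_part_nonneg: "0 \<le> sym_part f s"
  using f_nonneg[of s] f_nonneg[of "- s"] by (simp add: sym_part_def)

lemma antisym_part_le: "\<bar>antisym_part f s\<bar> \<le> sym_part f s"
  using f_nonneg[of s] f_nonneg[of "- s"] by (simp add: sym_part_def antisym_part_def)

text \<open>Taylor's formula up to third order splits into even and odd terms, and the cubic term belongs to the odd
  part, where the factor \<open>sin s\<close> raises it to fourth order. Away from \<open>0\<close> both parts are dominated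
  by the even part itself, because \<open>f \<ge> 0\<close>.\<close>

lemma boundary_expansion_parts:
  assumes "smooth_at f 0"
  shows "boundary_expansion (sym_part f) (antisym_part f) (f 0) ((deriv ^^ 2) f 0) (deriv f 0)"
proof -
  let ?a = "(deriv ^^ 2) f 0" and ?b = "deriv f 0"
  obtain e d B where e: "0 < e" "e \<le> 1"
    and T: "\<And>s. \<bar>s\<bar> \<le> e \<Longrightarrow> \<bar>f s - (f 0 + ?b * s + ?a / 2 * s\<^sup>2 + d * s ^ 3)\<bar> \<le> B * s ^ 4"
    by (rule smooth_taylor[OF assms]) (rule that)
  have T': "\<bar>f (- s) - (f 0 - ?b * s + ?a / 2 * s\<^sup>2 - d * s ^ 3)\<bar> \<le> B * s ^ 4" if "\<bar>s\<bar> \<le> e" for s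
    using T[of "- s"] that by simp
  have even: "\<bar>sym_part f s - f 0 - ?a * (1 - cos s)\<bar> \<le> (B + \<bar>?a\<bar>) * s ^ 4" if s: "\<bar>s\<bar> \<le> e" for s
  proof -
    have "\<bar>sym_part f s - f 0 - ?a / 2 * s\<^sup>2\<bar> \<le> B * s ^ 4"
      unfolding sym_part_def by (rule even_odd_average(1)[OF T[OF s] T'[OF s]])
    moreover have "\<bar>?a * ((1 - cos s) - s\<^sup>2 / 2)\<bar> \<le> \<bar>?a\<bar> * s ^ 4"
    proof -
      have "\<bar>?a\<bar> * \<bar>(1 - cos s) - s\<^sup>2 / 2\<bar> \<le> \<bar>?a\<bar> * (s ^ 4 / 24)"
        by (intro mult_left_mono one_minus_cos_expansion) auto
      also have "\<dots> \<le> \<bar>?a\<bar> * s ^ 4" by (intro mult_left_mono) auto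
      finally show ?thesis by (simp only: abs_mult)
    qed
    moreover have "sym_part f s - f 0 - ?a * (1 - cos s) = (sym_part f s - f 0 - ?a / 2 * s\<^sup>2) - ?a * ((1 - cos s) - s\<^sup>2 / 2)"
      by (simp add: algebra_simps)
    ultimately show ?thesis unfolding distrib_right by linarith
  qed
  have odd: "\<bar>antisym_part f s * sin s - ?b * (sin s)\<^sup>2\<bar> \<le> (\<bar>d\<bar> + \<bar>B\<bar> + \<bar>?b\<bar>) * s ^ 4" if s: "\<bar>s\<bar> \<le> e" for s
  proof -
    have s3: "s ^ 4 \<le> \<bar>s\<bar> ^ 3"
    proof -
      have "s ^ 4 = \<bar>s\<bar> ^ 3 * \<bar>s\<bar>" by (simp add: power_even_abs_numeral[symmetric] eval_nat_numeral)
      also have "\<dots> \<le> \<bar>s\<bar> ^ 3 * 1" using s e by (intro mult_left_mono) auto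
      finally show ?thesis by simp
    qed
    have "\<bar>antisym_part f s - (?b * s + d * s ^ 3)\<bar> \<le> B * s ^ 4"
      unfolding antisym_part_def by (rule even_odd_average(2)[OF T[OF s] T'[OF s]])
    also have "B * s ^ 4 \<le> \<bar>B\<bar> * \<bar>s\<bar> ^ 3" using s3 by (intro mult_mono) auto
    finally have b1: "\<bar>antisym_part f s - (?b * s + d * s ^ 3)\<bar> \<le> \<bar>B\<bar> * \<bar>s\<bar> ^ 3" .
    have b2: "\<bar>d * s ^ 3\<bar> \<le> \<bar>d\<bar> * \<bar>s\<bar> ^ 3" by (simp add: abs_mult power_abs)
    have b3: "\<bar>?b * (sin s - s)\<bar> \<le> \<bar>?b\<bar> * \<bar>s\<bar> ^ 3"
      unfolding abs_mult by (intro mult_left_mono sin_minus_self_bound) auto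
    have "antisym_part f s - ?b * sin s = (antisym_part f s - (?b * s + d * s ^ 3)) + d * s ^ 3 - ?b * (sin s - s)"
      by (simp add: algebra_simps)
    then have "\<bar>antisym_part f s - ?b * sin s\<bar> \<le> (\<bar>d\<bar> + \<bar>B\<bar> + \<bar>?b\<bar>) * \<bar>s\<bar> ^ 3"
      using b1 b2 b3 unfolding distrib_right by linarith
    then have "\<bar>antisym_part f s - ?b * sin s\<bar> * \<bar>sin s\<bar> \<le> ((\<bar>d\<bar> + \<bar>B\<bar> + \<bar>?b\<bar>) * \<bar>s\<bar> ^ 3) * \<bar>s\<bar>"
      by (intro mult_mono abs_sin_x_le_abs_x) auto
    moreover have "\<bar>antisym_part f s * sin s - ?b * (sin s)\<^sup>2\<bar> = \<bar>antisym_part f s - ?b * sin s\<bar> * \<bar>sin s\<bar>"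
      unfolding abs_mult[symmetric] by (simp add: power2_eq_square left_diff_distrib mult.assoc)
    moreover have "\<bar>s\<bar> ^ 3 * \<bar>s\<bar> = s ^ 4" by (simp add: power_even_abs_numeral[symmetric] eval_nat_numeral)
    ultimately show ?thesis by (simp only: mult.assoc)
  qed
  show ?thesis
  proof
    show "flat (\<lambda>s. sym_part f s - f 0 - ?a * (1 - cos s))"
    proof (rule flatI[OF _ sym_part_integrable sym_part_nonneg e even])
      show "(\<lambda>s. sym_part f s - f 0 - ?a * (1 - cos s)) \<in> borel_measurable arc" by measurable
      fix s
      have "\<bar>?a * (1 - cos s)\<bar> \<le> \<bar>?a\<bar> * 2"
        unfolding abs_mult using cos_ge_minus_one[of s] cos_le_one[of s] by (intro mult_left_mono) auto
      then have "\<bar>sym_part f s - f 0 - ?a * (1 - cos s)\<bar> \<le> sym_part f s + \<bar>f 0\<bar> + 2 * \<bar>?a\<bar>"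
        using sym_part_nonneg[of s] by linarith
      also have "\<dots> \<le> (1 + \<bar>f 0\<bar> + 2 * \<bar>?a\<bar>) * (1 + sym_part f s)"
        using sym_part_nonneg[of s] by (simp add: distrib_left distrib_right)
      finally show "\<bar>sym_part f s - f 0 - ?a * (1 - cos s)\<bar> \<le> (1 + \<bar>f 0\<bar> + 2 * \<bar>?a\<bar>) * (1 + sym_part f s)" .
    qed
    show "flat (\<lambda>s. antisym_part f s * sin s - ?b * (sin s)\<^sup>2)"
    proof (rule flatI[OF _ sym_part_integrable sym_part_nonneg e odd])
      show "(\<lambda>s. antisym_part f s * sin s - ?b * (sin s)\<^sup>2) \<in> borel_measurable arc" by measurable
      fix s
      have "\<bar>antisym_part f s * sin s\<bar> \<le> sym_part f s * 1"
        unfolding abs_mult using antisym_part_le[of s] by (intro mult_mono) auto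
      moreover have "\<bar>?b * (sin s)\<^sup>2\<bar> \<le> \<bar>?b\<bar> * 1"
        unfolding abs_mult by (intro mult_left_mono) (auto simp: abs_square_le_1)
      ultimately have "\<bar>antisym_part f s * sin s - ?b * (sin s)\<^sup>2\<bar> \<le> sym_part f s + \<bar>?b\<bar>" by linarith
      also have "\<dots> \<le> (1 + \<bar>?b\<bar>) * (1 + sym_part f s)"
        using sym_part_nonneg[of s] by (simp add: distrib_left distrib_right)
      finally show "\<bar>antisym_part f s * sin s - ?b * (sin s)\<^sup>2\<bar> \<le> (1 + \<bar>?b\<bar>) * (1 + sym_part f s)" .
    qed
  qed
qed

end

theorem theorem2p1:
  fixes M :: "'a measure" and \<xi> :: "int \<Rightarrow> 'a \<Rightarrow> complex" and \<gamma> :: "int \<Rightarrow> complex"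
    and F :: "real measure" and \<rho>\<^sub>1 :: "complex \<Rightarrow> real" and \<phi> :: real and f :: "real \<Rightarrow> real"
  assumes "prob_space M"
    and "complex_gaussian_process M \<xi>"
    and "stationary_process M \<xi>"
    and "has_covariance M \<xi> \<gamma>"
    and "\<gamma> 0 = 1"
    and "spectral_measure \<gamma> F"
    and "one_intensity M \<xi> \<rho>\<^sub>1"
    and "f \<in> borel_measurable borel"
    and "\<And>s. f s \<ge> 0"
    and "\<And>s. f (s + 2 * pi) = f s"
    and "rotated_measure F \<phi> = density (restrict_space lborel {-pi<..pi}) (\<lambda>s. ennreal (f s))"
    and "smooth_at f 0"
  shows
    "(f 0 > 0 \<longrightarrow>
       (\<lambda>r. \<rho>\<^sub>1 (of_real r * cis \<phi>)
          - (1 / (pi * (1 - r\<^sup>2)\<^sup>2)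
             - 1 / (4 * pi * (f 0)\<^sup>2) * ((deriv f 0)\<^sup>2 + (I_op (T_op (sym_part f)))\<^sup>2)))
       \<in> O[at_left 1](\<lambda>r. 1 - r\<^sup>2)) \<and>
     (f 0 = 0 \<longrightarrow>
       (\<lambda>r. \<rho>\<^sub>1 (of_real r * cis \<phi>)
          - 1 / (pi * (1 - r\<^sup>2)) * ((deriv ^^ 2) f 0 / (2 * I_op (T_op (sym_part f)))))
       \<in> O[at_left 1](\<lambda>_. 1)) \<and>
     (f 0 = 0 \<and> (deriv ^^ 2) f 0 = 0 \<longrightarrow>
       (\<lambda>r. \<rho>\<^sub>1 (of_real r * cis \<phi>)
          - 1 / pi *
            (((I_op (T_op (T_op (sym_part f))))\<^sup>2
              - (I_op (T_op (T_op (\<lambda>s. sym_part f s * cos s))))\<^sup>2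
              - (I_op (T_op (T_op (\<lambda>s. antisym_part f s * sin s))))\<^sup>2)
             / (4 * (I_op (T_op (sym_part f)))\<^sup>2)))
       \<in> O[at_left 1](\<lambda>r. 1 - r\<^sup>2))"
proof -
  interpret spectral_density M \<xi> \<gamma> F \<phi> f
    using assms by (simp add: spectral_density_def spectral_density_axioms_def spectral_gaussian_def spectral_gaussian_axioms_def)
  interpret b: boundary_expansion "sym_part f" "antisym_part f" "f 0" "(deriv ^^ 2) f 0" "deriv f 0"
    by (rule boundary_expansion_parts[OF assms(12)])
  have sym0: "sym_part f 0 = f 0" by (simp add: sym_part_def)
  have T1: "I_op (T_op (sym_part f)) = b.T1"
    by (simp add: I_op_T_op[OF parts_meas(1)] b.T1_def sym0)
  have rho: "\<rho>\<^sub>1 (of_real r * cis \<phi>) = b.zero_density r / pi" if "1/2 < r" "r < 1" for r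
  proof -
    have r: "0 \<le> r" "r < 1" using that by auto
    have "\<rho>\<^sub>1 (of_real r * cis \<phi>) = intensity (of_real r * cis \<phi>) / pi"
      by (rule one_intensity_eq[OF assms(7)]) (use r in \<open>simp add: norm_mult\<close>)
    then show ?thesis
      unfolding intensity_def K_radial[OF r] b.zero_density_def b.A0_def b.A1_def b.A2_def b.B1_def
      by (simp add: diff_diff_eq)
  qed
  have transfer: "(\<lambda>r. \<rho>\<^sub>1 (of_real r * cis \<phi>) - G r) \<in> O[at_left 1](H)"
    if "(\<lambda>r. b.zero_density r / pi - G r) \<in> O[at_left 1](H)" for G H :: "real \<Rightarrow> real"
  proof -
    have "eventually (\<lambda>r. b.zero_density r / pi - G r = \<rho>\<^sub>1 (of_real r * cis \<phi>) - G r) (at_left 1)"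
      using eventually_half_one by eventually_elim (simp add: rho)
    from iffD1[OF landau_o.big.in_cong[OF this] that] show ?thesis .
  qed
  have zero: "deriv f 0 = 0" "b.T1 \<noteq> 0" if f0: "f 0 = 0"
  proof -
    obtain e where e: "0 < e" "\<And>n x. \<bar>x\<bar> < e \<Longrightarrow> ((deriv ^^ n) f has_field_derivative (deriv ^^ Suc n) f x) (at x)"
      using smooth_at_derivative[OF assms(12)] by metis
    have "(f has_field_derivative deriv f 0) (at 0)" using e(2)[of 0 0] e(1) by simp
    \<comment> \<open>A zero of the nonnegative density is a minimum.\<close>
    then show "deriv f 0 = 0"
      by (rule DERIV_local_min[OF _ zero_less_one]) (use f_nonneg f0 in auto)
    then have flat: "flat (\<lambda>s. sym_part f s - (deriv ^^ 2) f 0 * (1 - cos s))"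
      using b.flat_even f0 by simp
    have int: "integrable arc (\<lambda>s. sym_part f s / (1 - cos s))"
    proof -
      have "integrable arc (\<lambda>s. (deriv ^^ 2) f 0 + (sym_part f s - (deriv ^^ 2) f 0 * (1 - cos s)) * (1 - cos s) / (1 - cos s)\<^sup>2)"
        by (intro Bochner_Integration.integrable_add flat_integrable_over_m flat_times_m flat) simp
      then show ?thesis
      proof (rule integrable_cong_AE_imp)
        show "(\<lambda>s. sym_part f s / (1 - cos s)) \<in> borel_measurable arc" by measurable
        show "AE s in arc. (deriv ^^ 2) f 0 + (sym_part f s - (deriv ^^ 2) f 0 * (1 - cos s)) * (1 - cos s) / (1 - cos s)\<^sup>2
            = sym_part f s / (1 - cos s)"
          using AE_arc_cos_neq by eventually_elim (simp add: power2_eq_square diff_divide_distrib)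
      qed
    qed
    \<comment> \<open>Positivity of \<open>T1\<close>: the density has mass \<open>1\<close> and \<open>1 - cos s \<le> 2\<close>.\<close>
    have "1 / 2 = (LINT s|arc. sym_part f s / 2)" using sym_part_integral by simp
    also have "\<dots> \<le> (LINT s|arc. sym_part f s / (1 - cos s))"
    proof (rule integral_mono_AE[OF _ int])
      show "integrable arc (\<lambda>s. sym_part f s / 2)" using sym_part_integrable by simp
      show "AE s in arc. sym_part f s / 2 \<le> sym_part f s / (1 - cos s)"
        using AE_arc_cos_neq
      proof eventually_elim
        case (elim s)
        have "0 < 1 - cos s" "1 - cos s \<le> 2" using elim cos_le_one[of s] cos_ge_minus_one[of s] by (auto simp: less_le)
        then show ?case using sym_part_nonneg[of s] by (intro divide_left_mono) auto
      qed
    qed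
    finally have "0 < (LINT s|arc. sym_part f s / (1 - cos s))" by simp
    then show "b.T1 \<noteq> 0" by (subst b.T1_def) (simp add: f0)
  qed
  show ?thesis
  proof (intro conjI impI)
    assume f0: "f 0 > 0"
    show "(\<lambda>r. \<rho>\<^sub>1 (of_real r * cis \<phi>)
          - (1 / (pi * (1 - r\<^sup>2)\<^sup>2)
             - 1 / (4 * pi * (f 0)\<^sup>2) * ((deriv f 0)\<^sup>2 + (I_op (T_op (sym_part f)))\<^sup>2)))
       \<in> O[at_left 1](\<lambda>r. 1 - r\<^sup>2)"
    proof (rule transfer)
      have "1 / pi * ((z - 1 / y) - - (1 / (4 * x) * c)) = z / pi - (1 / (pi * y) - 1 / (4 * pi * x) * c)" for x y z c :: real
        by (simp add: right_diff_distrib distrib_left)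
      from this approaches_imp_bigo[OF b.density_interior[OF f0], of "1 / pi"]
      show "(\<lambda>r. b.zero_density r / pi - (1 / (pi * (1 - r\<^sup>2)\<^sup>2)
             - 1 / (4 * pi * (f 0)\<^sup>2) * ((deriv f 0)\<^sup>2 + (I_op (T_op (sym_part f)))\<^sup>2)))
         \<in> O[at_left 1](\<lambda>r. 1 - r\<^sup>2)"
        unfolding T1 by (simp only:)
    qed
  next
    assume f0: "f 0 = 0"
    have "(\<lambda>_ :: real. 1 / pi) \<in> O[at_left 1](\<lambda>_. 1)" by simp
    from landau_o.big.mult[OF this b.density_boundary_zero[OF f0 zero[OF f0]]]
    have O: "(\<lambda>r. (1 / pi) * (b.zero_density r - 1 / (1 - r\<^sup>2) * ((deriv ^^ 2) f 0 / (2 * b.T1)))) \<in> O[at_left 1](\<lambda>_. 1)"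
      by (simp only: mult_1)
    show "(\<lambda>r. \<rho>\<^sub>1 (of_real r * cis \<phi>)
          - 1 / (pi * (1 - r\<^sup>2)) * ((deriv ^^ 2) f 0 / (2 * I_op (T_op (sym_part f)))))
       \<in> O[at_left 1](\<lambda>_. 1)"
    proof (intro transfer)
      have "(1 / pi) * (z - 1 / y * c) = z / pi - 1 / (pi * y) * c" for z y c :: real
        by (simp add: right_diff_distrib)
      from O[unfolded this] show "(\<lambda>r. b.zero_density r / pi - 1 / (pi * (1 - r\<^sup>2)) * ((deriv ^^ 2) f 0 / (2 * I_op (T_op (sym_part f)))))
         \<in> O[at_left 1](\<lambda>_. 1)" unfolding T1 .
    qed
  next
    assume "f 0 = 0 \<and> (deriv ^^ 2) f 0 = 0"
    then have f0: "f 0 = 0" and f2: "(deriv ^^ 2) f 0 = 0" by auto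
    define U where "U = I_op (T_op (T_op (sym_part f)))"
    define V where "V = I_op (T_op (T_op (\<lambda>s. sym_part f s * cos s)))"
    define W where "W = I_op (T_op (T_op (\<lambda>s. antisym_part f s * sin s)))"
    note d2 = second_derivatives_of_parts[OF assms(12)]
    have R: "b.R = sym_part f" by (rule ext, subst b.R_def) (simp add: f0 f2)
    have S: "b.S = (\<lambda>s. antisym_part f s * sin s)" by (rule ext, subst b.S_def) (simp add: zero(1)[OF f0])
    have U: "U = (LINT s|arc. b.R s / (1 - cos s)\<^sup>2) / (2 * pi)"
      unfolding U_def R by (rule I_op_T_op_T_op[OF parts_meas(1)]) (simp_all add: sym0 f0 f2 d2(1))
    have W: "W = (LINT s|arc. b.S s / (1 - cos s)\<^sup>2) / (2 * pi)"
      unfolding W_def S by (rule I_op_T_op_T_op) (simp_all add: d2(3) zero(1)[OF f0])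
    \<comment> \<open>Since \<open>cos s = 1 - (1 - cos s)\<close>, the operator with \<open>cos\<close> differs from the one without by one power of
      \<open>1 - cos s\<close>.\<close>
    have V: "V = U - b.T1"
    proof -
      have "V = (LINT s|arc. sym_part f s * cos s / (1 - cos s)\<^sup>2) / (2 * pi)"
        unfolding V_def by (rule I_op_T_op_T_op) (simp_all add: d2(2) sym0 f0 f2)
      also have "(LINT s|arc. sym_part f s * cos s / (1 - cos s)\<^sup>2)
          = (LINT s|arc. sym_part f s / (1 - cos s)\<^sup>2 - sym_part f s * (1 - cos s) / (1 - cos s)\<^sup>2)"
        by (simp add: diff_divide_distrib[symmetric] algebra_simps)
      also have "\<dots> = (LINT s|arc. sym_part f s / (1 - cos s)\<^sup>2) - (LINT s|arc. sym_part f s * (1 - cos s) / (1 - cos s)\<^sup>2)"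
        using flat_integrable_over_m[OF b.flat_R] flat_integrable_over_m[OF flat_times_m[OF b.flat_R]] unfolding R
        by (rule Bochner_Integration.integral_diff)
      also have "(LINT s|arc. sym_part f s * (1 - cos s) / (1 - cos s)\<^sup>2) = (LINT s|arc. sym_part f s / (1 - cos s))"
        by (rule flat_cancel)
      finally have "V = (LINT s|arc. b.R s / (1 - cos s)\<^sup>2) / (2 * pi) - (LINT s|arc. sym_part f s / (1 - cos s)) / (2 * pi)"
        by (simp only: R diff_divide_distrib)
      moreover have "b.T1 = (LINT s|arc. sym_part f s / (1 - cos s)) / (2 * pi)" by (subst b.T1_def) (simp add: f0)
      ultimately show ?thesis by (simp only: U)
    qed
    have "approaches b.zero_density ((U\<^sup>2 - V\<^sup>2 - W\<^sup>2) / (4 * b.T1\<^sup>2))"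
      using b.density_boundary_double_zero[OF f0 zero[OF f0] f2] unfolding U[symmetric] W[symmetric] V[symmetric] .
    from approaches_imp_bigo[OF this, of "1 / pi"]
    have "(\<lambda>r. b.zero_density r / pi - 1 / pi * ((U\<^sup>2 - V\<^sup>2 - W\<^sup>2) / (4 * b.T1\<^sup>2))) \<in> O[at_left 1](\<lambda>r. 1 - r\<^sup>2)"
      by (simp only: right_diff_distrib) simp
    from transfer[OF this] show "(\<lambda>r. \<rho>\<^sub>1 (of_real r * cis \<phi>)
          - 1 / pi *
            (((I_op (T_op (T_op (sym_part f))))\<^sup>2
              - (I_op (T_op (T_op (\<lambda>s. sym_part f s * cos s))))\<^sup>2
              - (I_op (T_op (T_op (\<lambda>s. antisym_part f s * sin s))))\<^sup>2)
             / (4 * (I_op (T_op (sym_part f)))\<^sup>2)))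
       \<in> O[at_left 1](\<lambda>r. 1 - r\<^sup>2)"
      unfolding U_def V_def W_def T1 .
  qed
qed

end
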